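(* Let $H, K$ be two finitely generated subgroups of a free group $F$. Let $S(H,K)$ be a set of representatives of those double cosets $HgK$, $g\in F$, for which $H\cap gKg^{-1}$ is nontrivial, and let $L=\langle H,K,S(H,K)\rangle$ be the subgroup of $F$ generated by $H$, $K$ and $S(H,K)$. Suppose that neither $H$ nor $K$ has finite index in $L$. Then there is an epimorphism $\eta: L\to F_2$, where $F_2$ is a free group of rank 2, such that: (1) the restriction of $\eta$ to $H$ is injective and the restriction of $\eta$ to $K$ is injective; (2) the set $S(\eta(H),\eta(K))$ for the subgroups $\eta(H),\eta(K)$ of $F_2$ can be taken to be $\eta(S(H,K))$, i.e. $\eta(S(H,K))$ is a set of representatives of those double cosets $\eta(H)\,g\,\eta(K)$, $g\in F_2$, for which $\eta(H)\cap g\,\eta(K)g^{-1}$ is nontrivial; (3) for every $s\in S(H,K)$, the restriction $$\eta_s: H\cap sKs^{-1}\to \eta(H)\cap \eta(s)\eta(K)\eta(s)^{-1}$$ of $\eta$ to $H\cap sKs^{-1}$ is surjective.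
   Context: For subgroups $H,K$ of a free group $F$, $S(H,K)$ denotes a set containing exactly one representative from each double coset $HgK$, $g\in F$, such that $H\cap gKg^{-1}\neq\{1\}$ (and no other elements). For finitely generated $H,K$ this set is known to be finite. *)

theory Defs
  imports "HOL-Algebra.Algebra"
begin

text \<open>
  A word over \<open>B\<close> is a list of letters \<open>(x, e)\<close> with \<open>x \<in> B\<close>, where \<open>(x, True)\<close> stands for \<open>x\<close>
  and \<open>(x, False)\<close> for its formal inverse.
\<close>

definition reduced_words :: "'a set \<Rightarrow> ('a \<times> bool) list set" where
  "reduced_words B =
     {w. set w \<subseteq> B \<times> UNIV \<and> successively (\<lambda>(x, a) (y, b). x = y \<longrightarrow> a = b) w}"

definition word_value :: "('a, 'c) monoid_scheme \<Rightarrow> ('a \<times> bool) list \<Rightarrow> 'a" where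
  "word_value G w =
     foldr (\<lambda>(x, e) y. (if e then x else inv\<^bsub>G\<^esub> x) \<otimes>\<^bsub>G\<^esub> y) w \<one>\<^bsub>G\<^esub>"

text \<open>
  \<open>B\<close> is a basis of \<open>G\<close> when every element of \<open>G\<close> is the value of exactly one reduced word over \<open>B\<close>.
\<close>

definition free_basis :: "('a, 'c) monoid_scheme \<Rightarrow> 'a set \<Rightarrow> bool" where
  "free_basis G B \<longleftrightarrow>
     B \<subseteq> carrier G \<and> bij_betw (word_value G) (reduced_words B) (carrier G)"

definition free_group :: "('a, 'c) monoid_scheme \<Rightarrow> bool" where
  "free_group G \<longleftrightarrow> group G \<and> (\<exists>B. free_basis G B)"

definition free_group_of_rank :: "('a, 'c) monoid_scheme \<Rightarrow> nat \<Rightarrow> bool" where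
  "free_group_of_rank G n \<longleftrightarrow>
     group G \<and> (\<exists>B. free_basis G B \<and> finite B \<and> card B = n)"

definition fin_gen_subgroup :: "'a set \<Rightarrow> ('a, 'c) monoid_scheme \<Rightarrow> bool" where
  "fin_gen_subgroup H G \<longleftrightarrow>
     subgroup H G \<and> (\<exists>B. finite B \<and> B \<subseteq> carrier G \<and> generate G B = H)"

text \<open>\<open>card\<close> of an infinite set is 0, so finite index is expressed by finiteness of the set of cosets.\<close>

definition finite_index :: "'a set \<Rightarrow> ('a, 'c) monoid_scheme \<Rightarrow> bool" where
  "finite_index H G \<longleftrightarrow> subgroup H G \<and> finite (rcosets\<^bsub>G\<^esub> H)"

definition double_coset :: "('a, 'c) monoid_scheme \<Rightarrow> 'a set \<Rightarrow> 'a \<Rightarrow> 'a set \<Rightarrow> 'a set" where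
  "double_coset G H g K = (H #>\<^bsub>G\<^esub> g) <#>\<^bsub>G\<^esub> K"

definition conj_subgroup :: "('a, 'c) monoid_scheme \<Rightarrow> 'a \<Rightarrow> 'a set \<Rightarrow> 'a set" where
  "conj_subgroup G g K = (g <#\<^bsub>G\<^esub> K) #>\<^bsub>G\<^esub> inv\<^bsub>G\<^esub> g"

text \<open>
  \<open>S\<close> is an admissible choice of \<open>S(H, K)\<close>: the last clause says that each relevant double coset
  contains exactly one element of \<open>S\<close>, the first two that \<open>S\<close> has no other elements.
\<close>

definition is_double_coset_reps ::
  "('a, 'c) monoid_scheme \<Rightarrow> 'a set \<Rightarrow> 'a set \<Rightarrow> 'a set \<Rightarrow> bool" where
  "is_double_coset_reps G H K S \<longleftrightarrow>
     S \<subseteq> carrier G \<and>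
     (\<forall>s\<in>S. H \<inter> conj_subgroup G s K \<noteq> {\<one>\<^bsub>G\<^esub>}) \<and>
     (\<forall>g\<in>carrier G. H \<inter> conj_subgroup G g K \<noteq> {\<one>\<^bsub>G\<^esub>} \<longrightarrow>
        (\<exists>!s. s \<in> S \<and> s \<in> double_coset G H g K))"

end

theory Submission
  imports Defs "HOL-Library.Sublist"
begin

text \<open>
  An epimorphism \<open>\<eta>\<close> has the required properties as soon as it is injective on \<open>H\<close> and \<open>K\<close>, lifts
  every conjugacy between non-trivial elements of the images of \<open>H\<close> and \<open>K\<close>, and creates no
  new conjugacies along an element that already conjugates a non-trivial element of \<open>H\<close> into \<open>K\<close>.
  These properties are stable under composition, so it is enough to lower the rank of \<open>L\<close> by
  one at a time. (The rank is finite: the free factor spanned by the letters of \<open>H\<close> and \<open>K\<close>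
  is malnormal, hence contains \<open>S(H, K)\<close>.)

  Choose a basis of \<open>L\<close> for which the total number of finite orbits of the basis elements on the
  cosets of \<open>H\<close> and \<open>K\<close> is minimal. Replacing a basis element \<open>x\<close> by \<open>x y\<^sup>M\<close> for a suitable multiple
  \<open>M\<close> of all relevant periods shows that the finite orbits of \<open>x\<close> and \<open>y\<close> have the same union,
  which is then invariant under \<open>L\<close>; since the index is infinite, there are no finite orbits at all.
  It follows that for a basis element \<open>c\<close> some power \<open>c\<^sup>n\<close> occurs in no reduced word of \<open>H\<close> or \<open>K\<close>.

  Given two further basis elements \<open>d\<close> and \<open>e\<close>, map \<open>e\<close> to \<open>c\<^sup>n d c\<^sup>3\<^sup>n d c\<^sup>n\<close> and fix the others. In the
  images of \<open>H\<close> and \<open>K\<close> the run \<open>c\<^sup>3\<^sup>n\<close> occurs only inside the images of \<open>e\<close>, so reduced words, and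
  periodic words in particular, can be decoded locally; and \<open>c\<^sup>3\<^sup>n\<^sup>+\<^sup>1\<close> does not occur, so that the step
  can be repeated.
\<close>

section \<open>Free groups of reduced words\<close>

text \<open>The obstacle is that elements of \<open>H\<close> and \<open>K\<close> which are not
  conjugate in \<open>L\<close> may become conjugate in the image. In a free group, conjugacy is
  rotation of cyclically reduced words, and taking powers inside \<open>H\<close> or
  \<open>K\<close> repeats a period as often as wanted. A decoding rule that looks at a bounded
  window, and may fail near the ends of a word, therefore still determines every letter of a period.
  The exponent \<open>3n\<close> has to exceed every accidental run of \<open>c\<close> in front of
  a \<open>d\<close>: less than \<open>n\<close> comes from the source, at most \<open>n\<close>
  from the end of a preceding image of \<open>e\<close>, and at most \<open>n\<close> from the
  beginning of the present one. The outer powers \<open>c^n\<close> keep a \<open>d\<close> of the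
  source from cancelling against a \<open>d\<close> produced by \<open>e\<close>. That some
  \<open>c^n\<close> does not occur rests on finite generation: prefixes of words of
  \<open>H\<close> reach only finitely many cosets, so a long run of \<open>c\<close> would return
  to a coset and close up to a finite orbit. One letter \<open>c\<close> must serve both subgroups,
  hence a single minimisation for \<open>H\<close> and \<open>K\<close> together. Ranks below 2 are
  excluded because infinite index would make \<open>H\<close> and \<open>K\<close>, and then
  \<open>L\<close>, trivial.\<close>

type_synonym 'x word = "('x \<times> bool) list"

definition linv :: "'x \<times> bool \<Rightarrow> 'x \<times> bool" where
  "linv l = (fst l, \<not> snd l)"

definition reduced :: "'x word \<Rightarrow> bool" where
  "reduced = successively (\<lambda>l m. m \<noteq> linv l)"

text \<open>Van der Waerden's device: letters act on reduced words by prepending with cancellation,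
  and \<open>lcons_linv\<close> makes this action invertible. Reduction becomes a fold, and
  associativity needs no confluence argument.\<close>

definition lcons :: "'x \<times> bool \<Rightarrow> 'x word \<Rightarrow> 'x word" where
  "lcons l w = (case w of [] \<Rightarrow> [l] | m # w' \<Rightarrow> if m = linv l then w' else l # w)"

definition winv :: "'x word \<Rightarrow> 'x word" where
  "winv w = rev (map linv w)"

definition reduce :: "'x word \<Rightarrow> 'x word" where
  "reduce w = foldr lcons w []"

lemma linv_linv [simp]: "linv (linv l) = l"
  by (simp add: linv_def)

lemma linv_neq [simp]: "linv l \<noteq> l" "l \<noteq> linv l"
  by (auto simp: linv_def prod_eq_iff)

lemma linv_eq_iff [simp]: "linv l = linv m \<longleftrightarrow> l = m"
  by (auto simp: linv_def prod_eq_iff)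

lemma linv_swap: "linv l = m \<longleftrightarrow> l = linv m"
  by auto

lemma fst_linv [simp]: "fst (linv l) = fst l"
  by (simp add: linv_def)

lemma linv_Pair [simp]: "linv (x, b) = (x, \<not> b)"
  by (simp add: linv_def)

lemma winv_simps [simp]: "winv [] = []" "winv (l # w) = winv w @ [linv l]"
  by (simp_all add: winv_def)

lemma winv_append [simp]: "winv (u @ v) = winv v @ winv u"
  by (simp add: winv_def)

lemma winv_winv [simp]: "winv (winv w) = w"
  by (induction w) auto

lemma length_winv [simp]: "length (winv w) = length w"
  by (simp add: winv_def)

lemma winv_eq_Nil [simp]: "winv w = [] \<longleftrightarrow> w = []"
  by (simp add: winv_def)

lemma fst_set_winv [simp]: "fst ` set (winv w) = fst ` set w"
  by (force simp: winv_def)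

lemma reduce_Nil [simp]: "reduce [] = []"
  by (simp add: reduce_def)

lemma reduced_Nil [simp]: "reduced []"
  by (simp add: reduced_def)

lemma reduced_single [simp]: "reduced [l]"
  by (simp add: reduced_def)

lemma reduced_Cons_Cons [simp]: "reduced (l # m # w) \<longleftrightarrow> m \<noteq> linv l \<and> reduced (m # w)"
  by (simp add: reduced_def)

lemma reduced_append:
  "reduced (u @ v) \<longleftrightarrow> reduced u \<and> reduced v \<and> (u \<noteq> [] \<longrightarrow> v \<noteq> [] \<longrightarrow> hd v \<noteq> linv (last u))"
  by (auto simp: reduced_def successively_append_iff)

lemma reduced_Cons: "reduced (l # w) \<longleftrightarrow> reduced w \<and> (w \<noteq> [] \<longrightarrow> hd w \<noteq> linv l)"
  by (cases w) auto

lemma reduced_appendD: "reduced (u @ v) \<Longrightarrow> reduced u \<and> reduced v"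
  by (simp add: reduced_append)

lemma reduced_winv [simp]: "reduced (winv w) \<longleftrightarrow> reduced w"
proof -
  have *: "reduced (winv w)" if "reduced w" for w :: "'x word"
    using that
  proof (induction w)
    case (Cons l w)
    then show ?case
      by (cases w) (auto simp: reduced_append linv_swap)
  qed simp
  show ?thesis using *[of w] *[of "winv w"] by auto
qed

lemma reduced_lcons: "reduced w \<Longrightarrow> reduced (lcons l w)"
  by (cases w) (auto simp: lcons_def reduced_Cons)

lemma lcons_linv: "reduced w \<Longrightarrow> lcons l (lcons (linv l) w) = w"
  by (cases w) (auto simp: lcons_def reduced_Cons split: list.splits)

lemma reduced_reduce [simp]: "reduced (reduce w)"
  unfolding reduce_def by (induction w) (auto intro: reduced_lcons)

lemma lcons_reduced: "reduced (l # w) \<Longrightarrow> lcons l w = l # w"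
  by (cases w) (auto simp: lcons_def)

lemma reduce_reduced [simp]: "reduced w \<Longrightarrow> reduce w = w"
proof (induction w)
  case (Cons l w)
  then have "reduced w" by (simp add: reduced_Cons)
  then show ?case using Cons by (simp add: reduce_def lcons_reduced)
qed (simp add: reduce_def)

lemma reduce_Cons: "reduce (l # w) = lcons l (reduce w)"
  by (simp add: reduce_def)

lemma reduce_append_right: "reduce (u @ reduce v) = reduce (u @ v)"
  by (induction u) (auto simp: reduce_Cons)

lemma reduce_lcons_append: "reduce (lcons l u @ v) = lcons l (reduce (u @ v))"
proof (cases u)
  case Nil
  then show ?thesis by (simp add: lcons_def[of l "[]"] reduce_Cons)
next
  case (Cons m w)
  then show ?thesis
    by (cases "m = linv l") (simp_all add: lcons_def[of l "_ # _"] reduce_Cons lcons_linv)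
qed

lemma reduce_append_left: "reduce (reduce u @ v) = reduce (u @ v)"
  by (induction u) (simp_all add: reduce_Cons reduce_lcons_append)

lemma reduce_append_winv: "reduce (w @ winv w) = []"
proof (induction w)
  case (Cons l w)
  have "reduce (l # w @ winv w @ [linv l]) = lcons l (reduce (reduce (w @ winv w) @ [linv l]))"
    by (simp add: reduce_Cons reduce_append_left)
  then show ?case using Cons by (simp add: reduce_Cons lcons_def)
qed (simp add: reduce_def)

lemma set_reduce: "set (reduce w) \<subseteq> set w"
proof (induction w)
  case (Cons l w)
  then show ?case
    by (cases "reduce w") (auto simp: reduce_Cons lcons_def split: if_splits)
qed (simp add: reduce_def)

section \<open>The free group on all letters of a type\<close>

typedef 'x fg = "{w :: 'x word. reduced w}"
  morphisms word Abs_fg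
  by (rule exI[of _ "[]"]) simp

definition mk :: "'x word \<Rightarrow> 'x fg" where
  "mk w = Abs_fg (reduce w)"

lemma reduced_word [simp]: "reduced (word g)"
  using word by auto

lemma word_mk_reduce: "word (mk w) = reduce w"
  by (simp add: mk_def Abs_fg_inverse)

lemma word_mk [simp]: "reduced w \<Longrightarrow> word (mk w) = w"
  by (simp add: word_mk_reduce)

lemma mk_word [simp]: "mk (word g) = g"
  by (simp add: mk_def word_inverse)

lemma mk_reduce [simp]: "mk (reduce w) = mk w"
  by (simp add: mk_def)

lemma fg_eqI: "word g = word h \<Longrightarrow> g = h"
  by (simp add: word_inject)

instantiation fg :: (type) "{monoid_mult, inverse}"
begin

definition one_fg :: "'a fg" where "one_fg = mk []"
definition times_fg :: "'a fg \<Rightarrow> 'a fg \<Rightarrow> 'a fg" where "g * h = mk (word g @ word h)"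
definition inverse_fg :: "'a fg \<Rightarrow> 'a fg" where "inverse g = mk (winv (word g))"
definition divide_fg :: "'a fg \<Rightarrow> 'a fg \<Rightarrow> 'a fg" where "g div h = g * inverse (h :: 'a fg)"

instance
proof
  fix a b c :: "'a fg"
  show "a * b * c = a * (b * c)"
    by (rule fg_eqI) (simp add: times_fg_def word_mk_reduce reduce_append_left reduce_append_right)
  show "1 * a = a" "a * 1 = a"
    by (simp_all add: one_fg_def times_fg_def)
qed

end

lemma mk_append: "mk (u @ v) = mk u * mk v"
  by (rule fg_eqI)
    (simp add: times_fg_def word_mk_reduce reduce_append_left reduce_append_right)

lemma mk_Nil [simp]: "mk [] = 1"
  by (simp add: one_fg_def)

lemma word_one [simp]: "word 1 = []"
  by (simp flip: mk_Nil)

lemma word_eq_Nil [simp]: "word g = [] \<longleftrightarrow> g = 1"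
  by (metis word_one word_inject)

lemma word_inv [simp]: "word (inverse g) = winv (word g)"
  by (simp add: inverse_fg_def)

lemma fg_right_inverse [simp]: "(g :: 'x fg) * inverse g = 1"
  by (rule fg_eqI) (simp add: times_fg_def word_mk_reduce reduce_append_winv)

lemma fg_inverse_inverse [simp]: "inverse (inverse g) = (g :: 'x fg)"
  by (rule fg_eqI) simp

lemma fg_left_inverse [simp]: "inverse g * (g :: 'x fg) = 1"
  using fg_right_inverse[of "inverse g"] by simp

lemma fg_inverse_cancel_left [simp]: "inverse g * (g * h) = (h :: 'x fg)" "g * (inverse g * h) = h"
  by (simp_all flip: mult.assoc)

lemma fg_mult_left_cancel [simp]: "(g :: 'x fg) * h = g * k \<longleftrightarrow> h = k"
  by (metis fg_inverse_cancel_left(1))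

lemma fg_mult_right_cancel [simp]: "(h :: 'x fg) * g = k * g \<longleftrightarrow> h = k"
  by (metis fg_right_inverse mult.assoc mult.right_neutral)

lemma fg_inverse_unique: "(g :: 'x fg) * h = 1 \<Longrightarrow> inverse g = h"
  by (metis fg_mult_left_cancel fg_right_inverse)

lemma fg_inverse_mult: "inverse (g * h) = inverse h * inverse (g :: 'x fg)"
  by (rule fg_inverse_unique) (simp add: mult.assoc)

lemma fg_inverse_one [simp]: "inverse 1 = (1 :: 'x fg)"
  by (rule fg_inverse_unique) simp

lemma fg_inverse_eq_1 [simp]: "inverse g = 1 \<longleftrightarrow> g = (1 :: 'x fg)"
  by (metis fg_inverse_inverse fg_inverse_one)

lemma fg_inverse_power: "inverse (g ^ n) = inverse (g :: 'x fg) ^ n"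
  by (induction n) (simp_all add: fg_inverse_mult power_commutes)

lemma fg_conj_power: "(g * h * inverse g) ^ n = g * h ^ n * inverse (g :: 'x fg)"
  by (induction n) (simp_all add: mult.assoc)

lemma mk_winv: "mk (winv w) = inverse (mk w)"
  by (rule sym, rule fg_inverse_unique, rule fg_eqI)
    (simp add: mk_append[symmetric] word_mk_reduce reduce_append_winv)

lemma word_mult: "reduced (word g @ word h) \<Longrightarrow> word (g * h) = word g @ word h"
  by (simp add: times_fg_def)

text \<open>The source of all later length estimates: since the cancelled part \<open>t\<close> is a
  suffix of one factor and, inverted, a prefix of the other, a short factor can destroy only a short
  piece of a long one.\<close>

lemma mult_cancellation:
  obtains u t v where "word g = u @ t" "word h = winv t @ v" "word (g * h) = u @ v"
proof -
  have "\<exists>u t v. word g = u @ t \<and> w = winv t @ v \<and> reduced (u @ v)" if "reduced w" for w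
    using that
  proof (induction "length (word g)" arbitrary: g w)
    case 0
    then show ?case by (intro exI[of _ "[]"] exI[of _ w]) auto
  next
    case (Suc n)
    then have "word g \<noteq> []" by auto
    then obtain g' l where g: "word g = g' @ [l]" by (metis rev_exhaust)
    then have rg: "reduced g'" using reduced_word[of g] by (simp add: reduced_append del: reduced_word)
    show ?case
    proof (cases "\<exists>w'. w = linv l # w'")
      case True
      then obtain w' where w: "w = linv l # w'" by auto
      then have "reduced w'" using Suc by (simp add: reduced_Cons)
      moreover have "n = length (word (mk g'))" using Suc g rg by simp
      ultimately obtain u t v where "g' = u @ t" "w' = winv t @ v" "reduced (u @ v)"
        using Suc(1)[of "mk g'" w'] rg by auto
      then show ?thesis using g w
        by (intro exI[of _ u] exI[of _ "t @ [l]"] exI[of _ v]) auto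
    next
      case False
      then have "reduced (word g @ w)"
        using g Suc(3) reduced_word[of g]
        by (cases w) (auto simp: reduced_append simp del: reduced_word)
      then show ?thesis
        by (intro exI[of _ "word g"] exI[of _ "[]"] exI[of _ w]) auto
    qed
  qed
  from this[OF reduced_word[of h]] obtain u t v
    where *: "word g = u @ t" "word h = winv t @ v" "reduced (u @ v)" by auto
  have "g * h = mk (word g) * mk (word h)" by simp
  also have "\<dots> = mk u * mk v"
    unfolding * mk_append mk_winv by (simp add: mult.assoc)
  finally have "word (g * h) = u @ v" using * by (simp flip: mk_append)
  then show ?thesis using * that by blast
qed

text \<open>The free factor spanned by the letters in \<open>A\<close>. All ranks live in one type,
  so lowering the rank only shrinks \<open>A\<close>.\<close>

definition Fr :: "'x set \<Rightarrow> 'x fg set" where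
  "Fr A = {g. fst ` set (word g) \<subseteq> A}"

definition gen :: "'x \<Rightarrow> 'x fg" where
  "gen x = mk [(x, True)]"

lemma word_gen [simp]: "word (gen x) = [(x, True)]"
  by (simp add: gen_def)

lemma mk_single: "mk [(x, b)] = (if b then gen x else inverse (gen x))"
  using mk_winv[of "[(x, True)]"] by (simp add: gen_def)

lemma mk_in_Fr: "fst ` set w \<subseteq> A \<Longrightarrow> mk w \<in> Fr A"
  unfolding Fr_def using set_reduce[of w] by (auto simp: word_mk_reduce)

lemma gen_in_Fr [simp]: "gen x \<in> Fr A \<longleftrightarrow> x \<in> A"
  by (simp add: Fr_def)

lemma Fr_one [simp]: "1 \<in> Fr A"
  by (simp add: Fr_def)

lemma Fr_mult [simp]: "g \<in> Fr A \<Longrightarrow> h \<in> Fr A \<Longrightarrow> g * h \<in> Fr A"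
  unfolding times_fg_def by (rule mk_in_Fr) (auto simp: Fr_def)

lemma Fr_inverse [simp]: "inverse g \<in> Fr A \<longleftrightarrow> g \<in> Fr A"
  by (simp add: Fr_def)

lemma Fr_power [simp]: "g \<in> Fr A \<Longrightarrow> g ^ n \<in> Fr A"
  by (induction n) auto

lemma Fr_mono: "A \<subseteq> Y \<Longrightarrow> Fr A \<subseteq> Fr Y"
  by (auto simp: Fr_def)

lemma Fr_UNIV [simp]: "Fr UNIV = UNIV"
  by (simp add: Fr_def)

lemma Fr_induct [consumes 1, case_names one gen inv]:
  assumes "g \<in> Fr A" "P 1"
    and "\<And>x g. x \<in> A \<Longrightarrow> g \<in> Fr A \<Longrightarrow> P g \<Longrightarrow> P (gen x * g)"
    and "\<And>x g. x \<in> A \<Longrightarrow> g \<in> Fr A \<Longrightarrow> P g \<Longrightarrow> P (inverse (gen x) * g)"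
  shows "P g"
proof -
  have "P (mk w)" if "fst ` set w \<subseteq> A" for w
    using that
  proof (induction w)
    case (Cons l w)
    obtain x b where l: "l = (x, b)" by (cases l)
    have "mk (l # w) = mk [l] * mk w" by (simp flip: mk_append)
    moreover have "mk w \<in> Fr A" using Cons by (intro mk_in_Fr) auto
    ultimately show ?case using Cons assms l by (simp add: mk_single)
  qed (use assms in simp)
  from this[of "word g"] assms(1) show ?thesis by (simp add: Fr_def)
qed

definition FG :: "'x set \<Rightarrow> 'x fg monoid" where
  "FG A = \<lparr>carrier = Fr A, monoid.mult = (*), one = 1\<rparr>"

lemma FG_simps [simp]: "carrier (FG A) = Fr A" "monoid.mult (FG A) = (*)" "monoid.one (FG A) = 1"
  by (simp_all add: FG_def)

lemma group_FG [simp]: "group (FG A)"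
proof (rule groupI)
  fix g assume "g \<in> carrier (FG A)"
  then show "\<exists>h\<in>carrier (FG A). h \<otimes>\<^bsub>FG A\<^esub> g = \<one>\<^bsub>FG A\<^esub>"
    by (intro bexI[of _ "inverse g"]) auto
qed (auto simp: mult.assoc)

lemma inv_FG [simp]: "g \<in> Fr A \<Longrightarrow> inv\<^bsub>FG A\<^esub> g = inverse g"
  by (rule group.inv_equality) auto

section \<open>Evaluation of words and homomorphisms\<close>

definition gval :: "('g, 'c) monoid_scheme \<Rightarrow> ('x \<Rightarrow> 'g) \<Rightarrow> 'x word \<Rightarrow> 'g" where
  "gval G f w = foldr (\<lambda>(x, e) y. (if e then f x else inv\<^bsub>G\<^esub> f x) \<otimes>\<^bsub>G\<^esub> y) w \<one>\<^bsub>G\<^esub>"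

lemma word_value_eq_gval: "word_value G = gval G (\<lambda>x. x)"
  by (rule ext) (simp add: word_value_def gval_def)

context
  fixes G (structure) and f :: "'x \<Rightarrow> 'g" and A
  assumes G: "group G" and f: "\<And>x. x \<in> A \<Longrightarrow> f x \<in> carrier G"
begin

interpretation group G by (rule G)

lemma gval_closed: "fst ` set w \<subseteq> A \<Longrightarrow> gval G f w \<in> carrier G"
  by (induction w) (auto simp: gval_def f)

lemma gval_lcons:
  assumes "fst ` set (l # w) \<subseteq> A"
  shows "gval G f (lcons l w) = gval G f (l # w)"
proof (cases "\<exists>w'. w = linv l # w'")
  case True
  then obtain w' where w: "w = linv l # w'" by auto
  obtain x b where l: "l = (x, b)" by (cases l)
  have "gval G f w' \<in> carrier G" using assms w by (intro gval_closed) auto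
  moreover have "f x \<in> carrier G" using assms l f by auto
  ultimately show ?thesis using w l
    by (auto simp: lcons_def gval_def m_assoc[symmetric])
next
  case False
  then show ?thesis by (auto simp: lcons_def split: list.splits)
qed

lemma gval_reduce:
  assumes "fst ` set w \<subseteq> A"
  shows "gval G f (reduce w) = gval G f w"
  using assms
proof (induction w)
  case (Cons l w)
  have "gval G f (reduce (l # w)) = gval G f (l # reduce w)"
    unfolding reduce_Cons using Cons.prems set_reduce[of w] by (intro gval_lcons) auto
  then show ?case using Cons by (auto simp: gval_def split: prod.splits)
qed (simp add: reduce_def)

lemma gval_append:
  assumes "fst ` set u \<subseteq> A" "fst ` set v \<subseteq> A"
  shows "gval G f (u @ v) = gval G f u \<otimes> gval G f v"
  using assms
proof (induction u)
  case (Cons l u)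
  have "gval G f u \<in> carrier G" "gval G f v \<in> carrier G" using Cons by (auto intro: gval_closed)
  with Cons show ?case using f by (auto simp: gval_def m_assoc split: prod.splits)
qed (use gval_closed[of v] in \<open>auto simp: gval_def\<close>)

lemma gval_hom: "(\<lambda>g. gval G f (word g)) \<in> hom (FG A) G"
proof (rule homI)
  fix g h assume "g \<in> carrier (FG A)" "h \<in> carrier (FG A)"
  then show "gval G f (word (g \<otimes>\<^bsub>FG A\<^esub> h)) = gval G f (word g) \<otimes> gval G f (word h)"
    by (subst gval_append[symmetric])
      (simp_all add: times_fg_def word_mk_reduce Fr_def gval_reduce image_Un)
qed (auto simp: Fr_def intro: gval_closed)

end

definition ext_hom :: "('x \<Rightarrow> 'y fg) \<Rightarrow> 'x fg \<Rightarrow> 'y fg" where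
  "ext_hom f g = gval (FG UNIV) f (word g)"

lemma ext_hom_mult [simp]: "ext_hom f (g * h) = ext_hom f g * ext_hom f h"
  using hom_mult[OF gval_hom[of "FG UNIV" UNIV f], of g h] by (simp add: ext_hom_def)

lemma ext_hom_one [simp]: "ext_hom f 1 = 1"
  by (simp add: ext_hom_def gval_def)

lemma ext_hom_gen [simp]: "ext_hom f (gen x) = f x"
  by (simp add: ext_hom_def gval_def)

lemma ext_hom_inverse [simp]: "ext_hom f (inverse g) = inverse (ext_hom f g)"
  by (rule sym, rule fg_inverse_unique) (simp flip: ext_hom_mult)

lemma ext_hom_power [simp]: "ext_hom f (g ^ n) = ext_hom f g ^ n"
  by (induction n) auto

lemma ext_hom_Fr:
  assumes "\<And>x. x \<in> A \<Longrightarrow> f x \<in> Fr B" "g \<in> Fr A"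
  shows "ext_hom f g \<in> Fr B"
  using assms(2) by (induction g rule: Fr_induct) (use assms(1) in auto)

section \<open>Cyclically reduced words\<close>

definition wpow :: "nat \<Rightarrow> 'a list \<Rightarrow> 'a list" where
  "wpow n w = concat (replicate n w)"

lemma wpow_0 [simp]: "wpow 0 w = []"
  and wpow_Suc [simp]: "wpow (Suc n) w = w @ wpow n w"
  by (simp_all add: wpow_def)

lemma wpow_add: "wpow (m + n) w = wpow m w @ wpow n w"
  by (induction m) auto

lemma wpow_commute [simp]: "wpow n w @ w = w @ wpow n w"
  by (induction n) auto

lemma wpow_commute_left [simp]: "wpow n w @ w @ v = w @ wpow n w @ v"
  by (induction n) auto

lemma length_wpow [simp]: "length (wpow n w) = n * length w"
  by (induction n) auto

lemma map_wpow: "map f (wpow n w) = wpow n (map f w)"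
  by (induction n) auto

lemma mk_wpow: "mk (wpow n w) = mk w ^ n"
  by (induction n) (auto simp: mk_append)

lemma winv_wpow: "winv (wpow n w) = wpow n (winv w)"
  by (induction n) auto

lemma le_length_wpow: "w \<noteq> [] \<Longrightarrow> n \<le> length (wpow n w)"
  by (cases w) auto

text \<open>Cyclic reducedness, stated through \<open>w @ w\<close> so that reducedness of
  \<open>w\<close> and of the junction come in one formula; powers are then plain
  repetitions.\<close>

definition cyc :: "'x word \<Rightarrow> bool" where
  "cyc w \<longleftrightarrow> w \<noteq> [] \<and> reduced (w @ w)"

lemma reduced_glue: "reduced (a @ y) \<Longrightarrow> reduced (y @ b) \<Longrightarrow> y \<noteq> [] \<Longrightarrow> reduced (a @ y @ b)"
  by (auto simp: reduced_append)

lemma cyc_reduced: "cyc w \<Longrightarrow> reduced w"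
  by (simp add: cyc_def reduced_append)

lemma reduced_wpow_append:
  assumes "cyc y" "reduced (y @ b)"
  shows "reduced (wpow n y @ y @ b)"
proof -
  have "reduced (y @ wpow n y @ b)"
  proof (induction n)
    case (Suc n)
    then show ?case using assms(1) reduced_glue[of y y "wpow n y @ b"] by (simp add: cyc_def)
  qed (use assms in simp)
  then show ?thesis by simp
qed

lemma reduced_wpow: "cyc y \<Longrightarrow> reduced (wpow n y)"
  using reduced_wpow_append[of y "[]" n] by (auto simp: cyc_reduced reduced_append)

lemma word_mk_power: "cyc y \<Longrightarrow> word (mk y ^ n) = wpow n y"
  by (simp add: reduced_wpow flip: mk_wpow)

lemma reduced_append_wpow:
  "cyc y \<Longrightarrow> reduced (a @ y) \<Longrightarrow> reduced (a @ y @ wpow n y)"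
  by (rule reduced_glue) (use reduced_wpow[of y "Suc n"] in \<open>auto simp: cyc_def\<close>)

lemma cyc_winv: "cyc y \<Longrightarrow> cyc (winv y)"
  unfolding cyc_def by (metis reduced_winv winv_append winv_eq_Nil)

lemma cyc_decomposition:
  assumes "g \<noteq> 1"
  obtains t w where "word g = t @ w @ winv t" "cyc w"
proof -
  have "\<exists>t w. v = t @ w @ winv t \<and> cyc w" if "reduced v" "v \<noteq> []" for v :: "'a word"
    using that
  proof (induction "length v" arbitrary: v rule: less_induct)
    case less
    show ?case
    proof (cases "cyc v")
      case True
      then show ?thesis by (intro exI[of _ "[]"] exI[of _ v]) simp
    next
      case False
      then have hd: "hd v = linv (last v)"
        using less.prems by (auto simp: cyc_def reduced_append)
      then obtain l v' where v: "v = l # v' @ [linv l]"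
        using less.prems
        by (cases v; cases "tl v" rule: rev_cases) (auto simp: linv_swap)
      have "v' \<noteq> []" using less.prems v by auto
      moreover have "reduced v'" using less.prems v reduced_appendD[of "[l]" "v' @ [linv l]"]
          reduced_appendD[of v' "[linv l]"] by auto
      ultimately obtain t w where "v' = t @ w @ winv t" "cyc w"
        using less.hyps[of v'] v by auto
      then show ?thesis using v by (intro exI[of _ "l # t"] exI[of _ w]) auto
    qed
  qed
  then show ?thesis using that assms reduced_word[of g] by (metis word_eq_Nil)
qed

lemma word_conj_power:
  assumes "word g = t @ w @ winv t" "cyc w" "n > 0"
  shows "word (g ^ n) = t @ wpow n w @ winv t"
proof -
  obtain m where n: "n = Suc m" using assms(3) by (cases n) auto
  have r: "reduced (t @ w @ winv t)" using assms(1) reduced_word by metis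
  have "reduced (t @ w)" "reduced (w @ winv t)"
    using r reduced_appendD[of "t @ w" "winv t"] reduced_appendD[of t "w @ winv t"] by auto
  moreover have "w \<noteq> []" using assms by (simp add: cyc_def)
  ultimately have red: "reduced (t @ wpow n w @ winv t)"
    using reduced_glue[of t w "wpow m w @ winv t"] reduced_wpow_append[of w "winv t" m]
      assms(2) n by auto
  have g: "g = mk t * mk w * inverse (mk t)"
    using assms(1) by (metis mk_append mk_winv mk_word mult.assoc)
  have "g ^ n = mk (t @ wpow n w @ winv t)"
    unfolding g fg_conj_power by (simp add: mk_append mk_wpow mk_winv mult.assoc)
  then show ?thesis using red by simp
qed

section \<open>Conjugacy of cyclically reduced words\<close>

lemma append_eq_append_le:
  assumes "a @ b = c @ d" "length a \<le> length c"
  obtains e where "c = a @ e" "b = e @ d"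
  using assms by (metis append_eq_append_conv_if append_take_drop_id)

text \<open>\<open>g\<close> has at most \<open>m\<close> letters, so it can cancel at most
  \<open>m\<close> letters and hence touches at most \<open>m\<close> of the copies of
  \<open>y\<close>.\<close>

lemma suffix_power_mult:
  assumes "cyc y" "length (word g) \<le> m"
  shows "\<exists>z. word (g * mk y ^ (m + n)) = z @ wpow n y"
proof -
  obtain u t v where *: "word g = u @ t" "wpow (m + n) y = winv t @ v"
      "word (g * mk y ^ (m + n)) = u @ v"
    using mult_cancellation[of g "mk y ^ (m + n)"] by (auto simp: word_mk_power[OF assms(1)])
  have "length t \<le> m" using * assms by auto
  also have "m \<le> length (wpow m y)" using assms by (intro le_length_wpow) (simp add: cyc_def)
  finally have "length (winv t) \<le> length (wpow m y)" by simp
  then obtain v' where "v = v' @ wpow n y"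
    using append_eq_append_le[of "winv t" v "wpow m y" "wpow n y"] *(2) unfolding wpow_add by metis
  then show ?thesis using * by auto
qed

lemma prefix_power_mult:
  assumes "cyc y" "length (word g) \<le> m"
  shows "\<exists>z. word (mk y ^ (m + n) * g) = wpow n y @ z"
proof -
  obtain z where "word (inverse g * mk (winv y) ^ (m + n)) = z @ wpow n (winv y)"
    using suffix_power_mult[of "winv y" "inverse g" m n] assms by (auto simp: cyc_winv)
  then have "winv (word (inverse g * mk (winv y) ^ (m + n))) = wpow n y @ winv z"
    by (simp add: winv_wpow)
  moreover have "inverse (inverse g * mk (winv y) ^ (m + n)) = mk y ^ (m + n) * g"
    by (simp add: mk_winv fg_inverse_mult fg_inverse_power)
  ultimately show ?thesis by (metis word_inv)
qed

text \<open>Multiplying the conjugator \<open>q\<close> by a high power of \<open>y\<close> yields a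
  word \<open>p\<close> that begins with \<open>y\<close> and, because \<open>y^M q = q z^M\<close>,
  ends with \<open>z\<close>. Both sides of the equation are then reduced as they stand and agree as
  lists.\<close>

lemma conjugate_cyc_words:
  assumes "cyc y" "cyc z" "mk y * q = q * mk z"
  obtains M p where "mk p = mk y ^ M * q" "y @ p = p @ z"
proof -
  define M where "M = length (word q) + 1"
  define p where "p = word (mk y ^ M * q)"
  have "mk y ^ n * q = q * mk z ^ n" for n
    by (induction n) (simp, metis assms(3) mult.assoc power_Suc)
  then have p2: "p = word (q * mk z ^ M)" by (simp add: p_def)
  obtain p1 where p1: "p = y @ p1"
    using prefix_power_mult[OF assms(1), of q "length (word q)" 1] by (auto simp: p_def M_def)
  obtain p3 where p3: "p = p3 @ z"
    using suffix_power_mult[OF assms(2), of q "length (word q)" 1] by (auto simp: p2 M_def)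
  have "reduced p" by (simp add: p_def)
  have "reduced (y @ p)"
    using reduced_glue[of y y p1] p1 \<open>reduced p\<close> assms by (simp add: cyc_def)
  moreover have "reduced (p @ z)"
    using reduced_glue[of p3 z z] p3 \<open>reduced p\<close> assms by (simp add: cyc_def)
  moreover have "mk y * (mk y ^ M * q) = mk y ^ M * q * mk z"
    by (metis assms(3) mult.assoc power_commutes)
  then have "mk (y @ p) = mk (p @ z)"
    by (simp add: mk_append p_def)
  ultimately have "y @ p = p @ z" by (metis word_mk)
  then show ?thesis using that[of p M] by (simp add: p_def)
qed

text \<open>The classical word equation: its solutions are rotations. Copies of \<open>y\<close> are
  peeled off \<open>p\<close> until the remainder is no longer than \<open>y\<close>.\<close>

lemma append_conjugate:
  assumes "y @ p = p @ z" "y \<noteq> []"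
  obtains u v j where "y = u @ v" "z = v @ u" "p = wpow j y @ u"
proof -
  have "\<exists>u v j. y = u @ v \<and> z = v @ u \<and> p = wpow j y @ u"
    using assms
  proof (induction "length p" arbitrary: p rule: less_induct)
    case less
    show ?case
    proof (cases "length p \<le> length y")
      case True
      then obtain v where "y = p @ v" "z = v @ p"
        using append_eq_append_le[OF less.prems(1)[symmetric]] by metis
      then show ?thesis by (intro exI[of _ p] exI[of _ v] exI[of _ 0]) simp
    next
      case False
      then obtain p' where p: "p = y @ p'" "p = p' @ z"
        using append_eq_append_le[OF less.prems(1)] by (metis nat_le_linear)
      then have "y @ p' = p' @ z" "length p' < length p" using less.prems by auto
      then obtain u v j where "y = u @ v \<and> z = v @ u \<and> p' = wpow j y @ u"
        using less.hyps[of p'] less.prems(2) by metis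
      then show ?thesis using p by (intro exI[of _ u] exI[of _ v] exI[of _ "Suc j"]) simp
    qed
  qed
  then show ?thesis using that by blast
qed

text \<open>Peeling off the ends leads either to a middle letter equal to its own inverse or to two
  adjacent inverse letters; both are impossible.\<close>

lemma reduced_winv_self: "reduced v \<Longrightarrow> winv v = v \<Longrightarrow> v = []"
proof (induction "length v" arbitrary: v rule: less_induct)
  case less
  show ?case
  proof (cases v)
    case (Cons l w)
    show ?thesis
    proof (cases w rule: rev_cases)
      case (snoc w' m)
      then have "m = linv l" "winv w' = w'" using less.prems Cons by auto
      moreover have "reduced w'" using less.prems Cons snoc by (simp add: reduced_Cons reduced_append)
      ultimately have "w' = []" using less.hyps Cons snoc by auto
      then show ?thesis using less.prems Cons snoc \<open>m = linv l\<close> by simp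
    qed (use less.prems Cons in auto)
  qed
qed

section \<open>Powers of a cyclically reduced word as padding\<close>

lemma infix_wpow_rotation:
  assumes "wpow n w = a @ z @ b" "length z = length w"
  obtains u v where "w = u @ v" "z = v @ u"
proof -
  have "\<exists>u v. w = u @ v \<and> z = v @ u"
    using assms
  proof (induction n arbitrary: a)
    case (Suc n)
    show ?case
    proof (cases "length w \<le> length a")
      case True
      then obtain a' where "wpow n w = a' @ z @ b"
        using append_eq_append_le[of w "wpow n w" a "z @ b"] Suc.prems by auto
      then show ?thesis using Suc by blast
    next
      case False
      then obtain v where w: "w = a @ v" and v: "v @ wpow n w = z @ b"
        using append_eq_append_le[of a "z @ b" w "wpow n w"] Suc.prems
        by (metis nat_le_linear wpow_Suc)
      have "length v \<le> length z" using Suc.prems w by simp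
      then obtain u where z: "z = v @ u" "wpow n w = u @ b"
        using append_eq_append_le[OF v] by metis
      then have len: "length u = length a" using Suc.prems w by simp
      have "u = a"
      proof (cases n)
        case (Suc m)
        then have "u @ b = a @ v @ wpow m w" using z w by simp
        then show ?thesis using len by simp
      qed (use z len in simp)
      then show ?thesis using w z by auto
    qed
  qed auto
  then show ?thesis using that by blast
qed

text \<open>An infix of the length of one period is a rotation \<open>v @ u\<close> of
  \<open>y = u @ v\<close>. If it were \<open>winv y\<close>, both \<open>u\<close> and
  \<open>v\<close> would be their own inverses and thus empty.\<close>

lemma winv_not_infix_wpow:
  assumes "cyc y"
  shows "wpow n y \<noteq> a @ winv y @ b"
proof
  assume "wpow n y = a @ winv y @ b"
  then obtain u v where uv: "y = u @ v" "winv y = v @ u"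
    using infix_wpow_rotation[of n y a "winv y" b] by auto
  then have "winv v = v" "winv u = u" by auto
  moreover have "reduced u" "reduced v" using assms cyc_reduced uv reduced_appendD by metis+
  ultimately have "y = []" using reduced_winv_self uv by auto
  then show False using assms by (simp add: cyc_def)
qed

text \<open>However \<open>a\<close> interacts with \<open>y\<close>, the two outer powers cannot
  annihilate each other across it: for that, an inverse of \<open>y\<close> would have to occur
  inside a power of \<open>y\<close>.\<close>

lemma power_padding:
  assumes y: "cyc y"
  obtains M where "\<And>j. \<exists>w. word (mk y ^ (M + j) * a * mk y ^ (M + j)) = wpow j y @ w @ wpow j y"
proof -
  define m where "m = length (word a) + 2"
  define b where "b = a * mk y ^ m"
  \<comment> \<open>Two copies are kept: if the cancellation from the left reached the last one, it
    would swallow the first one whole, which puts \<open>winv y\<close> into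
    \<open>wpow n y\<close>.\<close>
  obtain z where z: "word b = z @ y @ y"
    using suffix_power_mult[OF y, of a "length (word a)" 2]
    by (auto simp: b_def m_def numeral_2_eq_2)
  \<comment> \<open>The cancelled part is no longer than \<open>word b\<close> and fits into
    \<open>length (word b)\<close> copies of \<open>y\<close>; the additional copy survives at the
    front.\<close>
  define n where "n = length (word b) + 1"
  obtain u t v where *: "wpow n y = u @ t" "word b = winv t @ v" "word (mk y ^ n * b) = u @ v"
    using mult_cancellation[of "mk y ^ n" b] by (auto simp: word_mk_power[OF y])
  have "\<exists>w. word (mk y ^ n * b) = y @ w @ y"
  proof -
    have "length y \<le> length v"
    proof (rule ccontr)
      assume "\<not> length y \<le> length v"
      then obtain r where "winv t = z @ y @ r"
        using z * by (auto simp: append_eq_append_conv2)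
      then have "t = winv r @ winv y @ winv z" by (metis append.assoc winv_append winv_winv)
      then show False using * winv_not_infix_wpow[OF y, of n "u @ winv r" "winv z"] by simp
    qed
    moreover have "winv t @ v = (z @ y) @ y" using z * by simp
    moreover from calculation have "length (winv t) \<le> length (z @ y)"
      by (metis add_le_cancel_right length_append nat_add_left_cancel_le)
    ultimately obtain v' where v: "v = v' @ y"
      using append_eq_append_le by metis
    have "length (winv t) \<le> length (word b)" using * by auto
    also have "\<dots> \<le> length (wpow (length (word b)) y)"
      using y by (intro le_length_wpow) (simp add: cyc_def)
    finally have "length t \<le> length (wpow (length (word b)) y)" by simp
    moreover have W: "y @ wpow (length (word b)) y = u @ t" using *(1) by (simp add: n_def)
    then have "length y + length (wpow (length (word b)) y) = length u + length t"
      by (metis length_append)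
    ultimately have "length y \<le> length u" by linarith
    then obtain u' where "u = y @ u'"
      using append_eq_append_le[OF W] by metis
    then show ?thesis using * v by auto
  qed
  then obtain w where w: "word (mk y ^ n * a * mk y ^ m) = y @ w @ y"
    by (auto simp: b_def mult.assoc)
  show ?thesis
  proof (rule that[of "m + n"])
    fix j
    have yne: "y \<noteq> []" using y by (simp add: cyc_def)
    have r: "reduced (y @ w @ y)" using w reduced_word by metis
    then have "reduced ((y @ w) @ y @ wpow (n + j) y)"
      using reduced_append_wpow[OF y, of "y @ w" "n + j"] by simp
    then have "reduced (wpow (m + j) y @ y @ (w @ y @ wpow (n + j) y))"
      using reduced_wpow_append[OF y, of "w @ y @ wpow (n + j) y" "m + j"] by simp
    moreover have "mk y ^ (m + n + j) * a * mk y ^ (m + n + j)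
        = mk y ^ (m + j) * (mk y ^ n * a * mk y ^ m) * mk y ^ (n + j)"
    proof -
      have "mk y ^ (m + n + j) = mk y ^ (m + j) * mk y ^ n" "mk y ^ (m + n + j) = mk y ^ m * mk y ^ (n + j)"
        by (simp_all flip: power_add add: ac_simps)
      then show ?thesis by (metis mult.assoc)
    qed
    moreover have "mk y ^ n * a * mk y ^ m = mk (y @ w @ y)" using w by (metis mk_word)
    ultimately have "word (mk y ^ (m + n + j) * a * mk y ^ (m + n + j))
        = wpow (m + j) y @ y @ w @ y @ wpow (n + j) y"
      by (simp flip: mk_wpow mk_append)
    also have "\<dots> = wpow j y @ (wpow m y @ y @ w @ y @ wpow n y) @ wpow j y"
      using wpow_add[of j m y] wpow_add[of n j y] by (simp add: add.commute)
    finally show "\<exists>w. word (mk y ^ (m + n + j) * a * mk y ^ (m + n + j)) = wpow j y @ w @ wpow j y"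
      by blast
  qed
qed

text \<open>Since \<open>x\<close> begins and ends with \<open>y\<close>, powers of \<open>y\<close>
  attach to it without cancellation, and enough copies absorb \<open>g\<close> and
  \<open>inverse g\<close>. This makes \<open>x\<close> visible in a word although nothing is known
  about \<open>g\<close>.\<close>

lemma infix_conj_power:
  assumes y: "cyc y" and x: "reduced x" "x = y @ x1" "x = x2 @ y"
  obtains n where "sublist x (word (g * mk y ^ n * mk x * mk y ^ n * inverse g))"
proof -
  define n where "n = length (word g) + 1"
  obtain z where z: "word (g * mk y ^ n) = z @ y"
    using suffix_power_mult[OF y, of g "length (word g)" 1] by (auto simp: n_def)
  obtain z' where z': "word (mk y ^ n * inverse g) = y @ z'"
    using prefix_power_mult[OF y, of "inverse g" "length (word g)" 1] by (auto simp: n_def)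
  have yy: "y \<noteq> []" "reduced (y @ y)" using y by (auto simp: cyc_def)
  have "reduced (z @ y)" "reduced (y @ z')" using z z' reduced_word by metis+
  moreover have "reduced (y @ x)"
    using reduced_glue[of y y x1] x yy by auto
  ultimately have zyx: "reduced (z @ y @ x)" by (intro reduced_glue yy)
  have "reduced (y @ y @ z')" by (intro reduced_glue yy \<open>reduced (y @ z')\<close>)
  then have "reduced ((z @ y @ x2) @ y @ y @ z')"
    using reduced_glue[of "z @ y @ x2" y "y @ z'"] zyx yy unfolding x(3) by simp
  then have "reduced (z @ y @ x @ y @ z')" by (simp add: x(3))
  then have "word (mk (z @ y) * mk x * mk (y @ z')) = z @ y @ x @ y @ z'"
    by (simp flip: mk_append)
  moreover have "mk (z @ y) = g * mk y ^ n" "mk (y @ z') = mk y ^ n * inverse g"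
    using z z' by (metis mk_word)+
  ultimately have "word (g * mk y ^ n * mk x * mk y ^ n * inverse g) = (z @ y) @ x @ y @ z'"
    by (simp add: mult.assoc)
  then show ?thesis using that by (metis sublist_appendI)
qed

section \<open>Conjugacy-faithful homomorphisms\<close>

text \<open>
  The three closure properties of an epimorphism which imply the conclusion of the theorem: every
  conjugacy between non-trivial elements of the images of \<open>H\<close> and \<open>K\<close> lifts, every conjugator
  of a non-trivial element of \<open>H\<close> into \<open>K\<close> conjugates as much upstairs as downstairs, and no
  non-trivial element of the kernel centralizes a non-trivial element of \<open>K\<close>. Unlike the
  conclusion itself, they are visibly stable under composition.
\<close>

definition conj_faithful ::
  "('a, 'c) monoid_scheme \<Rightarrow> ('b, 'd) monoid_scheme \<Rightarrow> ('a \<Rightarrow> 'b) \<Rightarrow> 'a set \<Rightarrow> 'a set \<Rightarrow> bool" where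
  "conj_faithful G G' \<eta> H K \<longleftrightarrow>
     \<eta> \<in> epi G G' \<and> H \<subseteq> carrier G \<and> K \<subseteq> carrier G \<and> inj_on \<eta> H \<and> inj_on \<eta> K \<and>
     (\<forall>h\<in>H. \<forall>k\<in>K. \<forall>g'\<in>carrier G'. h \<noteq> \<one>\<^bsub>G\<^esub> \<longrightarrow> \<eta> h \<otimes>\<^bsub>G'\<^esub> g' = g' \<otimes>\<^bsub>G'\<^esub> \<eta> k \<longrightarrow>
        (\<exists>g\<in>carrier G. \<eta> g = g' \<and> h \<otimes>\<^bsub>G\<^esub> g = g \<otimes>\<^bsub>G\<^esub> k)) \<and>
     (\<forall>h\<in>H. \<forall>k\<in>K. \<forall>h'\<in>H. \<forall>k'\<in>K. \<forall>g\<in>carrier G. h \<noteq> \<one>\<^bsub>G\<^esub> \<longrightarrow> h \<otimes>\<^bsub>G\<^esub> g = g \<otimes>\<^bsub>G\<^esub> k \<longrightarrow>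
        \<eta> h' \<otimes>\<^bsub>G'\<^esub> \<eta> g = \<eta> g \<otimes>\<^bsub>G'\<^esub> \<eta> k' \<longrightarrow> h' \<otimes>\<^bsub>G\<^esub> g = g \<otimes>\<^bsub>G\<^esub> k') \<and>
     (\<forall>k\<in>K. \<forall>c\<in>carrier G. k \<noteq> \<one>\<^bsub>G\<^esub> \<longrightarrow> c \<otimes>\<^bsub>G\<^esub> k = k \<otimes>\<^bsub>G\<^esub> c \<longrightarrow> \<eta> c = \<one>\<^bsub>G'\<^esub> \<longrightarrow> c = \<one>\<^bsub>G\<^esub>)"

lemma conj_faithful_epi: "conj_faithful G G' \<eta> H K \<Longrightarrow> \<eta> \<in> epi G G'"
  and conj_faithful_subset: "conj_faithful G G' \<eta> H K \<Longrightarrow> H \<subseteq> carrier G \<and> K \<subseteq> carrier G"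
  and conj_faithful_inj: "conj_faithful G G' \<eta> H K \<Longrightarrow> inj_on \<eta> H \<and> inj_on \<eta> K"
  by (auto simp: conj_faithful_def)

lemma conj_faithful_lift:
  fixes G (structure)
  assumes "conj_faithful G G' \<eta> H K" "h \<in> H" "k \<in> K" "g' \<in> carrier G'" "h \<noteq> \<one>"
    "\<eta> h \<otimes>\<^bsub>G'\<^esub> g' = g' \<otimes>\<^bsub>G'\<^esub> \<eta> k"
  obtains g where "g \<in> carrier G" "\<eta> g = g'" "h \<otimes> g = g \<otimes> k"
  using assms unfolding conj_faithful_def by blast

lemma conj_faithful_reflect:
  fixes G (structure)
  assumes "conj_faithful G G' \<eta> H K" "h \<in> H" "k \<in> K" "h' \<in> H" "k' \<in> K" "g \<in> carrier G" "h \<noteq> \<one>"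
    "h \<otimes> g = g \<otimes> k" "\<eta> h' \<otimes>\<^bsub>G'\<^esub> \<eta> g = \<eta> g \<otimes>\<^bsub>G'\<^esub> \<eta> k'"
  shows "h' \<otimes> g = g \<otimes> k'"
  using assms unfolding conj_faithful_def by blast

lemma conj_faithful_centralizer:
  fixes G (structure)
  assumes "conj_faithful G G' \<eta> H K" "k \<in> K" "c \<in> carrier G" "k \<noteq> \<one>"
    "c \<otimes> k = k \<otimes> c" "\<eta> c = \<one>\<^bsub>G'\<^esub>"
  shows "c = \<one>"
  using assms unfolding conj_faithful_def by blast

lemma conj_faithful_iso:
  fixes G (structure)
  assumes "group G" "group G'" "\<eta> \<in> iso G G'" "H \<subseteq> carrier G" "K \<subseteq> carrier G"
  shows "conj_faithful G G' \<eta> H K"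
proof -
  interpret group_hom G G' \<eta>
    using assms by (simp add: group_hom_def group_hom_axioms_def iso_def)
  have bij: "bij_betw \<eta> (carrier G) (carrier G')" using assms(3) by (simp add: iso_def)
  then have inj: "inj_on \<eta> (carrier G)" and surj: "\<eta> ` carrier G = carrier G'"
    by (auto simp: bij_betw_def)
  have eq: "x = y" if "x \<in> carrier G" "y \<in> carrier G" "\<eta> x = \<eta> y" for x y
    using inj that by (auto dest: inj_onD)
  have sub: "x \<in> carrier G" if "x \<in> H \<or> x \<in> K" for x using that assms by auto
  have "\<exists>g\<in>carrier G. \<eta> g = g' \<and> h \<otimes> g = g \<otimes> k"
    if "h \<in> H" "k \<in> K" "g' \<in> carrier G'" "\<eta> h \<otimes>\<^bsub>G'\<^esub> g' = g' \<otimes>\<^bsub>G'\<^esub> \<eta> k" for h k g'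
  proof -
    obtain g where g: "g \<in> carrier G" "\<eta> g = g'" using \<open>g' \<in> carrier G'\<close> unfolding surj[symmetric] by (rule imageE) simp
    then have "h \<otimes> g = g \<otimes> k" using that sub by (intro eq) simp_all
    with g show ?thesis by blast
  qed
  moreover have "h' \<otimes> g = g \<otimes> k'"
    if "h' \<in> H" "k' \<in> K" "g \<in> carrier G" "\<eta> h' \<otimes>\<^bsub>G'\<^esub> \<eta> g = \<eta> g \<otimes>\<^bsub>G'\<^esub> \<eta> k'" for h' k' g
    using that sub by (intro eq) simp_all
  moreover have "c = \<one>" if "c \<in> carrier G" "\<eta> c = \<one>\<^bsub>G'\<^esub>" for c
    using that by (intro eq) simp_all
  moreover have "\<eta> \<in> epi G G'" using surj homh by (simp add: epi_def)
  ultimately show ?thesis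
    unfolding conj_faithful_def using assms inj by (auto intro: inj_on_subset)
qed

lemma conj_faithful_comp:
  fixes G (structure)
  assumes "group G" "group G'" "group G''" "subgroup H G" "subgroup K G"
    and 1: "conj_faithful G G' \<eta> H K" and 2: "conj_faithful G' G'' \<theta> (\<eta> ` H) (\<eta> ` K)"
  shows "conj_faithful G G'' (\<theta> \<circ> \<eta>) H K"
proof -
  have epi: "\<eta> \<in> epi G G'" "\<theta> \<in> epi G' G''" by (rule conj_faithful_epi[OF 1], rule conj_faithful_epi[OF 2])
  interpret a: group_hom G G' \<eta>
    using assms epi by (simp add: group_hom_def group_hom_axioms_def epi_def)
  interpret b: group_hom G' G'' \<theta>
    using assms epi by (simp add: group_hom_def group_hom_axioms_def epi_def)
  have sub: "H \<subseteq> carrier G" "K \<subseteq> carrier G" using conj_faithful_subset[OF 1] by simp_all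
  have inj: "inj_on \<eta> H" "inj_on \<eta> K" "inj_on \<theta> (\<eta> ` H)" "inj_on \<theta> (\<eta> ` K)"
    using conj_faithful_inj[OF 1] conj_faithful_inj[OF 2] by simp_all
  \<comment> \<open>Injectivity on \<open>H\<close> and \<open>K\<close> hands the non-triviality
    side conditions over to the second map.\<close>
  have nontriv: "\<eta> h \<noteq> \<one>\<^bsub>G'\<^esub>" if "h \<in> H" "h \<noteq> \<one>" for h
    using inj_onD[OF inj(1), of h "\<one>"] that subgroup.one_closed[OF assms(4)] a.hom_one by metis
  have nontriv': "\<eta> h \<noteq> \<one>\<^bsub>G'\<^esub>" if "h \<in> K" "h \<noteq> \<one>" for h
    using inj_onD[OF inj(2), of h "\<one>"] that subgroup.one_closed[OF assms(5)] a.hom_one by metis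
  have down: "\<eta> h \<otimes>\<^bsub>G'\<^esub> \<eta> g = \<eta> g \<otimes>\<^bsub>G'\<^esub> \<eta> k"
    if "h \<otimes> g = g \<otimes> k" "h \<in> carrier G" "k \<in> carrier G" "g \<in> carrier G" for h g k
    using that by (metis a.hom_mult)
  have "\<exists>g\<in>carrier G. \<theta> (\<eta> g) = g' \<and> h \<otimes> g = g \<otimes> k"
    if h: "h \<in> H" "k \<in> K" "g' \<in> carrier G''" "h \<noteq> \<one>"
      "\<theta> (\<eta> h) \<otimes>\<^bsub>G''\<^esub> g' = g' \<otimes>\<^bsub>G''\<^esub> \<theta> (\<eta> k)" for h k g'
  proof -
    obtain g1 where g1: "g1 \<in> carrier G'" "\<theta> g1 = g'" "\<eta> h \<otimes>\<^bsub>G'\<^esub> g1 = g1 \<otimes>\<^bsub>G'\<^esub> \<eta> k"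
      by (rule conj_faithful_lift[OF 2 imageI[OF h(1)] imageI[OF h(2)] h(3) nontriv[OF h(1,4)] h(5)])
    obtain g where "g \<in> carrier G" "\<eta> g = g1" "h \<otimes> g = g \<otimes> k"
      by (rule conj_faithful_lift[OF 1 h(1,2) g1(1) h(4) g1(3)])
    with g1(2) show ?thesis by blast
  qed
  moreover have "h' \<otimes> g = g \<otimes> k'"
    if h: "h \<in> H" "k \<in> K" "h' \<in> H" "k' \<in> K" "g \<in> carrier G" "h \<noteq> \<one>" "h \<otimes> g = g \<otimes> k"
      "\<theta> (\<eta> h') \<otimes>\<^bsub>G''\<^esub> \<theta> (\<eta> g) = \<theta> (\<eta> g) \<otimes>\<^bsub>G''\<^esub> \<theta> (\<eta> k')" for h k h' k' g
  proof -
    have "\<eta> h \<otimes>\<^bsub>G'\<^esub> \<eta> g = \<eta> g \<otimes>\<^bsub>G'\<^esub> \<eta> k"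
      by (rule down[OF h(7)]) (use h sub in auto)
    then have "\<eta> h' \<otimes>\<^bsub>G'\<^esub> \<eta> g = \<eta> g \<otimes>\<^bsub>G'\<^esub> \<eta> k'"
      by (rule conj_faithful_reflect[OF 2 imageI[OF h(1)] imageI[OF h(2)] imageI[OF h(3)]
            imageI[OF h(4)] a.hom_closed[OF h(5)] nontriv[OF h(1,6)] _ h(8)])
    then show ?thesis by (rule conj_faithful_reflect[OF 1 h(1-7)])
  qed
  moreover have "c = \<one>"
    if c: "k \<in> K" "c \<in> carrier G" "k \<noteq> \<one>" "c \<otimes> k = k \<otimes> c" "\<theta> (\<eta> c) = \<one>\<^bsub>G''\<^esub>" for k c
  proof -
    have "\<eta> c \<otimes>\<^bsub>G'\<^esub> \<eta> k = \<eta> k \<otimes>\<^bsub>G'\<^esub> \<eta> c"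
      by (rule down[OF c(4)]) (use c sub in auto)
    then have "\<eta> c = \<one>\<^bsub>G'\<^esub>"
      by (rule conj_faithful_centralizer[OF 2 imageI[OF c(1)] a.hom_closed[OF c(2)] nontriv'[OF c(1,3)] _ c(5)])
    then show ?thesis by (rule conj_faithful_centralizer[OF 1 c(1-4)])
  qed
  moreover have "\<theta> \<circ> \<eta> \<in> epi G G''"
    using epi hom_compose[of \<eta> G G' \<theta> G''] image_comp[of \<theta> \<eta> "carrier G"] by (simp add: epi_def)
  moreover have "inj_on (\<theta> \<circ> \<eta>) H" "inj_on (\<theta> \<circ> \<eta>) K"
    using inj by (simp_all add: comp_inj_on)
  ultimately show ?thesis
    using sub unfolding conj_faithful_def o_apply by (intro conjI ballI impI) blast+
qed

section \<open>Letter maps that can be inverted locally\<close>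

lemma wpow_odd: "wpow (2 * n + 1) w = wpow n w @ w @ wpow n w"
  using wpow_add[of n "Suc n" w] by (simp add: mult_2)

lemma wpow_Suc_rotate: "wpow (Suc n) (u @ v) = u @ wpow n (v @ u) @ v"
  by (induction n) auto

definition lmap :: "('x \<Rightarrow> 'y) \<Rightarrow> 'x word \<Rightarrow> 'y word" where
  "lmap \<rho> = map (\<lambda>(x, b). (\<rho> x, b))"

definition letter_hom :: "('x \<Rightarrow> 'y) \<Rightarrow> 'x fg \<Rightarrow> 'y fg" where
  "letter_hom \<rho> = ext_hom (\<lambda>x. gen (\<rho> x))"

lemma lmap_simps [simp]:
  "lmap \<rho> [] = []" "lmap \<rho> ((x, b) # w) = (\<rho> x, b) # lmap \<rho> w"
  "lmap \<rho> (u @ v) = lmap \<rho> u @ lmap \<rho> v" "length (lmap \<rho> w) = length w"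
  "lmap \<rho> (wpow n w) = wpow n (lmap \<rho> w)" "lmap \<rho> w = [] \<longleftrightarrow> w = []"
  by (simp_all add: lmap_def map_wpow)

lemma letter_hom_simps [simp]:
  "letter_hom \<rho> (g * h) = letter_hom \<rho> g * letter_hom \<rho> h"
  "letter_hom \<rho> 1 = 1" "letter_hom \<rho> (inverse g) = inverse (letter_hom \<rho> g)"
  "letter_hom \<rho> (g ^ n) = letter_hom \<rho> g ^ n" "letter_hom \<rho> (gen x) = gen (\<rho> x)"
  by (simp_all add: letter_hom_def)

lemma letter_hom_mk: "letter_hom \<rho> (mk w) = mk (lmap \<rho> w)"
proof (induction w)
  case (Cons l w)
  have "mk (l # w) = mk [l] * mk w" "mk (lmap \<rho> (l # w)) = mk (lmap \<rho> [l]) * mk (lmap \<rho> w)"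
    by (simp_all flip: mk_append lmap_simps)
  then show ?case using Cons by (cases l) (simp add: mk_single)
qed simp

lemma letter_hom_image: "letter_hom \<rho> ` Fr A = Fr (\<rho> ` A)"
proof
  show "letter_hom \<rho> ` Fr A \<subseteq> Fr (\<rho> ` A)"
    unfolding letter_hom_def using ext_hom_Fr[of A "\<lambda>x. gen (\<rho> x)" "\<rho> ` A"] by auto
  show "Fr (\<rho> ` A) \<subseteq> letter_hom \<rho> ` Fr A"
  proof
    fix g assume "g \<in> Fr (\<rho> ` A)"
    then show "g \<in> letter_hom \<rho> ` Fr A"
    proof (induction g rule: Fr_induct)
      case one
      then show ?case by (intro image_eqI[of _ _ 1]) auto
    next
      case (gen y g)
      then obtain x g0 where "x \<in> A" "y = \<rho> x" "g0 \<in> Fr A" "g = letter_hom \<rho> g0" by auto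
      then show ?case by (intro image_eqI[of _ _ "gen x * g0"]) auto
    next
      case (inv y g)
      then obtain x g0 where "x \<in> A" "y = \<rho> x" "g0 \<in> Fr A" "g = letter_hom \<rho> g0" by auto
      then show ?case by (intro image_eqI[of _ _ "inverse (gen x) * g0"]) auto
    qed
  qed
qed

lemma subgroup_FG_closed:
  assumes "subgroup H (FG A)"
  shows "h \<in> H \<Longrightarrow> h' \<in> H \<Longrightarrow> h * h' \<in> H" "h \<in> H \<Longrightarrow> h ^ n \<in> H" "h \<in> H \<Longrightarrow> h \<in> Fr A"
    "h \<in> H \<Longrightarrow> inverse h \<in> H"
proof -
  show *: "h * h' \<in> H" if "h \<in> H" "h' \<in> H" for h h'
    using subgroup.m_closed[OF assms] that by simp
  show "h ^ n \<in> H" if "h \<in> H" for h n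
    using subgroup.one_closed[OF assms] that * by (induction n) auto
  show sub: "h \<in> Fr A" if "h \<in> H" for h using subgroup.subset[OF assms] that by auto
  show "inverse h \<in> H" if "h \<in> H" for h
    using subgroup.m_inv_closed[OF assms that] sub that by simp
qed

text \<open>
  If a letter of a reduced word of \<open>H\<close> or \<open>K\<close> is determined by the image of a window of radius \<open>N\<close>
  around it, then periodic words are determined by their images, since they can be prolonged until
  every letter of a period lies in the middle of a full window.
\<close>

locale locally_invertible =
  fixes A :: "'x set" and H K :: "'x fg set" and \<rho> :: "'x \<Rightarrow> 'x" and W :: "'x word set" and N :: nat
  assumes subgroup_H: "subgroup H (FG A)" and subgroup_K: "subgroup K (FG A)"
  defines "W \<equiv> {w. \<exists>g\<in>H \<union> K. sublist w (word g)}"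
  assumes reduced_lmap: "w \<in> W \<Longrightarrow> reduced (lmap \<rho> w)"
    and window: "\<lbrakk>a @ l # b \<in> W; a' @ l' # b' \<in> W; lmap \<rho> (a @ l # b) = lmap \<rho> (a' @ l' # b');
      length a = length a'; N \<le> length a; N \<le> length b\<rbrakk> \<Longrightarrow> l = l'"
begin

lemma W_I: "g \<in> H \<union> K \<Longrightarrow> sublist w (word g) \<Longrightarrow> w \<in> W"
  by (auto simp: W_def)

lemma W_infix: "a @ w @ b \<in> W \<Longrightarrow> w \<in> W"
  unfolding W_def using sublist_appendI[of w a b] sublist_order.order_trans by blast

lemmas H_closed = subgroup_FG_closed[OF subgroup_H]
lemmas K_closed = subgroup_FG_closed[OF subgroup_K]

text \<open>The common margins give every position of the middle part a full window, so the words
  are decoded letter by letter.\<close>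

lemma window_word:
  assumes "a @ w @ b \<in> W" "a' @ w' @ b' \<in> W" "lmap \<rho> a = lmap \<rho> a'" "lmap \<rho> w = lmap \<rho> w'"
    "lmap \<rho> b = lmap \<rho> b'" "N \<le> length a" "N \<le> length b"
  shows "w = w'"
proof (rule nth_equalityI)
  show len: "length w = length w'" using assms(4) by (metis lmap_simps(4))
  fix i assume i: "i < length w"
  have w: "w = take i w @ w ! i # drop (Suc i) w" "w' = take i w' @ w' ! i # drop (Suc i) w'"
    using i len by (simp_all add: id_take_nth_drop)
  have la: "length a = length a'" using assms(3) by (metis lmap_simps(4))
  show "w ! i = w' ! i"
  proof (rule window)
    show "(a @ take i w) @ w ! i # (drop (Suc i) w @ b) \<in> W" using assms(1) w(1)
      by (metis append.assoc append_Cons)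
    show "(a' @ take i w') @ w' ! i # (drop (Suc i) w' @ b') \<in> W" using assms(2) w(2)
      by (metis append.assoc append_Cons)
    have "(a @ take i w) @ w ! i # (drop (Suc i) w @ b) = a @ w @ b"
      "(a' @ take i w') @ w' ! i # (drop (Suc i) w' @ b') = a' @ w' @ b'"
      using w by (metis append.assoc append_Cons)+
    then show "lmap \<rho> ((a @ take i w) @ w ! i # (drop (Suc i) w @ b)) =
        lmap \<rho> ((a' @ take i w') @ w' ! i # (drop (Suc i) w' @ b'))"
      using assms by (metis lmap_simps(3))
  qed (use i len la assms in auto)
qed

lemma W_wpow:
  assumes "g \<in> H \<union> K" "word g = t @ y @ winv t" "cyc y"
  shows "wpow n y \<in> W"
proof -
  have "g ^ Suc n \<in> H \<union> K" using assms H_closed K_closed by blast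
  moreover have "word (g ^ Suc n) = (t @ y) @ wpow n y @ winv t"
    using word_conj_power[OF assms(2,3), of "Suc n"] by simp
  ultimately show ?thesis by (metis W_I sublist_appendI)
qed

lemma cyc_lmap:
  assumes "g \<in> H \<union> K" "word g = t @ y @ winv t" "cyc y"
  shows "cyc (lmap \<rho> y)"
  using reduced_lmap[OF W_wpow[OF assms, of 2]] assms(3) by (simp add: cyc_def numeral_2_eq_2)

lemma letter_hom_eq_one:
  assumes "g \<in> H \<union> K" "letter_hom \<rho> g = 1"
  shows "g = 1"
proof -
  have "reduced (lmap \<rho> (word g))" using assms W_I by (intro reduced_lmap) auto
  moreover have "mk (lmap \<rho> (word g)) = 1" using assms letter_hom_mk[of \<rho> "word g"] by simp
  ultimately have "lmap \<rho> (word g) = []" by (metis word_mk word_one)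
  then show ?thesis by simp
qed

text \<open>The images of the cyclic cores \<open>y\<close> and \<open>z\<close> stay cyclically
  reduced and are conjugate, hence rotations of each other. Since \<open>lmap\<close> preserves
  positions, the cut can be made in \<open>y\<close> itself; decoding inside long powers then shows
  that \<open>z\<close> is this rotation of \<open>y\<close>.\<close>

lemma lift_conjugacy:
  assumes h: "h \<in> H" "k \<in> K" "h \<noteq> 1" and eq: "letter_hom \<rho> h * g' = g' * letter_hom \<rho> k"
  obtains g where "g \<in> Fr A" "letter_hom \<rho> g = g'" "h * g = g * k"
proof -
  have "k \<noteq> 1"
    using h eq letter_hom_eq_one[of h] by (metis UnCI fg_mult_right_cancel letter_hom_simps(2) mult.left_neutral mult.right_neutral)
  obtain t y where t: "word h = t @ y @ winv t" "cyc y" using cyc_decomposition h by metis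
  obtain s z where s: "word k = s @ z @ winv s" "cyc z" using cyc_decomposition \<open>k \<noteq> 1\<close> by metis
  have hk: "h = mk t * mk y * inverse (mk t)" "k = mk s * mk z * inverse (mk s)"
    using t(1) s(1) by (metis mk_append mk_winv mk_word mult.assoc)+
  have cyc: "cyc (lmap \<rho> y)" "cyc (lmap \<rho> z)" using cyc_lmap h t s by blast+
  define q where "q = inverse (letter_hom \<rho> (mk t)) * g' * letter_hom \<rho> (mk s)"
  have "mk (lmap \<rho> y) * q = inverse (letter_hom \<rho> (mk t)) * (letter_hom \<rho> h * g') * letter_hom \<rho> (mk s)"
    by (simp add: q_def hk(1) mult.assoc flip: letter_hom_mk)
  also have "\<dots> = q * mk (lmap \<rho> z)"
    unfolding eq by (simp add: q_def hk(2) mult.assoc flip: letter_hom_mk)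
  finally obtain M p where p: "mk p = mk (lmap \<rho> y) ^ M * q" "lmap \<rho> y @ p = p @ lmap \<rho> z"
    using conjugate_cyc_words[OF cyc] by metis
  then obtain u v j where uv: "lmap \<rho> y = u @ v" "lmap \<rho> z = v @ u" "p = wpow j (lmap \<rho> y) @ u"
    using append_conjugate cyc unfolding cyc_def by metis
  obtain y1 y2 where y: "y = y1 @ y2" "lmap \<rho> y1 = u" "lmap \<rho> y2 = v"
    using uv(1) unfolding lmap_def by (auto simp: map_eq_append_conv)
  have "y2 @ y1 = z"
  proof (rule window_word)
    \<comment> \<open>Rotating costs one copy of \<open>y\<close>. Of the remaining
      \<open>2 * N + 1\<close> copies the middle one is decoded, and the \<open>N\<close> copies on
      either side are the margins.\<close>
    have "wpow (2 * N + 2) y = y1 @ (wpow N (y2 @ y1) @ (y2 @ y1) @ wpow N (y2 @ y1)) @ y2"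
      unfolding y(1) wpow_odd[symmetric] using wpow_Suc_rotate[of "2 * N + 1" y1 y2] by simp
    then show "wpow N (y2 @ y1) @ (y2 @ y1) @ wpow N (y2 @ y1) \<in> W"
      using W_wpow[OF _ t, of "2 * N + 2"] h W_infix by auto
    show "wpow N z @ z @ wpow N z \<in> W"
      using W_wpow[OF _ s, of "2 * N + 1"] h by (simp only: wpow_odd) simp
    have "y2 @ y1 \<noteq> []" using t(2) y by (auto simp: cyc_def)
    then show "N \<le> length (wpow N (y2 @ y1))" "N \<le> length (wpow N (y2 @ y1))"
      by (rule le_length_wpow)+
  qed (use y uv in auto)
  define p0 where "p0 = wpow j y @ y1"
  have "y @ p0 = p0 @ z" using y(1) \<open>y2 @ y1 = z\<close> by (auto simp: p0_def)
  then have yp: "mk y * mk p0 = mk p0 * mk z" by (simp flip: mk_append)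
  have lp: "letter_hom \<rho> (mk p0) = mk p" using y uv by (simp add: letter_hom_mk p0_def)
  \<comment> \<open>Solving the definitions of \<open>q\<close> and \<open>p\<close> for
    \<open>g'\<close> and replacing each factor by its lift.\<close>
  define g where "g = mk t * inverse (mk y) ^ M * mk p0 * inverse (mk s)"
  have lg: "letter_hom \<rho> g = g'"
    by (simp add: g_def lp p(1) letter_hom_mk[symmetric, of \<rho> y] q_def mult.assoc
        flip: fg_inverse_power)
  have "mk y * inverse (mk y) ^ M = inverse (mk y) ^ M * mk y"
    by (metis fg_left_inverse fg_right_inverse left_right_inverse_power power_commuting_commutes)
  then have "h * g = mk t * inverse (mk y) ^ M * (mk y * mk p0) * inverse (mk s)"
    by (simp add: g_def hk(1) mult.assoc) (simp flip: mult.assoc)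
  then have hg: "h * g = g * k" unfolding yp by (simp add: g_def hk(2) mult.assoc)
  have "fst ` set (word h) \<subseteq> A" "fst ` set (word k) \<subseteq> A"
    using h H_closed(3)[of h] K_closed(3)[of k] by (auto simp: Fr_def)
  then have sub: "fst ` set t \<subseteq> A" "fst ` set y \<subseteq> A" "fst ` set s \<subseteq> A"
    unfolding t s by auto
  then have "mk t \<in> Fr A" "mk y \<in> Fr A" "mk s \<in> Fr A" by (simp_all add: mk_in_Fr)
  moreover have "mk p0 \<in> Fr A"
    using calculation mk_in_Fr[of y1 A] sub y(1) by (simp add: p0_def mk_append mk_wpow image_Un)
  ultimately have "g \<in> Fr A" by (simp add: g_def)
  then show ?thesis using that lg hg by blast
qed

text \<open>Only the conjugates by \<open>S\<close> lie in \<open>H\<close> or \<open>K\<close>, and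
  \<open>S\<close> is arbitrary. Conjugated products of powers of \<open>y\<close> with
  \<open>a\<close> stay in the same subgroup, and with enough powers the padded word survives as an
  infix.\<close>

lemma conj_padding_in_W:
  assumes y: "cyc y"
    and g: "(S * mk y * inverse S \<in> H \<and> S * a * inverse S \<in> H) \<or> (S * mk y * inverse S \<in> K \<and> S * a * inverse S \<in> K)"
    and x: "word (mk y ^ m * a * mk y ^ m) = wpow (Suc j) y @ w @ wpow (Suc j) y"
  shows "wpow (Suc j) y @ w @ wpow (Suc j) y \<in> W"
proof -
  let ?x = "wpow (Suc j) y @ w @ wpow (Suc j) y"
  have r: "reduced ?x" unfolding x[symmetric] by simp
  have e1: "?x = y @ (wpow j y @ w @ wpow (Suc j) y)"
    and e2: "?x = (wpow (Suc j) y @ w @ wpow j y) @ y" by simp_all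
  obtain n where n: "sublist ?x (word (S * mk y ^ n * mk ?x * mk y ^ n * inverse S))"
    by (rule infix_conj_power[OF y r e1 e2])
  have mx: "mk ?x = mk y ^ m * a * mk y ^ m" unfolding x[symmetric] by simp
  have e: "S * mk y ^ n * mk ?x * mk y ^ n * inverse S = (S * mk y * inverse S) ^ (n + m) *
      (S * a * inverse S) * (S * mk y * inverse S) ^ (m + n)"
    unfolding fg_conj_power mx by (simp add: mult.assoc power_add)
  have "\<dots> \<in> H \<union> K"
    using g by (elim disjE conjE) (simp_all add: H_closed(1,2) K_closed(1,2))
  with n show ?thesis unfolding e by (intro W_I)
qed

text \<open>In coordinates adapted to the cyclic core \<open>y\<close> of \<open>h\<close>, both
  \<open>h\<close> and \<open>k\<close> become \<open>y\<close>, by conjugation with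
  \<open>T\<close> and \<open>S = inverse g * T\<close>; \<open>h'\<close> and \<open>k'\<close>
  become \<open>a\<close> and \<open>b\<close>, and the claim reads \<open>a = b\<close>. Their
  images agree, and padding by powers of \<open>y\<close> supplies the common margins for
  decoding.\<close>

lemma reflect_conjugacy:
  assumes h: "h \<in> H" "k \<in> K" "h' \<in> H" "k' \<in> K" "h \<noteq> 1" "h * g = g * k"
    and eq: "letter_hom \<rho> h' * letter_hom \<rho> g = letter_hom \<rho> g * letter_hom \<rho> k'"
  shows "h' * g = g * k'"
proof -
  obtain t y where t: "word h = t @ y @ winv t" "cyc y" using cyc_decomposition h by metis
  define T S where "T = mk t" and "S = inverse g * T"
  define a b where "a = inverse T * h' * T" and "b = inverse S * k' * S"
  have hT: "h = T * mk y * inverse T"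
    using t(1) unfolding T_def by (metis mk_append mk_winv mk_word mult.assoc)
  have kS: "k = S * mk y * inverse S"
  proof -
    have "k = inverse g * (h * g)" by (simp add: h)
    then show ?thesis by (simp add: S_def hT fg_inverse_mult mult.assoc)
  qed
  have ha: "h' = T * a * inverse T" "k' = S * b * inverse S"
    by (simp_all add: a_def b_def mult.assoc)
  have "letter_hom \<rho> k' = inverse (letter_hom \<rho> g) * (letter_hom \<rho> h' * letter_hom \<rho> g)"
    by (simp add: eq)
  then have ab: "letter_hom \<rho> a = letter_hom \<rho> b"
    by (simp add: a_def b_def S_def fg_inverse_mult mult.assoc)
  obtain Ma where Ma: "\<And>j. \<exists>w. word (mk y ^ (Ma + j) * a * mk y ^ (Ma + j)) = wpow j y @ w @ wpow j y"
    using power_padding[OF t(2)] by metis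
  obtain Mb where Mb: "\<And>j. \<exists>w. word (mk y ^ (Mb + j) * b * mk y ^ (Mb + j)) = wpow j y @ w @ wpow j y"
    using power_padding[OF t(2)] by metis
  \<comment> \<open>One exponent that is large enough for the padding of \<open>a\<close> and of
    \<open>b\<close> and leaves \<open>Suc N\<close> copies of \<open>y\<close> at each end.\<close>
  define m where "m = Ma + Mb + Suc N"
  let ?P = "wpow (Suc N) y"
  obtain wa where wa: "word (mk y ^ m * a * mk y ^ m) = ?P @ wa @ ?P"
  proof -
    obtain w where w: "word (mk y ^ m * a * mk y ^ m) = wpow (Mb + Suc N) y @ w @ wpow (Mb + Suc N) y"
      using Ma[of "Mb + Suc N"] by (auto simp: m_def add_ac)
    also have "\<dots> = ?P @ (wpow Mb y @ w @ wpow Mb y) @ ?P"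
      using wpow_add[of "Suc N" Mb y] wpow_add[of Mb "Suc N" y] by (simp add: add.commute)
    finally show ?thesis using that by blast
  qed
  obtain wb where wb: "word (mk y ^ m * b * mk y ^ m) = ?P @ wb @ ?P"
  proof -
    obtain w where w: "word (mk y ^ m * b * mk y ^ m) = wpow (Ma + Suc N) y @ w @ wpow (Ma + Suc N) y"
      using Mb[of "Ma + Suc N"] by (auto simp: m_def add_ac)
    also have "\<dots> = ?P @ (wpow Ma y @ w @ wpow Ma y) @ ?P"
      using wpow_add[of "Suc N" Ma y] wpow_add[of Ma "Suc N" y] by (simp add: add.commute)
    finally show ?thesis using that by blast
  qed
  have Wa: "?P @ wa @ ?P \<in> W" using h hT ha by (intro conj_padding_in_W[OF t(2) _ wa]) auto
  have Wb: "?P @ wb @ ?P \<in> W" using h kS ha by (intro conj_padding_in_W[OF t(2) _ wb]) auto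
  have "mk (lmap \<rho> (?P @ wa @ ?P)) = letter_hom \<rho> (mk y ^ m * a * mk y ^ m)"
    unfolding letter_hom_mk[symmetric] wa[symmetric] by simp
  also have "\<dots> = letter_hom \<rho> (mk y ^ m * b * mk y ^ m)" by (simp add: ab)
  also have "\<dots> = mk (lmap \<rho> (?P @ wb @ ?P))"
    unfolding letter_hom_mk[symmetric] wb[symmetric] by simp
  finally have "lmap \<rho> (?P @ wa @ ?P) = lmap \<rho> (?P @ wb @ ?P)"
    using reduced_lmap Wa Wb by (metis word_mk)
  then have "lmap \<rho> wa = lmap \<rho> wb" by simp
  moreover have "Suc N \<le> length ?P" by (rule le_length_wpow) (use t in \<open>simp add: cyc_def\<close>)
  ultimately have "wa = wb" using window_word[OF Wa Wb] by simp
  then have "mk y ^ m * a * mk y ^ m = mk y ^ m * b * mk y ^ m" using wa wb by (metis word_inject)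
  then have "a = b" by (simp add: mult.assoc)
  then have "h' = T * (inverse S * k' * S) * inverse T" using ha(1) b_def by simp
  then show ?thesis by (simp add: S_def fg_inverse_mult mult.assoc)
qed

text \<open>A commuting \<open>c\<close>, moved to the core and multiplied by a power of
  \<open>y\<close>, is a prefix \<open>p\<close> of a power of \<open>y\<close>. If \<open>c\<close>
  is in the kernel, \<open>p\<close> and \<open>wpow M y\<close> have equal uncancelled images,
  hence equal length; as prefixes of powers of \<open>y\<close> they coincide.\<close>

lemma centralizer_injective:
  assumes "k \<in> K" "k \<noteq> 1" "c * k = k * c" "letter_hom \<rho> c = 1"
  shows "c = 1"
proof -
  obtain t y where t: "word k = t @ y @ winv t" "cyc y" using cyc_decomposition assms by metis
  define a where "a = inverse (mk t) * c * mk t"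
  have k: "k = mk t * mk y * inverse (mk t)"
    using t(1) by (metis mk_append mk_winv mk_word mult.assoc)
  have "mk y * a = inverse (mk t) * (k * c) * mk t" by (simp add: a_def k mult.assoc)
  also have "\<dots> = a * mk y" unfolding assms(3)[symmetric] by (simp add: a_def k mult.assoc)
  finally obtain M p where p: "mk p = mk y ^ M * a" "y @ p = p @ y"
    using conjugate_cyc_words[OF t(2) t(2)] by metis
  then obtain u v j where uv: "y = u @ v" "p = wpow j y @ u"
    using append_conjugate t unfolding cyc_def by metis
  have py: "p @ v = wpow (Suc j) y" using uv by simp
  have "p \<in> W" using W_infix[of "[]" p v] W_wpow[OF _ t, of "Suc j"] assms(1) py by simp
  moreover have "wpow M y \<in> W" using W_wpow[OF _ t] assms(1) by simp
  moreover have "mk (lmap \<rho> p) = mk (lmap \<rho> (wpow M y))"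
    using assms(4) unfolding letter_hom_mk[symmetric] p(1) by (simp add: a_def mk_wpow)
  ultimately have "lmap \<rho> p = lmap \<rho> (wpow M y)" using reduced_lmap by (metis word_mk)
  then have "length p = length (wpow M y)" by (metis lmap_simps(4))
  moreover have "p @ v @ wpow M y = wpow M y @ wpow (Suc j) y"
    using py wpow_add[of "Suc j" M y] wpow_add[of M "Suc j" y] by (metis add.commute append.assoc)
  ultimately have "p = wpow M y" using append_eq_append_conv by blast
  then have "a = 1" using p(1) by (metis mk_wpow fg_mult_left_cancel mult.right_neutral)
  moreover have "c = mk t * a * inverse (mk t)" by (simp add: a_def mult.assoc)
  ultimately show ?thesis by simp
qed

lemma inj_on_letter_hom:
  assumes "subgroup H' (FG A)" "H' \<subseteq> H \<union> K"
  shows "inj_on (letter_hom \<rho>) H'"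
proof (rule inj_onI)
  fix x y assume xy: "x \<in> H'" "y \<in> H'" "letter_hom \<rho> x = letter_hom \<rho> y"
  then have "x * inverse y \<in> H'" by (simp add: subgroup_FG_closed[OF assms(1)])
  then have "x * inverse y \<in> H \<union> K" using assms(2) by blast
  moreover have "letter_hom \<rho> (x * inverse y) = 1" using xy(3) by simp
  ultimately have "x * inverse y = y * inverse y"
    using letter_hom_eq_one[of "x * inverse y"] fg_right_inverse by metis
  then show "x = y" by (simp only: fg_mult_right_cancel)
qed

theorem conj_faithful_letter_hom: "conj_faithful (FG A) (FG (\<rho> ` A)) (letter_hom \<rho>) H K"
proof -
  have epi: "letter_hom \<rho> \<in> epi (FG A) (FG (\<rho> ` A))"
  proof -
    have "letter_hom \<rho> \<in> hom (FG A) (FG (\<rho> ` A))"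
    proof (rule homI)
      show "letter_hom \<rho> g \<in> carrier (FG (\<rho> ` A))" if "g \<in> carrier (FG A)" for g
        using that imageI[of g "Fr A" "letter_hom \<rho>"] by (simp add: letter_hom_image)
    qed simp
    then show ?thesis by (simp add: epi_def letter_hom_image)
  qed
  have lift: "\<exists>g\<in>Fr A. letter_hom \<rho> g = g' \<and> h * g = g * k"
    if "h \<in> H" "k \<in> K" "h \<noteq> 1" "letter_hom \<rho> h * g' = g' * letter_hom \<rho> k" for h k g'
    by (rule lift_conjugacy[OF that]) blast
  show ?thesis
    unfolding conj_faithful_def FG_simps
  proof (intro conjI ballI impI)
    show "H \<subseteq> Fr A" "K \<subseteq> Fr A" using H_closed(3) K_closed(3) by blast+
    show "inj_on (letter_hom \<rho>) H" by (rule inj_on_letter_hom[OF subgroup_H]) simp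
    show "inj_on (letter_hom \<rho>) K" by (rule inj_on_letter_hom[OF subgroup_K]) simp
  next
    fix h k h' k' g
    assume "h \<in> H" "k \<in> K" "h' \<in> H" "k' \<in> K" "h \<noteq> 1" "h * g = g * k"
      "letter_hom \<rho> h' * letter_hom \<rho> g = letter_hom \<rho> g * letter_hom \<rho> k'"
    then show "h' * g = g * k'" by (rule reflect_conjugacy)
  next
    fix k c assume "k \<in> K" "k \<noteq> 1" "c * k = k * c" "letter_hom \<rho> c = 1"
    then show "c = 1" by (rule centralizer_injective)
  qed (rule epi lift; assumption)+
qed

end

section \<open>Eliminating a letter\<close>

definition avoids :: "'x \<Rightarrow> nat \<Rightarrow> 'x fg set \<Rightarrow> bool" where
  "avoids c n H \<longleftrightarrow> (\<forall>g\<in>H. \<forall>s. \<not> sublist (replicate n (c, s)) (word g))"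

section \<open>Block decomposition with respect to the letter \<open>c\<close>\<close>

definition lpow :: "'x \<Rightarrow> int \<Rightarrow> 'x word" where
  "lpow c k = replicate (nat \<bar>k\<bar>) (c, 0 < k)"

text \<open>Each pair is a run of \<open>c\<close> followed by another letter. Signed exponents turn
  the merging and cancelling of adjacent runs into integer addition.\<close>

definition blocks :: "'x \<Rightarrow> (int \<times> 'x \<times> bool) list \<Rightarrow> 'x word" where
  "blocks c bs = concat (map (\<lambda>(i, l). lpow c i @ [l]) bs)"

lemma blocks_simps [simp]:
  "blocks c [] = []" "blocks c ((i, l) # bs) = lpow c i @ l # blocks c bs"
  "blocks c (bs @ bs') = blocks c bs @ blocks c bs'"
  by (simp_all add: blocks_def)

lemma lpow_0 [simp]: "lpow c 0 = []"
  by (simp add: lpow_def)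

lemma lpow_eq_Nil [simp]: "lpow c k = [] \<longleftrightarrow> k = 0"
  by (simp add: lpow_def)

lemma length_lpow [simp]: "length (lpow c k) = nat \<bar>k\<bar>"
  by (simp add: lpow_def)

lemma set_lpow: "l \<in> set (lpow c k) \<Longrightarrow> l = (c, 0 < k)"
  by (simp add: lpow_def)

lemma reduced_replicate: "reduced (replicate m l)"
  by (induction m) (auto simp: reduced_Cons)

lemma reduced_lpow [simp]: "reduced (lpow c k)"
  by (simp add: lpow_def reduced_replicate)

lemma Cons_lpow:
  assumes "reduced ((c, s) # lpow c k)"
  shows "(c, s) # lpow c k = lpow c (if s then k + 1 else k - 1)"
proof (cases "k = 0")
  case True
  then show ?thesis by (simp add: lpow_def)
next
  case False
  then have "s = (0 < k)"
    using assms by (cases "nat \<bar>k\<bar>") (auto simp: lpow_def)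
  moreover have "(c, 0 < k) # lpow c k = replicate (Suc (nat \<bar>k\<bar>)) (c, 0 < k)"
    by (simp add: lpow_def)
  moreover have "Suc (nat \<bar>k\<bar>) = nat \<bar>if s then k + 1 else k - 1\<bar>" "(0 < k) = (0 < (if s then k + 1 else k - 1))"
    using \<open>s = (0 < k)\<close> False by auto
  ultimately show ?thesis by (simp add: lpow_def)
qed

lemma exists_blocks:
  assumes "reduced w"
  obtains bs k where "w = blocks c bs @ lpow c k" "\<forall>(i, l)\<in>set bs. fst l \<noteq> c"
proof -
  have "\<exists>bs k. w = blocks c bs @ lpow c k \<and> (\<forall>(i, l)\<in>set bs. fst l \<noteq> c)"
    using assms
  proof (induction w)
    case Nil
    then show ?case by (intro exI[of _ "[]"] exI[of _ 0]) simp
  next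
    case (Cons l w)
    then obtain bs k where w: "w = blocks c bs @ lpow c k" "\<forall>(i, l)\<in>set bs. fst l \<noteq> c"
      by (auto simp: reduced_Cons)
    show ?case
    proof (cases "fst l = c")
      case False
      then show ?thesis using w by (intro exI[of _ "(0, l) # bs"] exI[of _ k]) auto
    next
      case True
      then obtain s where l: "l = (c, s)" by (cases l) auto
      show ?thesis
      proof (cases bs)
        case Nil
        then show ?thesis using w Cons.prems l Cons_lpow[of c s k]
          by (intro exI[of _ "[]"] exI[of _ "if s then k + 1 else k - 1"]) simp
      next
        case (Cons b bs')
        obtain i m where b: "b = (i, m)" by (cases b)
        have "reduced ((l # lpow c i) @ m # blocks c bs' @ lpow c k)"
          using \<open>reduced (l # w)\<close> w Cons b by simp
        then have "reduced (l # lpow c i)" using reduced_appendD by blast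
        then show ?thesis using w l Cons b Cons_lpow[of c s i]
          by (intro exI[of _ "(if s then i + 1 else i - 1, m) # bs'"] exI[of _ k]) simp
      qed
    qed
  qed
  then show ?thesis using that by blast
qed

lemma map_eq_appendE:
  assumes "map f xs = ys @ zs"
  obtains us vs where "xs = us @ vs" "map f us = ys" "map f vs = zs"
  using assms unfolding map_eq_append_conv by metis

lemma blocks_split:
  assumes "blocks c bs @ lpow c k = a @ l # b" "fst l \<noteq> c"
  obtains bs1 i bs2 where "bs = bs1 @ (i, l) # bs2" "a = blocks c bs1 @ lpow c i"
proof -
  have "\<exists>bs1 i bs2. bs = bs1 @ (i, l) # bs2 \<and> a = blocks c bs1 @ lpow c i"
    using assms(1)
  proof (induction bs arbitrary: a)
    case Nil
    then have "l \<in> set (lpow c k)" by simp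
    then show ?case using assms(2) set_lpow by fastforce
  next
    case (Cons x bs)
    obtain i m where x: "x = (i, m)" by (cases x)
    have eq: "lpow c i @ m # blocks c bs @ lpow c k = a @ l # b" using Cons.prems x by simp
    consider "length a < length (lpow c i)" | "length a = length (lpow c i)" | "length a > length (lpow c i)"
      by linarith
    then show ?case
    proof cases
      case 1
      have "(a @ l # b) ! length a = l" by simp
      then have "l \<in> set (lpow c i)" using 1 unfolding eq[symmetric] by (metis nth_append nth_mem)
      then show ?thesis using assms(2) set_lpow by fastforce
    next
      case 2
      then show ?thesis using eq x
        by (intro exI[of _ "[]"] exI[of _ i] exI[of _ bs]) auto
    next
      case 3
      have "length (lpow c i @ [m]) \<le> length a" using 3 by simp
      moreover have "(lpow c i @ [m]) @ (blocks c bs @ lpow c k) = a @ l # b" using eq by simp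
      ultimately obtain a' where a': "a = (lpow c i @ [m]) @ a'" "blocks c bs @ lpow c k = a' @ l # b"
        using append_eq_append_le by metis
      then obtain bs1 j bs2 where "bs = bs1 @ (j, l) # bs2 \<and> a' = blocks c bs1 @ lpow c j"
        using Cons.IH by blast
      then show ?thesis using a' x
        by (intro exI[of _ "(i, m) # bs1"] exI[of _ j] exI[of _ bs2]) simp
    qed
  qed
  then show ?thesis using that by blast
qed

lemma sublist_replicate_append:
  assumes "sublist (replicate m z) (xs @ y # ys)" "y \<noteq> z"
  shows "sublist (replicate m z) xs \<or> sublist (replicate m z) ys"
proof -
  obtain a b where eq: "xs @ y # ys = a @ replicate m z @ b" using assms(1) by (auto simp: sublist_def)
  show ?thesis
  proof (cases "length (a @ replicate m z) \<le> length xs")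
    case True
    then obtain e where "xs = (a @ replicate m z) @ e"
      using append_eq_append_le[of "a @ replicate m z" b xs "y # ys"] eq by auto
    then show ?thesis by (auto simp: sublist_def)
  next
    case False
    have "length (xs @ [y]) \<le> length a"
    proof (rule ccontr)
      assume *: "\<not> length (xs @ [y]) \<le> length a"
      have "(a @ replicate m z @ b) ! length xs = y" unfolding eq[symmetric] by simp
      moreover have "(a @ replicate m z @ b) ! length xs = z"
        using False * by (auto simp: nth_append)
      ultimately show False using assms(2) by simp
    qed
    moreover have "(xs @ [y]) @ ys = a @ replicate m z @ b" using eq by simp
    ultimately obtain e where "ys = e @ replicate m z @ b"
      using append_eq_append_le by metis
    then show ?thesis by (auto simp: sublist_def)
  qed
qed

text \<open>Read from the right with \<open>takeWhile\<close>, the word shows only its trailing run,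
  because the last block ends in a letter different from \<open>c^(+-1)\<close>.\<close>

lemma suffix_replicate_lpow:
  assumes "suffix (replicate m (c, True)) (blocks c bs @ lpow c k)" "\<forall>(i, l)\<in>set bs. fst l \<noteq> c"
    "0 < m"
  shows "int m \<le> k"
proof -
  let ?P = "\<lambda>l. l = (c, True)"
  obtain z where z: "blocks c bs @ lpow c k = z @ replicate m (c, True)"
    using assms(1) by (auto simp: suffix_def)
  have "takeWhile ?P (rev (z @ replicate m (c, True))) = replicate m (c, True) @ takeWhile ?P (rev z)"
    by (simp add: takeWhile_append)
  moreover have "takeWhile ?P (rev (blocks c bs)) = []"
    using assms(2) by (cases bs rule: rev_cases) auto
  then have "takeWhile ?P (rev (blocks c bs @ lpow c k)) = (if 0 < k then lpow c k else [])"
    by (cases "nat \<bar>k\<bar>") (auto simp: lpow_def takeWhile_append replicate_append_same)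
  ultimately have "(if 0 < k then lpow c k else []) = replicate m (c, True) @ takeWhile ?P (rev z)"
    using z by simp
  from arg_cong[OF this, of length] have "m \<le> length (if 0 < k then lpow c k else [])"
    by (simp only: length_append length_replicate)
  then show ?thesis using assms(3) by (auto split: if_splits)
qed

text \<open>The integer power \<open>c^k\<close>.\<close>

definition cval :: "'x \<Rightarrow> int \<Rightarrow> 'x fg" where
  "cval c k = mk (lpow c k)"

lemma cval_0 [simp]: "cval c 0 = 1"
  by (simp add: cval_def)

lemma cval_plus_one: "cval c (k + 1) = cval c k * gen c"
proof (cases "k \<ge> 0")
  case True
  then have "lpow c (k + 1) = lpow c k @ [(c, True)]"
    by (cases "k = 0") (auto simp: lpow_def nat_add_distrib replicate_append_same)
  then show ?thesis by (simp add: cval_def mk_append gen_def)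
next
  case False
  then have "nat \<bar>k\<bar> = Suc (nat \<bar>k + 1\<bar>)" by simp
  then have "lpow c k = lpow c (k + 1) @ [(c, False)]"
    using False by (simp add: lpow_def replicate_append_same)
  then have "cval c k = cval c (k + 1) * inverse (gen c)"
    by (simp add: cval_def mk_append mk_single)
  then show ?thesis by (simp add: mult.assoc)
qed

lemma cval_add: "cval c (i + j) = cval c i * cval c j"
proof (induction j rule: int_induct[of _ 0])
  case base
  then show ?case by (simp add: cval_def)
next
  case (step1 j)
  then show ?case by (simp add: cval_plus_one mult.assoc flip: add.assoc)
next
  case (step2 j)
  have "cval c (i + (j - 1)) * gen c = cval c (i + j)" "cval c (j - 1) * gen c = cval c j"
    using cval_plus_one[of c "i + (j - 1)"] cval_plus_one[of c "j - 1"] by (simp_all add: algebra_simps)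
  then have "cval c (i + (j - 1)) * gen c = cval c i * cval c (j - 1) * gen c"
    using step2 by (simp add: mult.assoc)
  then show ?case by (simp only: fg_mult_right_cancel)
qed

lemma cval_of_nat: "cval c (int n) = gen c ^ n" "cval c (- int n) = inverse (gen c) ^ n"
proof -
  show *: "cval c (int n) = gen c ^ n" for n
    by (induction n) (simp, metis add.commute cval_plus_one of_nat_Suc power_Suc2)
  show "cval c (- int n) = inverse (gen c) ^ n"
    using cval_add[of c "int n" "- int n"] *[of n] fg_inverse_unique[of "gen c ^ n" "cval c (- int n)"]
    by (simp add: fg_inverse_power)
qed

lemma iso_ext_hom:
  assumes "\<And>x. x \<in> A \<Longrightarrow> f x \<in> Fr A" "\<And>x. x \<in> A \<Longrightarrow> f' x \<in> Fr A"
    and "\<And>x. x \<in> A \<Longrightarrow> ext_hom f' (f x) = gen x" "\<And>x. x \<in> A \<Longrightarrow> ext_hom f (f' x) = gen x"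
  shows "ext_hom f \<in> iso (FG A) (FG A)"
proof -
  have "ext_hom f' (ext_hom f g) = g" if "g \<in> Fr A" for g
    using that by (induction g rule: Fr_induct) (use assms in auto)
  moreover have "ext_hom f (ext_hom f' g) = g" if "g \<in> Fr A" for g
    using that by (induction g rule: Fr_induct) (use assms in auto)
  moreover have "ext_hom f g \<in> Fr A" "ext_hom f' g \<in> Fr A" if "g \<in> Fr A" for g
    using that assms ext_hom_Fr by blast+
  ultimately have "bij_betw (ext_hom f) (Fr A) (Fr A)"
    by (intro bij_betwI[of _ _ _ "ext_hom f'"]) auto
  moreover have "ext_hom f \<in> hom (FG A) (FG A)"
    using ext_hom_Fr[of A f A] assms(1) by (intro homI) simp_all
  ultimately show ?thesis by (simp add: iso_def)
qed

text \<open>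
  The substitution of the rank reduction step is split into the automorphism \<open>\<theta>\<close>, which surrounds
  \<open>e\<close> by powers of \<open>c\<close>, and the letter map \<open>\<rho>\<close>, which identifies \<open>e\<close> with \<open>d\<close>. On words avoiding
  \<open>c\<^sup>n\<close>, the run of length \<open>3n\<close> in front of \<open>e\<close> cannot be confused with any other run.
\<close>

locale three_letters =
  fixes c d e :: 'x and n :: nat
  assumes distinct: "c \<noteq> d" "c \<noteq> e" "d \<noteq> e" and n_pos: "0 < n"
begin

definition \<rho> :: "'x \<Rightarrow> 'x" where
  "\<rho> x = (if x = e then d else x)"

definition \<theta> :: "'x fg \<Rightarrow> 'x fg" where
  "\<theta> = ext_hom (\<lambda>x. if x = e then gen c ^ n * gen d * gen c ^ (3 * n) * gen e * gen c ^ n else gen x)"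

text \<open>
  The action of \<open>\<theta>\<close> on the block decomposition of a word; the exponent \<open>r\<close> is carried over
  from the image of the preceding block.
\<close>

fun \<theta>_blocks :: "int \<Rightarrow> (int \<times> 'x \<times> bool) list \<Rightarrow> (int \<times> 'x \<times> bool) list" where
  "\<theta>_blocks r [] = []"
| "\<theta>_blocks r ((i, l) # bs) =
     (if l = (e, True) then (r + i + int n, (d, True)) # (3 * int n, (e, True)) # \<theta>_blocks (int n) bs
      else if l = (e, False) then (r + i - int n, (e, False)) # (- 3 * int n, (d, False)) # \<theta>_blocks (- int n) bs
      else (r + i, l) # \<theta>_blocks 0 bs)"

text \<open>The exponent which the last block hands over to the trailing run of \<open>c\<close>;
  the start value \<open>r\<close> matters only if there is no block.\<close>

fun \<theta>_carry :: "int \<Rightarrow> (int \<times> 'x \<times> bool) list \<Rightarrow> int" where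
  "\<theta>_carry r [] = r"
| "\<theta>_carry r ((i, l) # bs) =
     \<theta>_carry (if l = (e, True) then int n else if l = (e, False) then - int n else 0) bs"

lemma \<theta>_simps [simp]:
  "\<theta> (g * h) = \<theta> g * \<theta> h" "\<theta> 1 = 1" "\<theta> (inverse g) = inverse (\<theta> g)" "\<theta> (g ^ m) = \<theta> g ^ m"
  "\<theta> (gen e) = gen c ^ n * gen d * gen c ^ (3 * n) * gen e * gen c ^ n"
  "x \<noteq> e \<Longrightarrow> \<theta> (gen x) = gen x"
  by (simp_all add: \<theta>_def)

lemma \<theta>_cval [simp]: "\<theta> (cval c k) = cval c k"
  using cval_of_nat[of c "nat \<bar>k\<bar>"] distinct by (cases "k \<ge> 0") auto

lemma mk_block_Cons: "mk (lpow c i @ l # w) = cval c i * mk [l] * mk w"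
  by (simp add: cval_def mult.assoc flip: mk_append)

lemma \<theta>_blocks_value:
  "mk (blocks c (\<theta>_blocks r bs) @ lpow c (\<theta>_carry r bs + k)) = cval c r * \<theta> (mk (blocks c bs @ lpow c k))"
proof (induction bs arbitrary: r)
  case Nil
  show ?case by (simp add: cval_add flip: cval_def)
next
  case (Cons b bs)
  obtain i x s where b: "b = (i, x, s)" by (cases b)
  have c3: "cval c (int n) = gen c ^ n" "cval c (3 * int n) = gen c ^ (3 * n)"
    "cval c (- int n) = inverse (gen c) ^ n" "cval c (- (3 * int n)) = inverse (gen c) ^ (3 * n)"
    using cval_of_nat[of c n] cval_of_nat[of c "3 * n"] by simp_all
  have sub: "cval c (r + i - int n) = cval c r * cval c i * cval c (- int n)"
    using cval_add[of c "r + i" "- int n"] cval_add[of c r i] by simp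
  show ?case
    using distinct Cons.IH
    by (cases "x = e"; cases s)
      (simp_all add: b mk_block_Cons cval_add sub mk_single fg_inverse_mult c3 mult.assoc
        fg_inverse_power)
qed

text \<open>Reducedness together with avoidance of \<open>c^n\<close>, in block form;
  \<open>p\<close> is the letter that ends the preceding block, \<open>None\<close> at the
  beginning.\<close>

fun source_ok :: "('x \<times> bool) option \<Rightarrow> (int \<times> 'x \<times> bool) list \<Rightarrow> bool" where
  "source_ok p [] \<longleftrightarrow> True"
| "source_ok p ((i, l) # bs) \<longleftrightarrow> \<bar>i\<bar> < int n \<and> fst l \<noteq> c \<and>
     (i = 0 \<longrightarrow> p \<noteq> Some (linv l)) \<and> source_ok (Some l) bs"

definition \<rho>_letter :: "'x \<times> bool \<Rightarrow> 'x \<times> bool" where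
  "\<rho>_letter l = (\<rho> (fst l), snd l)"

text \<open>No cancellation occurs even after \<open>e\<close> has been identified with
  \<open>d\<close>, and the run in front tells a positive \<open>e\<close> from a positive
  \<open>d\<close>. Inverse letters have no such clause: they are decoded in the inverse
  word.\<close>

fun target_ok :: "('x \<times> bool) option \<Rightarrow> (int \<times> 'x \<times> bool) list \<Rightarrow> bool" where
  "target_ok q [] \<longleftrightarrow> True"
| "target_ok q ((k, l) # bs) \<longleftrightarrow> \<bar>k\<bar> \<le> 3 * int n \<and> fst l \<noteq> c \<and>
     (l = (e, True) \<longrightarrow> k = 3 * int n) \<and> (l = (d, True) \<longrightarrow> k < 3 * int n) \<and>
     (k = 0 \<longrightarrow> map_option \<rho>_letter q \<noteq> Some (linv (\<rho>_letter l))) \<and> target_ok (Some l) bs"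

text \<open>The second assumption lists what the preceding source letter leaves behind: the image of
  \<open>e\<close> ends in \<open>e c^n\<close>, that of its inverse in the inverse of
  \<open>d\<close> followed by \<open>c^(-n)\<close>. As \<open>\<bar>r\<bar> \<le> n\<close> and
  \<open>\<bar>i\<bar> < n\<close>, a run in front of \<open>d\<close> stays below
  \<open>3n\<close>, and a run can vanish only where the source already had none.\<close>

lemma target_ok_\<theta>_blocks:
  assumes "source_ok p bs"
    and "(p = None \<and> r = 0 \<and> q = None) \<or> (p = Some (e, True) \<and> r = int n \<and> q = p) \<or>
      (p = Some (e, False) \<and> r = - int n \<and> q = Some (d, False)) \<or>
      (\<exists>l. p = Some l \<and> fst l \<noteq> e \<and> r = 0 \<and> q = p)"
  shows "target_ok q (\<theta>_blocks r bs)"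
  using assms
proof (induction bs arbitrary: p q r)
  case (Cons b bs)
  obtain i x s where b: "b = (i, x, s)" by (cases b)
  have r: "\<bar>r\<bar> \<le> int n" and i: "\<bar>i\<bar> < int n" and x: "x \<noteq> c" using Cons.prems b by auto
  consider "x = e" s | "x = e" "\<not> s" | "x \<noteq> e" by blast
  then show ?case
  proof cases
    case 1
    then have "target_ok (Some (e, True)) (\<theta>_blocks (int n) bs)"
      using Cons.prems b by (intro Cons.IH[of "Some (e, True)"]) auto
    then show ?thesis using 1 Cons.prems b r i x distinct n_pos
      by (auto simp: \<rho>_letter_def \<rho>_def)
  next
    case 2
    then have "target_ok (Some (d, False)) (\<theta>_blocks (- int n) bs)"
      using Cons.prems b by (intro Cons.IH[of "Some (e, False)"]) auto
    then show ?thesis using 2 Cons.prems b r i x distinct n_pos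
      by (auto simp: \<rho>_letter_def \<rho>_def)
  next
    case 3
    then have "target_ok (Some (x, s)) (\<theta>_blocks 0 bs)"
      using Cons.prems b by (intro Cons.IH[of "Some (x, s)"]) auto
    then show ?thesis using 3 Cons.prems b r i x distinct n_pos
      by (auto simp: \<rho>_letter_def \<rho>_def)
  qed
qed simp

lemma lmap_\<rho>: "lmap \<rho> w = map \<rho>_letter w"
  by (simp add: lmap_def \<rho>_letter_def split_def)

lemma \<rho>_letter_linv [simp]: "\<rho>_letter (linv l) = linv (\<rho>_letter l)"
  by (simp add: \<rho>_letter_def linv_def)

lemma fst_\<rho>_letter_eq_c [simp]: "fst (\<rho>_letter l) = c \<longleftrightarrow> fst l = c"
  using distinct by (auto simp: \<rho>_letter_def \<rho>_def)

lemma \<rho>_letter_eq_c [simp]: "\<rho>_letter l = (c, s) \<longleftrightarrow> l = (c, s)"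
  using distinct by (cases l) (auto simp: \<rho>_letter_def \<rho>_def)

lemma \<rho>_letter_c [simp]: "\<rho>_letter (c, s) = (c, s)"
  by simp

lemma map_\<rho>_letter_lpow [simp]: "map \<rho>_letter (lpow c k) = lpow c k"
  using distinct by (simp add: lpow_def \<rho>_letter_def \<rho>_def)

lemma map_\<rho>_letter_replicate: "map \<rho>_letter v = replicate m (c, s) \<Longrightarrow> v = replicate m (c, s)"
  by (induction v arbitrary: m) (auto simp: Cons_replicate_eq)

lemma reduced_map_\<rho>_letter: "reduced (map \<rho>_letter w) \<Longrightarrow> reduced w"
proof (induction w)
  case (Cons l w)
  then have "\<rho>_letter (hd w) \<noteq> linv (\<rho>_letter l)" if "w \<noteq> []"
    using that by (simp add: reduced_Cons hd_map)
  then have "hd w \<noteq> linv l" if "w \<noteq> []" using that \<rho>_letter_linv by metis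
  then show ?case using Cons by (simp add: reduced_Cons)
qed simp

lemma reduced_lpow_Cons:
  assumes "reduced (m # v)" "fst m \<noteq> c"
  shows "reduced (lpow c i @ m # v)"
    and "fst l \<noteq> c \<Longrightarrow> (i = 0 \<Longrightarrow> m \<noteq> linv l) \<Longrightarrow> reduced (l # lpow c i @ m # v)"
proof -
  have hd: "i \<noteq> 0 \<Longrightarrow> last (lpow c i) = (c, 0 < i)" "i \<noteq> 0 \<Longrightarrow> hd (lpow c i) = (c, 0 < i)"
    by (simp_all add: lpow_def last_replicate hd_replicate)
  show *: "reduced (lpow c i @ m # v)"
    using assms hd by (cases "i = 0") (auto simp: reduced_append)
  show "reduced (l # lpow c i @ m # v)" if "fst l \<noteq> c" "i = 0 \<Longrightarrow> m \<noteq> linv l"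
    using * hd that by (cases "i = 0") (auto simp: reduced_Cons linv_def)
qed

text \<open>Reducedness is proved after the identification of letters, which is the stronger form;
  the preceding letter is prefixed to make the induction work.\<close>

lemma target_ok_reduced:
  assumes "target_ok q bs" "\<And>l. q = Some l \<Longrightarrow> fst l \<noteq> c"
  shows "reduced (map \<rho>_letter (case q of None \<Rightarrow> [] | Some l \<Rightarrow> [l]) @ map \<rho>_letter (blocks c bs @ lpow c k))"
  using assms
proof (induction bs arbitrary: q)
  case Nil
  have "reduced (l # lpow c k)" if "fst l \<noteq> c" for l
    using that by (cases "k = 0") (auto simp: reduced_Cons lpow_def hd_replicate linv_def reduced_replicate)
  then show ?case using Nil by (auto split: option.splits)
next
  case (Cons b bs)
  obtain i m where b: "b = (i, m)" by (cases b)
  have "reduced (\<rho>_letter m # map \<rho>_letter (blocks c bs @ lpow c k))"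
    using Cons.IH[of "Some m"] Cons.prems b by simp
  note tail = reduced_lpow_Cons[where m = "\<rho>_letter m", OF this]
  have m: "fst (\<rho>_letter m) \<noteq> c" using Cons.prems b by simp
  show ?case
  proof (cases q)
    case None
    then show ?thesis using tail(1)[OF m] b by simp
  next
    case (Some l)
    have "reduced (\<rho>_letter l # lpow c i @ \<rho>_letter m # map \<rho>_letter (blocks c bs @ lpow c k))"
      using Cons.prems b Some by (intro tail(2)[OF m]) auto
    then show ?thesis using Some b by simp
  qed
qed

lemma target_ok_block:
  "target_ok q (bs1 @ (k, l) # bs2) \<Longrightarrow> \<bar>k\<bar> \<le> 3 * int n \<and> fst l \<noteq> c \<and>
     (l = (e, True) \<longrightarrow> k = 3 * int n) \<and> (l = (d, True) \<longrightarrow> k < 3 * int n)"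
  by (induction q bs1 rule: target_ok.induct) auto

lemma target_ok_letters: "target_ok q bs \<Longrightarrow> \<forall>(i, l)\<in>set bs. fst l \<noteq> c"
  by (induction q bs rule: target_ok.induct) auto

lemma target_ok_avoids:
  assumes "target_ok q bs" "\<bar>k\<bar> \<le> 3 * int n"
  shows "\<not> sublist (replicate (3 * n + 1) (c, s)) (blocks c bs @ lpow c k)"
proof -
  have short: "\<not> sublist (replicate (3 * n + 1) (c, s)) (lpow c i)" if "\<bar>i\<bar> \<le> 3 * int n" for i
    using that sublist_length_le[of "replicate (3 * n + 1) (c, s)" "lpow c i"] by auto
  show ?thesis
    using assms(1)
  proof (induction bs arbitrary: q)
    case Nil
    then show ?case using short assms(2) by simp
  next
    case (Cons b bs)
    obtain i m where b: "b = (i, m)" by (cases b)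
    then have "m \<noteq> (c, s)" "\<bar>i\<bar> \<le> 3 * int n" using Cons.prems by auto
    then show ?case
      using sublist_replicate_append[of "3 * n + 1" "(c, s)" "lpow c i" m "blocks c bs @ lpow c k"]
        short Cons.IH[of "Some m"] Cons.prems b by auto
  qed
qed

lemma source_okI:
  assumes "reduced ((case p of None \<Rightarrow> [] | Some l \<Rightarrow> [l]) @ blocks c bs @ lpow c k)"
    and "\<And>s. \<not> sublist (replicate n (c, s)) (blocks c bs @ lpow c k)"
    and "\<forall>(i, l)\<in>set bs. fst l \<noteq> c"
  shows "source_ok p bs" "\<bar>k\<bar> < int n"
proof -
  have short: "\<bar>i\<bar> < int n" if "sublist (lpow c i) (blocks c bs @ lpow c k)"
    "\<And>s. \<not> sublist (replicate n (c, s)) (blocks c bs @ lpow c k)" for i bs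
  proof (rule ccontr)
    assume "\<not> \<bar>i\<bar> < int n"
    then have "lpow c i = replicate n (c, 0 < i) @ replicate (nat \<bar>i\<bar> - n) (c, 0 < i)"
      by (simp add: lpow_def flip: replicate_add)
    then have "sublist (replicate n (c, 0 < i)) (lpow c i)" by (metis sublist_append_rightI)
    then show False using that sublist_order.order_trans by blast
  qed
  show "\<bar>k\<bar> < int n" using short[of k bs] assms(2) by simp
  show "source_ok p bs"
    using assms
  proof (induction bs arbitrary: p)
    case (Cons b bs)
    obtain i m where b: "b = (i, m)" by (cases b)
    have w: "blocks c (b # bs) @ lpow c k = lpow c i @ m # (blocks c bs @ lpow c k)" by (simp add: b)
    have "reduced (m # blocks c bs @ lpow c k)"
      using Cons.prems(1) unfolding w by (auto simp: reduced_append split: option.splits dest: reduced_appendD)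
    moreover have "\<not> sublist (replicate n (c, s)) (blocks c bs @ lpow c k)" for s
      using Cons.prems(2)[of s] unfolding w
      by (metis append_Cons append_assoc sublist_append_leftI sublist_order.order_trans append_Nil)
    ultimately have "source_ok (Some m) bs" using Cons.prems(3) by (intro Cons.IH) auto
    moreover have "\<bar>i\<bar> < int n" using short[of i "b # bs"] Cons.prems(2) unfolding w by simp
    moreover have "p \<noteq> Some (linv m)" if "i = 0" using Cons.prems(1) that unfolding w by auto
    ultimately show ?case using Cons.prems b by simp
  qed simp
qed

lemma \<theta>_carry_bound: "\<bar>r\<bar> \<le> int n \<Longrightarrow> \<bar>\<theta>_carry r bs\<bar> \<le> int n"
  by (induction r bs rule: \<theta>_carry.induct) auto

text \<open>The blocks computed by \<open>\<theta>_blocks\<close> are reduced, so they spell the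
  word of \<open>\<theta> g\<close> and not merely some word for it.\<close>

lemma word_\<theta>:
  assumes "\<And>s. \<not> sublist (replicate n (c, s)) (word g)"
  obtains bs k where "word (\<theta> g) = blocks c bs @ lpow c k" "target_ok None bs" "\<bar>k\<bar> \<le> 3 * int n"
proof -
  obtain bs k where w: "word g = blocks c bs @ lpow c k" "\<forall>(i, l)\<in>set bs. fst l \<noteq> c"
    by (rule exists_blocks[OF reduced_word])
  have red: "reduced (blocks c bs @ lpow c k)" unfolding w(1)[symmetric] by simp
  have "source_ok None bs" "\<bar>k\<bar> < int n"
    using source_okI[of None bs k] red assms w by auto
  then have ok: "target_ok None (\<theta>_blocks 0 bs)" by (intro target_ok_\<theta>_blocks) auto
  then have "reduced (blocks c (\<theta>_blocks 0 bs) @ lpow c (\<theta>_carry 0 bs + k))"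
    using target_ok_reduced[of None "\<theta>_blocks 0 bs" "\<theta>_carry 0 bs + k"]
    by (simp add: reduced_map_\<rho>_letter flip: map_append)
  moreover have "mk (blocks c (\<theta>_blocks 0 bs) @ lpow c (\<theta>_carry 0 bs + k)) = \<theta> g"
    unfolding \<theta>_blocks_value w(1)[symmetric] by simp
  ultimately have "word (\<theta> g) = blocks c (\<theta>_blocks 0 bs) @ lpow c (\<theta>_carry 0 bs + k)"
    by (metis word_mk)
  moreover have "\<bar>\<theta>_carry 0 bs + k\<bar> \<le> 3 * int n"
    using \<theta>_carry_bound[of 0 bs] \<open>\<bar>k\<bar> < int n\<close> by auto
  ultimately show ?thesis using that ok by blast
qed

text \<open>The last two facts are the decoding rule: a positive \<open>e\<close> is preceded by a
  run of \<open>3 * n\<close> letters \<open>c\<close>, a positive \<open>d\<close> never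
  is.\<close>

lemma
  assumes "\<And>s. \<not> sublist (replicate n (c, s)) (word g)"
  shows reduced_lmap_\<theta>: "reduced (lmap \<rho> (word (\<theta> g)))"
    and avoids_\<theta>: "\<not> sublist (replicate (3 * n + 1) (c, s)) (word (\<theta> g))"
    and before_e: "word (\<theta> g) = a @ (e, True) # b \<Longrightarrow> suffix (replicate (3 * n) (c, True)) a"
    and before_d: "word (\<theta> g) = a @ (d, True) # b \<Longrightarrow> \<not> suffix (replicate (3 * n) (c, True)) a"
proof -
  obtain bs k where w: "word (\<theta> g) = blocks c bs @ lpow c k" "target_ok None bs" "\<bar>k\<bar> \<le> 3 * int n"
    by (rule word_\<theta>[OF assms])
  show "reduced (lmap \<rho> (word (\<theta> g)))"
    using target_ok_reduced[OF w(2), of k] by (simp add: w(1) lmap_\<rho>)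
  show "\<not> sublist (replicate (3 * n + 1) (c, s)) (word (\<theta> g))"
    unfolding w(1) by (rule target_ok_avoids[OF w(2,3)])
  show "suffix (replicate (3 * n) (c, True)) a" if "word (\<theta> g) = a @ (e, True) # b"
  proof -
    have eq: "blocks c bs @ lpow c k = a @ (e, True) # b" and "fst (e, True) \<noteq> c"
      using that w(1) distinct by simp_all
    then obtain bs1 i bs2 where b: "bs = bs1 @ (i, e, True) # bs2" "a = blocks c bs1 @ lpow c i"
      by (rule blocks_split)
    then have "i = 3 * int n" using target_ok_block w(2) by blast
    then show ?thesis using b(2) n_pos by (simp add: lpow_def suffix_def nat_mult_distrib)
  qed
  show "\<not> suffix (replicate (3 * n) (c, True)) a" if "word (\<theta> g) = a @ (d, True) # b"
  proof
    assume suf: "suffix (replicate (3 * n) (c, True)) a"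
    have eq: "blocks c bs @ lpow c k = a @ (d, True) # b" and "fst (d, True) \<noteq> c"
      using that w(1) distinct by simp_all
    then obtain bs1 i bs2 where b: "bs = bs1 @ (i, d, True) # bs2" "a = blocks c bs1 @ lpow c i"
      by (rule blocks_split)
    then have "i < 3 * int n" using target_ok_block w(2) by blast
    moreover have "\<forall>(i, l)\<in>set bs1. fst l \<noteq> c" using target_ok_letters[OF w(2)] b by auto
    then have "int (3 * n) \<le> i"
      using suffix_replicate_lpow[of "3 * n" c bs1 i] suf n_pos unfolding b(2) by simp
    ultimately show False by simp
  qed
qed

context
  fixes A :: "'x set" and H K :: "'x fg set"
  assumes letters: "c \<in> A" "d \<in> A" "e \<in> A"
    and HK: "subgroup H (FG A)" "subgroup K (FG A)" "avoids c n H" "avoids c n K"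
begin

lemma \<theta>_iso: "\<theta> \<in> iso (FG A) (FG A)"
  unfolding \<theta>_def
proof (rule iso_ext_hom[of A _ "\<lambda>x. if x = e
    then inverse (gen c ^ n * gen d * gen c ^ (3 * n)) * gen e * inverse (gen c ^ n) else gen x"])
qed (use distinct letters in \<open>auto simp: mult.assoc fg_inverse_mult\<close>)

lemma \<theta>_group_hom: "group_hom (FG A) (FG A) \<theta>"
  using \<theta>_iso by (simp add: group_hom_def group_hom_axioms_def iso_def)

lemma not_infix: "g \<in> H \<union> K \<Longrightarrow> \<not> sublist (replicate n (c, s)) (word g)"
  using HK by (auto simp: avoids_def)

text \<open>The run that announces \<open>e\<close> lies within the last \<open>3 * n\<close>
  letters of the margin. It is still visible after \<open>\<rho>\<close>, since
  \<open>\<rho>\<close> fixes \<open>c\<close> and sends no other letter to it.\<close>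

lemma window_letter:
  assumes "g \<in> H \<union> K" "g' \<in> H \<union> K"
    and "sublist (a @ (e, True) # b) (word (\<theta> g))" "sublist (a' @ (d, True) # b') (word (\<theta> g'))"
    and "lmap \<rho> a = lmap \<rho> a'" "3 * n \<le> length a"
  shows False
proof -
  obtain p q where pq: "word (\<theta> g) = (p @ a) @ (e, True) # (b @ q)"
    using assms(3) by (auto simp: sublist_def)
  obtain p' q' where pq': "word (\<theta> g') = (p' @ a') @ (d, True) # (b' @ q')"
    using assms(4) by (auto simp: sublist_def)
  have "suffix (replicate (3 * n) (c, True)) (p @ a)"
    using before_e[OF not_infix[OF assms(1)] pq] .
  then have "suffix (replicate (3 * n) (c, True)) a"
    by (rule suffix_length_suffix) (use assms(6) in \<open>simp_all add: suffix_def\<close>)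
  then obtain z where "a = z @ replicate (3 * n) (c, True)" by (auto simp: suffix_def)
  then have "map \<rho>_letter a' = map \<rho>_letter z @ replicate (3 * n) (c, True)"
    using assms(5) by (simp add: lmap_\<rho> flip: map_append)
  then obtain z' v where "a' = z' @ v" "map \<rho>_letter v = replicate (3 * n) (c, True)"
    by (auto simp: map_eq_append_conv)
  then have "a' = z' @ replicate (3 * n) (c, True)"
    using map_\<rho>_letter_replicate by metis
  then have "suffix (replicate (3 * n) (c, True)) (p' @ a')" by (auto simp: suffix_def)
  then show False using before_d[OF not_infix[OF assms(2)] pq'] by blast
qed

lemma locally_invertible_\<rho>: "locally_invertible A (\<theta> ` H) (\<theta> ` K) \<rho> (3 * n)"
proof (rule locally_invertible.intro)
  show "subgroup (\<theta> ` H) (FG A)" "subgroup (\<theta> ` K) (FG A)"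
    using group_hom.subgroup_img_is_subgroup[OF \<theta>_group_hom] HK(1,2) by blast+
next
  fix w assume "w \<in> {w. \<exists>g\<in>\<theta> ` H \<union> \<theta> ` K. sublist w (word g)}"
  then obtain g where g: "g \<in> H \<union> K" "sublist w (word (\<theta> g))" by blast
  have "reduced (lmap \<rho> (word (\<theta> g)))" by (rule reduced_lmap_\<theta>[OF not_infix[OF g(1)]])
  then show "reduced (lmap \<rho> w)" using g(2) by (auto simp: sublist_def dest!: reduced_appendD)
next
  fix a l b a' l' b'
  assume "a @ l # b \<in> {w. \<exists>g\<in>\<theta> ` H \<union> \<theta> ` K. sublist w (word g)}"
    and "a' @ l' # b' \<in> {w. \<exists>g\<in>\<theta> ` H \<union> \<theta> ` K. sublist w (word g)}"
    and eq: "lmap \<rho> (a @ l # b) = lmap \<rho> (a' @ l' # b')" "length a = length a'"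
    and long: "3 * n \<le> length a" "3 * n \<le> length b"
  then obtain g g' where g: "g \<in> H \<union> K" "sublist (a @ l # b) (word (\<theta> g))"
    and g': "g' \<in> H \<union> K" "sublist (a' @ l' # b') (word (\<theta> g'))" by blast
  have lm: "lmap \<rho> a = lmap \<rho> a'" "lmap \<rho> b = lmap \<rho> b'" "\<rho>_letter l = \<rho>_letter l'"
    using eq by (simp_all add: lmap_\<rho>)
  have long': "3 * n \<le> length a'" "3 * n \<le> length b'"
    using long lm(1,2) by (metis lmap_simps(4))+
  have inv: "inverse g \<in> H \<union> K" "inverse g' \<in> H \<union> K"
    using g(1) g'(1) subgroup_FG_closed(4)[OF HK(1)] subgroup_FG_closed(4)[OF HK(2)] by blast+
  \<comment> \<open>For inverse letters the rule is applied to the inverse elements, so the right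
    margin takes the role of the left one; this is why the window extends to both sides.\<close>
  have sub_inv: "sublist (winv v @ linv m # winv u) (word (\<theta> (inverse h)))"
    if sub: "sublist (u @ m # v) (word (\<theta> h))" for u m v h
  proof -
    obtain p q where "word (\<theta> h) = p @ (u @ m # v) @ q" using sub by (auto simp: sublist_def)
    then have "word (\<theta> (inverse h)) = winv q @ (winv v @ linv m # winv u) @ winv p" by simp
    then show ?thesis by (metis sublist_appendI)
  qed
  have lm_inv: "lmap \<rho> (winv u) = winv (lmap \<rho> u)" for u
    by (simp add: lmap_\<rho> winv_def rev_map)
  show "l = l'"
  proof (rule ccontr)
    assume "l \<noteq> l'"
    then have "\<exists>s. (l = (e, s) \<and> l' = (d, s)) \<or> (l = (d, s) \<and> l' = (e, s))"
      using lm(3) by (cases l; cases l') (auto simp: \<rho>_letter_def \<rho>_def split: if_splits)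
    then consider "l = (e, True)" "l' = (d, True)" | "l = (d, True)" "l' = (e, True)"
      | "l = (e, False)" "l' = (d, False)" | "l = (d, False)" "l' = (e, False)"
      by (metis (full_types))
    then show False
    proof cases
      case 1
      then show ?thesis using window_letter[of g g' a b a' b'] g g' lm long by simp
    next
      case 2
      then show ?thesis using window_letter[of g' g a' b' a b] g g' lm long' by simp
    next
      case 3
      then show ?thesis
        using window_letter[OF inv, of "winv b" "winv a" "winv b'" "winv a'"]
          sub_inv[OF g(2)] sub_inv[OF g'(2)] lm lm_inv long by simp
    next
      case 4
      then show ?thesis
        using window_letter[OF inv(2,1), of "winv b'" "winv a'" "winv b" "winv a"]
          sub_inv[OF g(2)] sub_inv[OF g'(2)] lm lm_inv long' by simp
    qed
  qed
qed

theorem conj_faithful_eliminate: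
  "conj_faithful (FG A) (FG (A - {e})) (letter_hom \<rho> \<circ> \<theta>) H K"
proof -
  have "\<rho> ` A = A - {e}" using letters distinct by (auto simp: \<rho>_def image_iff)
  then have "conj_faithful (FG A) (FG (A - {e})) (letter_hom \<rho>) (\<theta> ` H) (\<theta> ` K)"
    using locally_invertible.conj_faithful_letter_hom[OF locally_invertible_\<rho>] by simp
  moreover have "conj_faithful (FG A) (FG A) \<theta> H K"
    using HK(1,2)[THEN subgroup.subset] \<theta>_iso by (intro conj_faithful_iso) simp_all
  ultimately show ?thesis by (intro conj_faithful_comp[OF _ _ _ HK(1,2)]) simp_all
qed

text \<open>The letter map cancels nothing on these words, so a run of \<open>c\<close> in the image
  is a run of \<open>c\<close> in \<open>word (\<theta> g)\<close>. The bound
  \<open>3 * n + 1\<close> is the new \<open>n\<close> for the next elimination.\<close>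

lemma avoids_eliminate:
  assumes "H' \<subseteq> H \<union> K"
  shows "avoids c (3 * n + 1) ((letter_hom \<rho> \<circ> \<theta>) ` H')"
  unfolding avoids_def
proof (intro ballI allI notI)
  fix y s assume "y \<in> (letter_hom \<rho> \<circ> \<theta>) ` H'" and y: "sublist (replicate (3 * n + 1) (c, s)) (word y)"
  then obtain g where g: "g \<in> H \<union> K" "y = letter_hom \<rho> (\<theta> g)" using assms by auto
  have "reduced (lmap \<rho> (word (\<theta> g)))" by (rule reduced_lmap_\<theta>[OF not_infix[OF g(1)]])
  then have "word y = lmap \<rho> (word (\<theta> g))"
    using letter_hom_mk[of \<rho> "word (\<theta> g)"] g(2) by simp
  then obtain p q where "map \<rho>_letter (word (\<theta> g)) = p @ replicate (3 * n + 1) (c, s) @ q"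
    using y unfolding sublist_def lmap_\<rho> by auto
  then obtain p' r where r: "word (\<theta> g) = p' @ r" "map \<rho>_letter p' = p" "map \<rho>_letter r = replicate (3 * n + 1) (c, s) @ q"
    by (rule map_eq_appendE)
  from r(3) obtain v q' where v: "r = v @ q'" "map \<rho>_letter v = replicate (3 * n + 1) (c, s)" "map \<rho>_letter q' = q"
    by (rule map_eq_appendE)
  have "v = replicate (3 * n + 1) (c, s)"
    by (rule map_\<rho>_letter_replicate[OF v(2)])
  then have "sublist (replicate (3 * n + 1) (c, s)) (word (\<theta> g))"
    unfolding r(1) v(1) by (simp only: sublist_appendI)
  then show False using avoids_\<theta>[OF not_infix[OF g(1)], of s] by simp
qed

end

end

text \<open>The letter \<open>c\<close> is kept through all rounds while a letter \<open>e\<close>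
  disappears in each; \<open>H\<close>, \<open>K\<close> and the bound \<open>n\<close> change with
  every round.\<close>

theorem exists_conj_faithful_rank_2:
  fixes A :: "'x set"
  assumes "finite A" "2 \<le> card A" "c \<in> A" "subgroup H (FG A)" "subgroup K (FG A)"
    and "avoids c n H" "avoids c n K"
  shows "\<exists>(B :: 'x set) \<eta>. finite B \<and> card B = 2 \<and> conj_faithful (FG A) (FG B) \<eta> H K"
  using assms
proof (induction "card A" arbitrary: A H K n rule: less_induct)
  case less
  show ?case
  proof (cases "card A = 2")
    case True
    have "conj_faithful (FG A) (FG A) id H K"
      using less.prems(4,5)[THEN subgroup.subset] by (intro conj_faithful_iso) (simp_all add: iso_def hom_def)
    then show ?thesis using True less.prems(1) by (intro exI[of _ A] exI[of _ id] conjI)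
  next
    case False
    have "card (A - {c}) \<ge> 2" using False less.prems by simp
    then have "A - {c} \<noteq> {}" by (intro notI) simp
    then obtain d where d: "d \<in> A - {c}" by blast
    have "card (A - {c} - {d}) \<ge> 1" using \<open>card (A - {c}) \<ge> 2\<close> d less.prems(1) by simp
    then have "A - {c} - {d} \<noteq> {}" by (intro notI) simp
    then obtain e where e: "e \<in> A - {c} - {d}" by blast
    \<comment> \<open>For \<open>n = 0\<close> the empty run would be an infix of the word of
      \<open>1\<close>.\<close>
    have "0 < n"
    proof (rule ccontr)
      assume "\<not> 0 < n"
      then show False
        using less.prems(6) subgroup.one_closed[OF less.prems(4)] by (auto simp: avoids_def)
    qed
    then interpret three_letters c d e n using d e by unfold_locales auto
    let ?\<eta> = "letter_hom \<rho> \<circ> \<theta>"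
    have A: "c \<in> A" "d \<in> A" "e \<in> A" using d e less.prems by auto
    have cf: "conj_faithful (FG A) (FG (A - {e})) ?\<eta> H K"
      using A less.prems by (intro conj_faithful_eliminate) auto
    have "?\<eta> \<in> hom (FG A) (FG (A - {e}))"
      using conj_faithful_epi[OF cf] by (simp add: epi_def)
    then interpret group_hom "FG A" "FG (A - {e})" ?\<eta>
      by (simp add: group_hom_def group_hom_axioms_def)
    have card: "card (A - {e}) = card A - 1" "card A > 2" using A less.prems False by auto
    have "\<exists>(B :: 'x set) \<eta>. finite B \<and> card B = 2 \<and> conj_faithful (FG (A - {e})) (FG B) \<eta> (?\<eta> ` H) (?\<eta> ` K)"
    proof (rule less.hyps)
      show "avoids c (3 * n + 1) (?\<eta> ` H)" "avoids c (3 * n + 1) (?\<eta> ` K)"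
        using A less.prems by (intro avoids_eliminate[of A H K]; simp)+
      show "subgroup (?\<eta> ` H) (FG (A - {e}))" "subgroup (?\<eta> ` K) (FG (A - {e}))"
        using less.prems subgroup_img_is_subgroup by blast+
    qed (use card A less.prems e in auto)
    then obtain B :: "'x set" and \<eta> where B: "finite B" "card B = 2"
      "conj_faithful (FG (A - {e})) (FG B) \<eta> (?\<eta> ` H) (?\<eta> ` K)" by blast
    have "conj_faithful (FG A) (FG B) (\<eta> \<circ> ?\<eta>) H K"
      by (rule conj_faithful_comp[OF group_FG group_FG group_FG less.prems(4,5) cf B(3)])
    then show ?thesis using B(1,2) by (intro exI[of _ B] exI[of _ "\<eta> \<circ> ?\<eta>"] conjI)
  qed
qed

section \<open>Finitely generated subgroups of infinite index\<close>

definition coset :: "'x fg set \<Rightarrow> 'x fg \<Rightarrow> 'x fg set" where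
  "coset H g = (\<lambda>h. h * g) ` H"

text \<open>The coset \<open>H g\<close> is fixed by right multiplication with a positive power of
  \<open>a\<close>. Representatives \<open>g\<close> are collected instead of cosets, so the set is
  a union of cosets of \<open>H\<close>.\<close>

definition finite_orbit :: "'x set \<Rightarrow> 'x fg set \<Rightarrow> 'x fg \<Rightarrow> 'x fg set" where
  "finite_orbit A H a = {g \<in> Fr A. \<exists>n>0. g * a ^ n * inverse g \<in> H}"

text \<open>The vertices of the coset graph through which some cyclically reduced loop passes.\<close>

definition core :: "'x set \<Rightarrow> 'x fg set \<Rightarrow> 'x fg set" where
  "core A H = {g \<in> Fr A. \<exists>w. cyc w \<and> g * mk w * inverse g \<in> H}"

text \<open>Used for powers of \<open>x y^M\<close>: positive words are cyclically reduced without
  any computation.\<close>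

lemma reduced_positive: "(\<And>l. l \<in> set w \<Longrightarrow> snd l) \<Longrightarrow> reduced w"
proof (induction w)
  case (Cons l w)
  then have "snd l" "w \<noteq> [] \<Longrightarrow> snd (hd w)" by simp_all
  then have "w \<noteq> [] \<Longrightarrow> hd w \<noteq> linv l" by (auto simp: linv_def)
  with Cons show ?case by (simp add: reduced_Cons)
qed simp

lemma cyc_positive: "w \<noteq> [] \<Longrightarrow> (\<And>l. l \<in> set w \<Longrightarrow> snd l) \<Longrightarrow> cyc w"
  unfolding cyc_def by (auto intro!: reduced_positive)

context
  fixes A :: "'x set" and H :: "'x fg set"
  assumes H: "subgroup H (FG A)"
begin

lemma one_in_H: "1 \<in> H"
  using subgroup.one_closed[OF H] by simp

lemma coset_eq_iff: "coset H g = coset H g' \<longleftrightarrow> g' * inverse g \<in> H"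
proof
  assume "coset H g = coset H g'"
  then have "1 * g' \<in> coset H g" unfolding coset_def using one_in_H by blast
  then obtain h where "h \<in> H" "g' = h * g" by (auto simp: coset_def)
  then show "g' * inverse g \<in> H" by (simp add: mult.assoc)
next
  assume *: "g' * inverse g \<in> H"
  have "h * g \<in> coset H g'" if "h \<in> H" for h
  proof -
    have "h * inverse (g' * inverse g) \<in> H"
      by (rule subgroup_FG_closed(1)[OF H that subgroup_FG_closed(4)[OF H *]])
    moreover have "h * g = h * inverse (g' * inverse g) * g'" by (simp add: fg_inverse_mult mult.assoc)
    ultimately show ?thesis unfolding coset_def by blast
  qed
  moreover have "h * g' \<in> coset H g" if "h \<in> H" for h
  proof -
    have "h * (g' * inverse g) \<in> H" by (rule subgroup_FG_closed(1)[OF H that *])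
    moreover have "h * g' = h * (g' * inverse g) * g" by (simp add: mult.assoc)
    ultimately show ?thesis unfolding coset_def by blast
  qed
  ultimately show "coset H g = coset H g'" by (auto simp: coset_def)
qed

lemma coset_mult_left: "h \<in> H \<Longrightarrow> coset H (h * g) = coset H g"
  by (simp add: coset_eq_iff fg_inverse_mult mult.assoc subgroup_FG_closed(4)[OF H])

lemma coset_image_saturated:
  assumes "\<And>h g. h \<in> H \<Longrightarrow> g \<in> S \<Longrightarrow> h * g \<in> S" "coset H g \<in> coset H ` S"
  shows "g \<in> S"
proof -
  obtain g' where "g' \<in> S" "coset H g' = coset H g" using assms(2) by auto
  then have "g * inverse g' * g' \<in> S" using assms(1) by (simp add: coset_eq_iff)
  then show ?thesis by (simp add: mult.assoc)
qed

lemma finite_orbit_mult_left: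
  assumes "h \<in> H" "g \<in> finite_orbit A H a"
  shows "h * g \<in> finite_orbit A H a"
proof -
  obtain n where n: "g \<in> Fr A" "n > 0" "g * a ^ n * inverse g \<in> H"
    using assms(2) by (auto simp: finite_orbit_def)
  have "h * (g * a ^ n * inverse g) * inverse h \<in> H"
    by (intro subgroup_FG_closed[OF H] n(3) assms(1))
  then have "h * g * a ^ n * inverse (h * g) \<in> H" by (simp add: fg_inverse_mult mult.assoc)
  moreover have "h * g \<in> Fr A" using n(1) assms(1) by (simp add: subgroup_FG_closed(3)[OF H])
  ultimately show ?thesis using n(2) by (auto simp: finite_orbit_def)
qed

lemma finite_orbit_mult_right:
  assumes "g \<in> finite_orbit A H a" "b \<in> Fr A" "a * b = b * a"
  shows "g * b \<in> finite_orbit A H a"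
proof -
  obtain n where n: "g \<in> Fr A" "n > 0" "g * a ^ n * inverse g \<in> H"
    using assms(1) by (auto simp: finite_orbit_def)
  have "a ^ n * b = b * a ^ n" using assms(3) by (metis power_commuting_commutes)
  then have "b * (a ^ n * inverse b) = a ^ n" by (metis fg_right_inverse mult.assoc mult.right_neutral)
  then have "g * b * a ^ n * inverse (g * b) = g * a ^ n * inverse g"
    by (simp add: fg_inverse_mult mult.assoc) (simp flip: mult.assoc)
  then show ?thesis using n assms(2) by (auto simp: finite_orbit_def)
qed

text \<open>A prefix of \<open>h1 * h2\<close> is a prefix of \<open>h1\<close>, or
  \<open>h1\<close> times a prefix of \<open>h2\<close>; the left factor \<open>h1\<close> from
  \<open>H\<close> does not change the coset. So the prefixes of generators and their inverses
  already reach all these cosets.\<close>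

lemma finite_prefix_cosets:
  assumes "fin_gen_subgroup H (FG A)"
  shows "finite {coset H (mk p) |p. \<exists>h\<in>H. prefix p (word h)}" (is "finite ?P")
proof -
  obtain B where B: "finite B" "B \<subseteq> Fr A" "generate (FG A) B = H"
    using assms by (auto simp: fin_gen_subgroup_def)
  \<comment> \<open>\<open>insert 1\<close> provides the coset of the empty prefix even if
    \<open>B\<close> is empty.\<close>
  define C where "C = (\<lambda>p. coset H (mk p)) ` (\<Union>b\<in>insert 1 B. set (prefixes (word b)) \<union> set (prefixes (winv (word b))))"
  have "coset H (mk p) \<in> C" if "h \<in> generate (FG A) B" "prefix p (word h)" for h p
    using that
  proof (induction h arbitrary: p rule: generate.induct)
    case one
    then show ?case by (auto simp: C_def)
  next
    case (incl h)
    then show ?case unfolding C_def by (intro imageI UN_I[of h]) simp_all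
  next
    case (inv h)
    then have "h \<in> Fr A" using B by auto
    then show ?case using inv unfolding C_def by (intro imageI UN_I[of h]) simp_all
  next
    case (eng h1 h2)
    obtain u t v where uv: "word h1 = u @ t" "word h2 = winv t @ v" "word (h1 * h2) = u @ v"
      by (rule mult_cancellation)
    have "prefix p (u @ v)" using eng.prems uv by simp
    then consider "prefix p u" | v1 where "p = u @ v1" "prefix v1 v" by (auto simp: prefix_append)
    then show ?case
    proof cases
      case 1
      then show ?thesis using eng.IH(1)[of p] uv(1) by (simp add: prefix_append)
    next
      case 2
      have "prefix (winv t @ v1) (word h2)" using 2 uv by simp
      then have "coset H (mk (winv t @ v1)) \<in> C" by (rule eng.IH(2))
      moreover have "mk p = h1 * mk (winv t @ v1)"
      proof -
        have "h1 = mk u * mk t" using uv(1) by (metis mk_append mk_word)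
        then show ?thesis using 2 by (simp add: mk_append mk_winv mult.assoc)
      qed
      moreover have "h1 \<in> H" using eng.hyps(1) B(3) by simp
      ultimately show ?thesis by (simp add: coset_mult_left)
    qed
  qed
  then have "?P \<subseteq> C" using B(3) by blast
  moreover have "finite C" unfolding C_def using B(1) by simp
  ultimately show ?thesis by (rule finite_subset)
qed

text \<open>Running \<open>m\<close> times around the loop \<open>w\<close> before stopping protects
  the end from cancellation: \<open>g w^m\<close> is a prefix of the word of an element of
  \<open>H\<close>, and it represents the same coset as \<open>g\<close>.\<close>

lemma finite_core_cosets:
  assumes "fin_gen_subgroup H (FG A)"
  shows "finite (coset H ` core A H)"
proof (rule finite_subset[OF _ finite_prefix_cosets[OF assms]], rule image_subsetI)
  fix g assume "g \<in> core A H"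
  then obtain w where w: "cyc w" "g * mk w * inverse g \<in> H" by (auto simp: core_def)
  define m where "m = length (word g) + 1"
  obtain z where z: "word (g * mk w ^ m) = z @ w"
    using suffix_power_mult[OF w(1), of g "length (word g)" 1] by (auto simp: m_def)
  obtain z' where z': "word (mk w ^ m * inverse g) = w @ z'"
    using prefix_power_mult[OF w(1), of "inverse g" "length (word g)" 1] by (auto simp: m_def)
  have ww: "w \<noteq> []" "reduced (w @ w)" using w(1) by (auto simp: cyc_def)
  have "reduced (z @ w)" "reduced (w @ z')" unfolding z[symmetric] z'[symmetric] by simp_all
  then have "reduced (z @ w @ w @ z')"
    using reduced_glue[of w w z'] reduced_glue[of z w "w @ z'"] ww by simp
  moreover have zw: "mk (z @ w) = g * mk w ^ m" and "mk (w @ z') = mk w ^ m * inverse g"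
    unfolding z[symmetric] z'[symmetric] by simp_all
  then have "mk (z @ w @ w @ z') = (g * mk w ^ m) * (mk w ^ m * inverse g)"
    using mk_append[of "z @ w" "w @ z'"] by simp
  ultimately have "word ((g * mk w ^ m) * (mk w ^ m * inverse g)) = (z @ w) @ w @ z'"
    by (metis append_assoc word_mk)
  then have "prefix (z @ w) (word ((g * mk w ^ m) * (mk w ^ m * inverse g)))" by simp
  moreover have conj: "(g * mk w * inverse g) ^ n \<in> H" for n by (intro subgroup_FG_closed[OF H] w(2))
  have "(g * mk w ^ m) * (mk w ^ m * inverse g) = (g * mk w * inverse g) ^ (m + m)"
    unfolding fg_conj_power by (simp only: power_add mult.assoc)
  then have "(g * mk w ^ m) * (mk w ^ m * inverse g) \<in> H" using conj by simp
  moreover have "coset H (mk (z @ w)) = coset H g"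
  proof -
    have "mk (z @ w) = (g * mk w * inverse g) ^ m * g"
      unfolding zw fg_conj_power by (simp add: mult.assoc)
    then show ?thesis using conj coset_mult_left by simp
  qed
  ultimately show "coset H g \<in> {coset H (mk p) |p. \<exists>h\<in>H. prefix p (word h)}"
    by (intro CollectI exI[of _ "z @ w"]) auto
qed

lemma coset_repeat:
  assumes "finite C" "\<And>t. t \<le> card C \<Longrightarrow> coset H (g * a ^ t) \<in> C"
  obtains p where "0 < p" "p \<le> card C" "g * a ^ p * inverse g \<in> H"
proof -
  have "\<not> inj_on (\<lambda>t. coset H (g * a ^ t)) {..card C}"
  proof
    assume "inj_on (\<lambda>t. coset H (g * a ^ t)) {..card C}"
    then have "card {..card C} \<le> card C"
      by (rule card_inj_on_le) (use assms in auto)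
    then show False by simp
  qed
  then obtain s t where st: "s < t" "t \<le> card C" "coset H (g * a ^ s) = coset H (g * a ^ t)"
    unfolding inj_on_def by (metis atMost_iff linorder_neqE_nat)
  have "g * a ^ t * inverse (g * a ^ s) \<in> H" using st(3) by (simp add: coset_eq_iff)
  moreover have "a ^ t = a ^ (t - s) * a ^ s" using st(1) by (simp flip: power_add)
  ultimately have "g * a ^ (t - s) * inverse g \<in> H" by (simp add: fg_inverse_mult mult.assoc)
  then show ?thesis using that[of "t - s"] st by simp
qed

end

text \<open>A run of \<open>card ?P\<close> letters \<open>c^(+-1)\<close> passes through
  \<open>card ?P + 1\<close> prefix cosets. Two of them coincide, so the coset where the run starts
  lies on a finite orbit of \<open>c\<close>.\<close>

lemma finite_orbit_avoids:
  assumes H: "subgroup H (FG A)" "fin_gen_subgroup H (FG A)" and "finite_orbit A H (gen c) = {}"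
  obtains n where "avoids c n H"
proof -
  let ?P = "{coset H (mk p) |p. \<exists>h\<in>H. prefix p (word h)}"
  have "avoids c (card ?P) H"
    unfolding avoids_def
  proof (intro ballI allI notI)
    fix h s assume h: "h \<in> H" "sublist (replicate (card ?P) (c, s)) (word h)"
    then obtain p q where w: "word h = p @ replicate (card ?P) (c, s) @ q" by (auto simp: sublist_def)
    obtain n where n: "0 < n" "mk p * mk [(c, s)] ^ n * inverse (mk p) \<in> H"
    proof (rule coset_repeat[OF H(1) finite_prefix_cosets[OF H]])
      fix t assume "t \<le> card ?P"
      then have "replicate (card ?P) (c, s) = replicate t (c, s) @ replicate (card ?P - t) (c, s)"
        by (simp flip: replicate_add)
      then have "prefix (p @ replicate t (c, s)) (word h)" using w by simp
      moreover have "mk (replicate t (c, s)) = mk [(c, s)] ^ t"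
        using mk_wpow[of t "[(c, s)]"] by (simp add: wpow_def concat_replicate_single)
      ultimately show "coset H (mk p * mk [(c, s)] ^ t) \<in> ?P"
        using h(1) by (intro CollectI exI[of _ "p @ replicate t (c, s)"]) (auto simp: mk_append)
    qed
    have "mk p * gen c ^ n * inverse (mk p) \<in> H"
    proof (cases s)
      case False
      have "inverse (mk p * mk [(c, s)] ^ n * inverse (mk p)) \<in> H"
        by (intro subgroup_FG_closed[OF H(1)] n(2))
      then show ?thesis using False by (simp add: mk_single fg_inverse_mult fg_inverse_power mult.assoc)
    qed (use n(2) in \<open>simp add: mk_single\<close>)
    moreover have "fst ` set (word h) \<subseteq> A"
      using subgroup_FG_closed(3)[OF H(1) h(1)] by (simp add: Fr_def)
    then have "mk p \<in> Fr A" using w by (intro mk_in_Fr) auto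
    ultimately have "mk p \<in> finite_orbit A H (gen c)" using n(1) by (auto simp: finite_orbit_def)
    then show False using assms(3) by simp
  qed
  then show ?thesis using that by blast
qed

lemma avoids_mono:
  assumes "avoids c n H" "n \<le> m"
  shows "avoids c m H"
  unfolding avoids_def
proof (intro ballI allI notI)
  fix g s assume "g \<in> H" "sublist (replicate m (c, s)) (word g)"
  moreover have "sublist (replicate n (c, s)) (replicate m (c, s))"
    using assms(2) by (metis le_add_diff_inverse replicate_add sublist_append_rightI)
  ultimately have "sublist (replicate n (c, s)) (word g)" by (metis sublist_order.order_trans)
  then show False using assms(1) \<open>g \<in> H\<close> by (simp add: avoids_def)
qed

text \<open>Every coset passed while reading the closed walk \<open>(x y^M)^n\<close> belongs to the
  core, as the walk is positive. The stretch \<open>y^M\<close> passes more cosets than the core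
  has, so \<open>y\<close> returns with a period at most \<open>?N\<close>. That period divides
  \<open>?N!\<close> and hence \<open>M\<close>, so \<open>y^M\<close> acts trivially there and
  \<open>x y^M\<close> moves the orbit exactly as \<open>x\<close> does.\<close>

lemma finite_orbit_transvection:
  assumes H: "subgroup H (FG A)" "fin_gen_subgroup H (FG A)"
    and xy: "x \<in> A" "y \<in> A" and M: "fact (card (coset H ` core A H)) dvd M" "0 < M"
    and g: "g \<in> finite_orbit A H (gen x * gen y ^ M)"
  shows "g \<in> finite_orbit A H (gen x)" "g * gen x \<in> finite_orbit A H (gen y)"
proof -
  let ?N = "card (coset H ` core A H)" and ?a = "gen x * gen y ^ M"
  \<comment> \<open>The stretch \<open>y^M\<close> thus contains the \<open>?N + 1\<close> cosets
    needed for the pigeonhole argument.\<close>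
  have "?N \<le> fact ?N" by (rule fact_ge_self)
  also have "\<dots> \<le> M" using M by (rule dvd_imp_le)
  finally have NM: "?N \<le> M" .
  have period: "\<exists>p. 0 < p \<and> p \<le> ?N \<and> g * gen x * gen y ^ p * inverse (g * gen x) \<in> H"
    if orbit: "g \<in> finite_orbit A H ?a" for g
  proof -
    obtain n where n: "g \<in> Fr A" "0 < n" "g * ?a ^ n * inverse g \<in> H"
      using orbit by (auto simp: finite_orbit_def)
    have in_core: "g * gen x * gen y ^ t \<in> core A H" if "t \<le> M" for t
    proof -
      let ?u = "(x, True) # replicate t (y, True)" and ?v = "replicate (M - t) (y, True)"
      have repl: "mk (replicate k (y, True)) = gen y ^ k" for k
        using mk_wpow[of k "[(y, True)]"] by (simp add: wpow_def concat_replicate_single gen_def)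
      have u: "mk ?u = gen x * gen y ^ t"
        using mk_append[of "[(x, True)]" "replicate t (y, True)"] by (simp add: repl gen_def)
      have uv: "mk ?u * mk ?v = ?a"
        using that by (simp only: u repl mult.assoc flip: power_add) simp
      \<comment> \<open>The closed walk is rotated so that it starts after
        \<open>x y^t\<close>.\<close>
      have "(mk ?u * mk ?v) ^ k * mk ?u = mk ?u * (mk ?v * mk ?u) ^ k" for k
        by (induction k) (simp_all add: mult.assoc)
      then have "?a ^ n * mk ?u = mk ?u * mk (wpow n (?v @ ?u))"
        unfolding uv by (simp only: mk_wpow mk_append)
      then have "mk ?u * mk (wpow n (?v @ ?u)) * inverse (mk ?u) = ?a ^ n * mk ?u * inverse (mk ?u)"
        by simp
      also have "\<dots> = ?a ^ n" by (simp only: mult.assoc fg_right_inverse mult.right_neutral)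
      finally have e: "mk ?u * mk (wpow n (?v @ ?u)) * inverse (mk ?u) = ?a ^ n" .
      have "g * mk ?u * mk (wpow n (?v @ ?u)) * inverse (g * mk ?u)
          = g * (mk ?u * mk (wpow n (?v @ ?u)) * inverse (mk ?u)) * inverse g"
        by (simp only: fg_inverse_mult mult.assoc)
      then have "g * mk ?u * mk (wpow n (?v @ ?u)) * inverse (g * mk ?u) = g * ?a ^ n * inverse g"
        unfolding e .
      moreover have "cyc (wpow n (?v @ ?u))"
      proof (rule cyc_positive)
        show "wpow n (?v @ ?u) \<noteq> []" using n(2) by (cases n) auto
        have "set (wpow n (?v @ ?u)) \<subseteq> {(x, True), (y, True)}"
          by (auto simp: wpow_def)
        then show "snd l" if "l \<in> set (wpow n (?v @ ?u))" for l using that by auto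
      qed
      moreover have "g * mk ?u \<in> Fr A" using n(1) xy unfolding u by simp
      ultimately have "g * mk ?u \<in> core A H"
        using n(3) by (auto simp: core_def intro!: exI[of _ "wpow n (?v @ ?u)"])
      then show ?thesis by (simp add: u mult.assoc)
    qed
    have "coset H (g * gen x * gen y ^ t) \<in> coset H ` core A H" if "t \<le> ?N" for t
      using in_core[of t] that NM by simp
    then show ?thesis
      using coset_repeat[OF H(1) finite_core_cosets[OF H], of "g * gen x" "gen y"] by metis
  qed
  show "g * gen x \<in> finite_orbit A H (gen y)"
    using period[OF g] g xy(1) by (auto simp: finite_orbit_def)
  \<comment> \<open>In terms of cosets: \<open>g x y^M\<close> and \<open>g x\<close> represent the
    same coset of \<open>H\<close>. Iterating this along the orbit gives
    \<open>walk\<close>.\<close>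
  have step: "g * ?a * inverse (gen x) * inverse g \<in> H" if orbit: "g \<in> finite_orbit A H ?a" for g
  proof -
    obtain p where p: "0 < p" "p \<le> ?N" "g * gen x * gen y ^ p * inverse (g * gen x) \<in> H"
      using period[OF orbit] by blast
    have "p dvd M" using dvd_trans[OF dvd_fact[of p ?N] M(1)] p(1,2) by simp
    then obtain k where k: "M = p * k" by (elim dvdE)
    have "(g * gen x * gen y ^ p * inverse (g * gen x)) ^ k \<in> H"
      by (intro subgroup_FG_closed[OF H(1)] p(3))
    then show ?thesis unfolding fg_conj_power k power_mult by (simp add: fg_inverse_mult mult.assoc)
  qed
  have walk: "g * ?a ^ m * inverse (gen x) ^ m * inverse g \<in> H" for m
  proof (induction m)
    case 0
    show ?case using one_in_H[OF H(1)] by simp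
  next
    case (Suc m)
    have "g * ?a ^ m \<in> finite_orbit A H ?a"
      using xy by (intro finite_orbit_mult_right[OF H(1) g]) (simp_all add: power_commutes)
    from step[OF this] Suc
    have "(g * ?a ^ m * ?a * inverse (gen x) * inverse (g * ?a ^ m)) * (g * ?a ^ m * inverse (gen x) ^ m * inverse g) \<in> H"
      by (rule subgroup_FG_closed[OF H(1)])
    then show ?case
      by (simp only: fg_inverse_mult mult.assoc fg_inverse_cancel_left power_Suc2[of ?a] power_Suc[of "inverse (gen x)"])
  qed
  obtain n where n: "g \<in> Fr A" "0 < n" "g * ?a ^ n * inverse g \<in> H"
    using g by (auto simp: finite_orbit_def)
  have "inverse (g * ?a ^ n * inverse (gen x) ^ n * inverse g) * (g * ?a ^ n * inverse g) \<in> H"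
    by (intro subgroup_FG_closed[OF H(1)] walk n(3))
  then have "g * gen x ^ n * inverse g \<in> H"
    by (simp add: fg_inverse_mult mult.assoc fg_inverse_power[symmetric])
  then show "g \<in> finite_orbit A H (gen x)" using n by (auto simp: finite_orbit_def)
qed

section \<open>Transport of subgroups and cosets along automorphisms\<close>

lemma iso_FG_props:
  assumes "\<psi> \<in> iso (FG A) (FG A)"
  shows "group_hom (FG A) (FG A) \<psi>" "inj_on \<psi> (Fr A)" "\<psi> ` Fr A = Fr A"
    and "\<And>g h. g \<in> Fr A \<Longrightarrow> h \<in> Fr A \<Longrightarrow> \<psi> (g * h) = \<psi> g * \<psi> h"
    and "\<And>g. g \<in> Fr A \<Longrightarrow> \<psi> (inverse g) = inverse (\<psi> g)"
    and "\<And>g n. g \<in> Fr A \<Longrightarrow> \<psi> (g ^ n) = \<psi> g ^ n"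
    and "\<And>g. g \<in> Fr A \<Longrightarrow> \<psi> g \<in> Fr A"
proof -
  show "group_hom (FG A) (FG A) \<psi>"
    using assms by (simp add: group_hom_def group_hom_axioms_def iso_def)
  then interpret group_hom "FG A" "FG A" \<psi> .
  show "inj_on \<psi> (Fr A)" "\<psi> ` Fr A = Fr A"
    using assms by (simp_all add: iso_def bij_betw_def)
  show mult: "\<psi> (g * h) = \<psi> g * \<psi> h" if "g \<in> Fr A" "h \<in> Fr A" for g h
    using hom_mult[of g h] that by simp
  show closed: "\<psi> g \<in> Fr A" if "g \<in> Fr A" for g using hom_closed[of g] that by simp
  show "\<psi> (inverse g) = inverse (\<psi> g)" if "g \<in> Fr A" for g
    using hom_inv[of g] that closed by simp
  show "\<psi> (g ^ n) = \<psi> g ^ n" if "g \<in> Fr A" for g n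
    using that hom_one mult by (induction n) simp_all
qed

lemma coset_iso_image:
  assumes "\<psi> \<in> iso (FG A) (FG A)" "H \<subseteq> Fr A" "g \<in> Fr A"
  shows "coset (\<psi> ` H) (\<psi> g) = \<psi> ` coset H g"
  using assms iso_FG_props(4)[OF assms(1)] unfolding coset_def image_image
  by (intro image_cong) (auto simp: subset_iff)

lemma subgroup_iso_image:
  assumes "\<psi> \<in> iso (FG A) (FG A)" "subgroup H (FG A)"
  shows "subgroup (\<psi> ` H) (FG A)"
  by (rule group_hom.subgroup_img_is_subgroup[OF iso_FG_props(1)[OF assms(1)] assms(2)])

lemma fin_gen_iso_image:
  assumes "\<psi> \<in> iso (FG A) (FG A)" "fin_gen_subgroup H (FG A)"
  shows "fin_gen_subgroup (\<psi> ` H) (FG A)"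
proof -
  interpret group_hom "FG A" "FG A" \<psi> by (rule iso_FG_props(1)[OF assms(1)])
  obtain B where B: "finite B" "B \<subseteq> Fr A" "generate (FG A) B = H" "subgroup H (FG A)"
    using assms(2) by (auto simp: fin_gen_subgroup_def)
  have "generate (FG A) (\<psi> ` B) = \<psi> ` H" using generate_img[of B] B by simp
  moreover have "\<psi> ` B \<subseteq> Fr A" using B(2) iso_FG_props(3)[OF assms(1)] by blast
  ultimately show ?thesis
    unfolding fin_gen_subgroup_def
    using B(1) subgroup_iso_image[OF assms(1) B(4)] by (auto intro: exI[of _ "\<psi> ` B"])
qed

lemma infinite_cosets_iso_image:
  assumes "\<psi> \<in> iso (FG A) (FG A)" "H \<subseteq> Fr A" "infinite (coset H ` Fr A)"
  shows "infinite (coset (\<psi> ` H) ` Fr A)"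
proof
  assume "finite (coset (\<psi> ` H) ` Fr A)"
  also have "coset (\<psi> ` H) ` Fr A = (\<lambda>g. coset (\<psi> ` H) (\<psi> g)) ` Fr A"
    unfolding image_image[of "coset (\<psi> ` H)" \<psi> "Fr A", symmetric] iso_FG_props(3)[OF assms(1)] ..
  also have "\<dots> = (\<lambda>Z. \<psi> ` Z) ` (coset H ` Fr A)"
    unfolding image_image by (rule image_cong[OF refl], rule coset_iso_image[OF assms(1,2)])
  finally have "finite ((\<lambda>Z. \<psi> ` Z) ` (coset H ` Fr A))" .
  moreover have "inj_on (\<lambda>Z. \<psi> ` Z) (coset H ` Fr A)"
  proof (rule inj_on_subset[OF inj_on_image])
    show "inj_on \<psi> (\<Union> (Pow (Fr A)))" using iso_FG_props(2)[OF assms(1)] by simp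
    show "coset H ` Fr A \<subseteq> Pow (Fr A)" using assms(2) by (auto simp: coset_def)
  qed
  ultimately show False using assms(3) finite_imageD by blast
qed

lemma finite_orbit_subset_core: "finite_orbit A H (gen x) \<subseteq> core A H"
proof
  fix g assume "g \<in> finite_orbit A H (gen x)"
  then obtain n where n: "g \<in> Fr A" "0 < n" "g * gen x ^ n * inverse g \<in> H"
    by (auto simp: finite_orbit_def)
  have "cyc (wpow n [(x, True)])"
    using n(2) by (intro cyc_positive) (cases n; auto simp: wpow_def)+
  moreover have "mk (wpow n [(x, True)]) = gen x ^ n" by (simp add: mk_wpow gen_def)
  ultimately show "g \<in> core A H"
    using n by (auto simp: core_def intro!: exI[of _ "wpow n [(x, True)]"])
qed

text \<open>An elementary Nielsen move. The letters stay the standard basis, and a change of basis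
  is expressed by moving the subgroups with the inverse automorphism.\<close>

definition transvection :: "'x \<Rightarrow> 'x fg \<Rightarrow> 'x fg \<Rightarrow> 'x fg" where
  "transvection x u = ext_hom (\<lambda>z. if z = x then gen x * u else gen z)"

lemma transvection_simps [simp]:
  "transvection x u (g * h) = transvection x u g * transvection x u h"
  "transvection x u (inverse g) = inverse (transvection x u g)"
  "transvection x u (g ^ n) = transvection x u g ^ n"
  "transvection x u (gen x) = gen x * u"
  "z \<noteq> x \<Longrightarrow> transvection x u (gen z) = gen z"
  by (simp_all add: transvection_def)

lemma transvection_power:
  assumes "x \<noteq> y" "x \<in> A" "y \<in> A"
  shows "transvection x (gen y ^ M) \<in> iso (FG A) (FG A)"
    and "transvection x (inverse (gen y) ^ M) \<in> iso (FG A) (FG A)"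
    and "g \<in> Fr A \<Longrightarrow> transvection x (gen y ^ M) (transvection x (inverse (gen y) ^ M) g) = g"
    and "g \<in> Fr A \<Longrightarrow> transvection x (inverse (gen y) ^ M) (transvection x (gen y ^ M) g) = g"
proof -
  show *: "transvection x (gen y ^ M) (transvection x (inverse (gen y) ^ M) g) = g"
    "transvection x (inverse (gen y) ^ M) (transvection x (gen y ^ M) g) = g"
    if "g \<in> Fr A" for g
  proof -
    have "transvection x (gen y ^ M) (transvection x (inverse (gen y) ^ M) (gen z)) = gen z"
      "transvection x (inverse (gen y) ^ M) (transvection x (gen y ^ M) (gen z)) = gen z" for z
      using assms(1) by (cases "z = x"; simp add: mult.assoc flip: fg_inverse_power)+
    note gens = this
    show "transvection x (gen y ^ M) (transvection x (inverse (gen y) ^ M) g) = g"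
      using that by (induction g rule: Fr_induct) (simp_all add: gens, simp add: transvection_def)
    show "transvection x (inverse (gen y) ^ M) (transvection x (gen y ^ M) g) = g"
      using that by (induction g rule: Fr_induct) (simp_all add: gens, simp add: transvection_def)
  qed
  have closed: "transvection x u g \<in> Fr A" if "u \<in> Fr A" "g \<in> Fr A" for u g
    unfolding transvection_def by (rule ext_hom_Fr[OF _ that(2)]) (use that assms in auto)
  have u: "gen y ^ M \<in> Fr A" "inverse (gen y) ^ M \<in> Fr A" using assms by simp_all
  show "transvection x (gen y ^ M) \<in> iso (FG A) (FG A)"
    unfolding iso_def
    by (auto intro!: homI bij_betwI[of _ _ _ "transvection x (inverse (gen y) ^ M)"] closed u *)
  show "transvection x (inverse (gen y) ^ M) \<in> iso (FG A) (FG A)"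
    unfolding iso_def
    by (auto intro!: homI bij_betwI[of _ _ _ "transvection x (gen y ^ M)"] closed u *)
qed

text \<open>Counts the cosets lying on finite orbits rather than the orbits, so that inclusions of
  \<open>finite_orbit\<close> sets compare the counts. For a letter the set is contained in the
  finite core.\<close>

definition orbit_count :: "'x set \<Rightarrow> 'x fg set \<Rightarrow> 'x fg \<Rightarrow> nat" where
  "orbit_count A H a = card (coset H ` finite_orbit A H a)"

text \<open>Finite orbits of \<open>z\<close> for the moved subgroup correspond to finite orbits of
  the new basis element for \<open>H\<close>. Those form a subset of the old ones: this is the
  transvection lemma for \<open>z = x\<close>, and trivial for the other letters.\<close>

lemma orbit_count_transvection:
  assumes H: "subgroup H (FG A)" "fin_gen_subgroup H (FG A)"
    and xy: "x \<noteq> y" "x \<in> A" "y \<in> A" and M: "fact (card (coset H ` core A H)) dvd M" "0 < M"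
    and z: "z \<in> A"
  defines "H' \<equiv> transvection x (inverse (gen y) ^ M) ` H"
  shows "orbit_count A H' (gen z) \<le> orbit_count A H (transvection x (gen y ^ M) (gen z))"
    and "orbit_count A H (transvection x (gen y ^ M) (gen z)) \<le> orbit_count A H (gen z)"
proof -
  let ?\<tau> = "transvection x (gen y ^ M)" and ?\<tau>' = "transvection x (inverse (gen y) ^ M)"
  have sub: "finite_orbit A H (?\<tau> (gen z)) \<subseteq> finite_orbit A H (gen z)"
  proof (cases "z = x")
    case True
    then show ?thesis using finite_orbit_transvection(1)[OF H xy(2,3) M] by auto
  qed simp
  have fin: "finite (coset H ` finite_orbit A H (gen z))"
    by (rule finite_subset[OF image_mono[OF finite_orbit_subset_core] finite_core_cosets[OF H]])
  show "orbit_count A H (?\<tau> (gen z)) \<le> orbit_count A H (gen z)"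
    unfolding orbit_count_def by (rule card_mono[OF fin image_mono[OF sub]])
  have HA: "H \<subseteq> Fr A" using subgroup_FG_closed(3)[OF H(1)] by blast
  note \<tau> = transvection_power[OF xy]
  have "finite_orbit A H' (gen z) \<subseteq> ?\<tau>' ` finite_orbit A H (?\<tau> (gen z))"
  proof
    fix g assume "g \<in> finite_orbit A H' (gen z)"
    then obtain n where n: "g \<in> Fr A" "0 < n" "g * gen z ^ n * inverse g \<in> H'"
      by (auto simp: finite_orbit_def)
    then obtain h where h: "h \<in> H" "g * gen z ^ n * inverse g = ?\<tau>' h" by (auto simp: H'_def)
    have "?\<tau> (g * gen z ^ n * inverse g) = h" unfolding h(2) using h(1) HA by (intro \<tau>(3)) auto
    then have "?\<tau> g * ?\<tau> (gen z) ^ n * inverse (?\<tau> g) \<in> H" using h(1) by simp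
    moreover have "?\<tau> g \<in> Fr A" by (rule iso_FG_props(7)[OF \<tau>(1) n(1)])
    ultimately have "?\<tau> g \<in> finite_orbit A H (?\<tau> (gen z))" using n(2) by (auto simp: finite_orbit_def)
    then show "g \<in> ?\<tau>' ` finite_orbit A H (?\<tau> (gen z))" using \<tau>(4)[OF n(1)] by (metis imageI)
  qed
  then have "coset H' ` finite_orbit A H' (gen z) \<subseteq> coset H' ` ?\<tau>' ` finite_orbit A H (?\<tau> (gen z))"
    by (rule image_mono)
  also have "\<dots> = (\<lambda>Z. ?\<tau>' ` Z) ` coset H ` finite_orbit A H (?\<tau> (gen z))"
    unfolding image_image H'_def
    by (rule image_cong[OF refl], rule coset_iso_image[OF \<tau>(2) HA]) (simp add: finite_orbit_def)
  finally have *: "coset H' ` finite_orbit A H' (gen z) \<subseteq> (\<lambda>Z. ?\<tau>' ` Z) ` coset H ` finite_orbit A H (?\<tau> (gen z))" .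
  have fin': "finite (coset H ` finite_orbit A H (?\<tau> (gen z)))"
    by (rule finite_subset[OF image_mono[OF sub] fin])
  show "orbit_count A H' (gen z) \<le> orbit_count A H (?\<tau> (gen z))"
    unfolding orbit_count_def
    by (rule order_trans[OF card_mono[OF finite_imageI[OF fin'] *] card_image_le[OF fin']])
qed

text \<open>By minimality the finite orbits of \<open>x y^M\<close> fill those of \<open>x\<close>.
  So \<open>g x^(-1)\<close> lies on one of them, and reading \<open>x\<close> from there arrives at
  \<open>g\<close> on a finite orbit of \<open>y\<close>.\<close>

lemma finite_orbits_agree:
  assumes H: "subgroup H (FG A)" "fin_gen_subgroup H (FG A)"
    and xy: "x \<in> A" "y \<in> A" and M: "fact (card (coset H ` core A H)) dvd M" "0 < M"
    and min: "orbit_count A H (gen x) \<le> orbit_count A H (gen x * gen y ^ M)"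
  shows "finite_orbit A H (gen x) \<subseteq> finite_orbit A H (gen y)"
proof
  let ?a = "gen x * gen y ^ M"
  fix g assume g: "g \<in> finite_orbit A H (gen x)"
  have fin: "finite (coset H ` finite_orbit A H (gen x))"
    by (rule finite_subset[OF image_mono[OF finite_orbit_subset_core] finite_core_cosets[OF H]])
  have "coset H ` finite_orbit A H ?a \<subseteq> coset H ` finite_orbit A H (gen x)"
    using finite_orbit_transvection(1)[OF H xy M] by blast
  then have eq: "coset H ` finite_orbit A H ?a = coset H ` finite_orbit A H (gen x)"
    using min unfolding orbit_count_def by (rule card_seteq[OF fin])
  have "g * inverse (gen x) \<in> finite_orbit A H (gen x)"
    using xy(1) by (intro finite_orbit_mult_right[OF H(1) g]) simp_all
  then have sat: "coset H (g * inverse (gen x)) \<in> coset H ` finite_orbit A H ?a" unfolding eq by simp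
  have "g * inverse (gen x) \<in> finite_orbit A H ?a"
    by (rule coset_image_saturated[OF H(1) _ sat]) (rule finite_orbit_mult_left[OF H(1)])
  then have "g * inverse (gen x) * gen x \<in> finite_orbit A H (gen y)"
    by (rule finite_orbit_transvection(2)[OF H xy M])
  then show "g \<in> finite_orbit A H (gen y)" by (simp add: mult.assoc)
qed

lemma no_finite_orbit:
  assumes H: "subgroup H (FG A)" and inf: "infinite (coset H ` Fr A)"
    and fin: "\<And>x. x \<in> A \<Longrightarrow> finite (coset H ` finite_orbit A H (gen x))"
    and agree: "\<And>x y. x \<in> A \<Longrightarrow> y \<in> A \<Longrightarrow> finite_orbit A H (gen x) \<subseteq> finite_orbit A H (gen y)"
    and x: "x \<in> A"
  shows "finite_orbit A H (gen x) = {}"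
proof (rule ccontr)
  assume "finite_orbit A H (gen x) \<noteq> {}"
  then obtain g where g: "g \<in> finite_orbit A H (gen x)" by blast
  have right: "g * w \<in> finite_orbit A H (gen x)" if "w \<in> Fr A" "g \<in> finite_orbit A H (gen x)" for g w
    using that
  proof (induction w arbitrary: g rule: Fr_induct)
    case (gen y w)
    have "g \<in> finite_orbit A H (gen y)" using agree x gen by blast
    then have "g * gen y \<in> finite_orbit A H (gen y)"
      using gen by (intro finite_orbit_mult_right[OF H]) simp_all
    then have "g * gen y \<in> finite_orbit A H (gen x)" using agree x gen by blast
    then show ?case using gen.IH[of "g * gen y"] by (simp add: mult.assoc)
  next
    case (inv y w)
    have "g \<in> finite_orbit A H (gen y)" using agree x inv by blast
    then have "g * inverse (gen y) \<in> finite_orbit A H (gen y)"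
      using inv by (intro finite_orbit_mult_right[OF H]) simp_all
    then have "g * inverse (gen y) \<in> finite_orbit A H (gen x)" using agree x inv by blast
    then show ?case using inv.IH[of "g * inverse (gen y)"] by (simp add: mult.assoc)
  qed simp
  have "f \<in> finite_orbit A H (gen x)" if "f \<in> Fr A" for f
  proof -
    have "inverse g * f \<in> Fr A" using g that by (simp add: finite_orbit_def)
    from right[OF this g] show ?thesis by simp
  qed
  then have "coset H ` Fr A \<subseteq> coset H ` finite_orbit A H (gen x)" by blast
  then show False using fin[OF x] inf finite_subset by blast
qed

theorem exists_iso_no_finite_orbit:
  assumes A: "finite A"
    and H: "subgroup H (FG A)" "fin_gen_subgroup H (FG A)" "infinite (coset H ` Fr A)"
    and K: "subgroup K (FG A)" "fin_gen_subgroup K (FG A)" "infinite (coset K ` Fr A)"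
  shows "\<exists>\<psi>\<in>iso (FG A) (FG A). \<forall>x\<in>A. finite_orbit A (\<psi> ` H) (gen x) = {} \<and> finite_orbit A (\<psi> ` K) (gen x) = {}"
proof -
  \<comment> \<open>The sum over both subgroups lets one automorphism serve \<open>H\<close> and
    \<open>K\<close>.\<close>
  define \<mu> where "\<mu> \<psi> = (\<Sum>x\<in>A. orbit_count A (\<psi> ` H) (gen x) + orbit_count A (\<psi> ` K) (gen x))"
    for \<psi> :: "'a fg \<Rightarrow> 'a fg"
  have "id \<in> iso (FG A) (FG A)" by (simp add: iso_def hom_def)
  then obtain \<psi> where \<psi>: "\<psi> \<in> iso (FG A) (FG A)" and min: "\<And>\<psi>'. \<psi>' \<in> iso (FG A) (FG A) \<Longrightarrow> \<mu> \<psi> \<le> \<mu> \<psi>'"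
    using ex_has_least_nat[of "\<lambda>\<psi>. \<psi> \<in> iso (FG A) (FG A)" id \<mu>] by blast
  define H1 K1 where "H1 = \<psi> ` H" and "K1 = \<psi> ` K"
  have HA: "H \<subseteq> Fr A" "K \<subseteq> Fr A"
    using subgroup_FG_closed(3)[OF H(1)] subgroup_FG_closed(3)[OF K(1)] by blast+
  have H1: "subgroup H1 (FG A)" "fin_gen_subgroup H1 (FG A)" "infinite (coset H1 ` Fr A)"
    unfolding H1_def using subgroup_iso_image[OF \<psi> H(1)] fin_gen_iso_image[OF \<psi> H(2)]
      infinite_cosets_iso_image[OF \<psi> HA(1) H(3)] by auto
  have K1: "subgroup K1 (FG A)" "fin_gen_subgroup K1 (FG A)" "infinite (coset K1 ` Fr A)"
    unfolding K1_def using subgroup_iso_image[OF \<psi> K(1)] fin_gen_iso_image[OF \<psi> K(2)]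
      infinite_cosets_iso_image[OF \<psi> HA(2) K(3)] by auto
  have agree: "finite_orbit A H1 (gen x) \<subseteq> finite_orbit A H1 (gen y) \<and>
      finite_orbit A K1 (gen x) \<subseteq> finite_orbit A K1 (gen y)" if xy: "x \<in> A" "y \<in> A" for x y
  proof (cases "x = y")
    case False
    \<comment> \<open>The product is divisible by both factorials, so the same move is admissible
      for \<open>H1\<close> and \<open>K1\<close>.\<close>
    define M :: nat where "M = fact (card (coset H1 ` core A H1)) * fact (card (coset K1 ` core A K1))"
    have M: "fact (card (coset H1 ` core A H1)) dvd M" "fact (card (coset K1 ` core A K1)) dvd M" "0 < M"
      by (simp_all add: M_def)
    let ?\<tau> = "transvection x (gen y ^ M)" and ?\<tau>' = "transvection x (inverse (gen y) ^ M)"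
    let ?h = "\<lambda>z. orbit_count A H1 (?\<tau> (gen z))" and ?k = "\<lambda>z. orbit_count A K1 (?\<tau> (gen z))"
    have "?\<tau>' \<circ> \<psi> \<in> iso (FG A) (FG A)"
      by (rule iso_set_trans[OF \<psi> transvection_power(2)[OF False xy]])
    then have "\<mu> \<psi> \<le> \<mu> (?\<tau>' \<circ> \<psi>)" by (rule min)
    also have "\<dots> \<le> (\<Sum>z\<in>A. ?h z + ?k z)"
      unfolding \<mu>_def image_comp[symmetric] H1_def[symmetric] K1_def[symmetric]
      using orbit_count_transvection(1)[OF H1(1,2) False xy M(1,3)]
        orbit_count_transvection(1)[OF K1(1,2) False xy M(2,3)]
      by (intro sum_mono add_mono)
    finally have total: "(\<Sum>z\<in>A. orbit_count A H1 (gen z) + orbit_count A K1 (gen z)) \<le> (\<Sum>z\<in>A. ?h z + ?k z)"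
      by (simp add: \<mu>_def H1_def K1_def)
    have le: "?h z \<le> orbit_count A H1 (gen z)" "?k z \<le> orbit_count A K1 (gen z)" if "z \<in> A" for z
      using orbit_count_transvection(2)[OF H1(1,2) False xy M(1,3) that]
        orbit_count_transvection(2)[OF K1(1,2) False xy M(2,3) that] by blast+
    \<comment> \<open>The move increases no summand, and the total does not drop; hence every
      summand is unchanged, in particular both parts of the one at \<open>x\<close>.\<close>
    have "?h x + ?k x \<ge> orbit_count A H1 (gen x) + orbit_count A K1 (gen x)"
    proof (rule ccontr)
      assume "\<not> ?thesis"
      then have "(\<Sum>z\<in>A. ?h z + ?k z) < (\<Sum>z\<in>A. orbit_count A H1 (gen z) + orbit_count A K1 (gen z))"
        using xy(1) by (intro sum_strict_mono_ex1[OF A] ballI add_mono le bexI[of _ x]) simp_all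
      then show False using total by simp
    qed
    then have "orbit_count A H1 (gen x) \<le> ?h x" "orbit_count A K1 (gen x) \<le> ?k x"
      using le[OF xy(1)] by linarith+
    then show ?thesis
      using finite_orbits_agree[OF H1(1,2) xy M(1,3)] finite_orbits_agree[OF K1(1,2) xy M(2,3)] by simp
  qed simp
  have fin: "finite (coset H' ` finite_orbit A H' (gen x))"
    if "subgroup H' (FG A)" "fin_gen_subgroup H' (FG A)" for H' x
    by (rule finite_subset[OF image_mono[OF finite_orbit_subset_core] finite_core_cosets[OF that]])
  have "finite_orbit A H1 (gen x) = {} \<and> finite_orbit A K1 (gen x) = {}" if "x \<in> A" for x
    using no_finite_orbit[OF H1(1,3) fin[OF H1(1,2)] _ that] agree
      no_finite_orbit[OF K1(1,3) fin[OF K1(1,2)] _ that] by simp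
  then show ?thesis using \<psi> unfolding H1_def K1_def by blast
qed

theorem exists_conj_faithful_finite_rank:
  fixes A :: "'x set"
  assumes A: "finite A" "2 \<le> card A"
    and H: "subgroup H (FG A)" "fin_gen_subgroup H (FG A)" "infinite (coset H ` Fr A)"
    and K: "subgroup K (FG A)" "fin_gen_subgroup K (FG A)" "infinite (coset K ` Fr A)"
  shows "\<exists>(B :: 'x set) \<eta>. finite B \<and> card B = 2 \<and> conj_faithful (FG A) (FG B) \<eta> H K"
proof -
  obtain \<psi> where \<psi>: "\<psi> \<in> iso (FG A) (FG A)"
    "\<And>x. x \<in> A \<Longrightarrow> finite_orbit A (\<psi> ` H) (gen x) = {}" "\<And>x. x \<in> A \<Longrightarrow> finite_orbit A (\<psi> ` K) (gen x) = {}"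
    using exists_iso_no_finite_orbit[OF A(1) H K] by blast
  have "A \<noteq> {}" using A(2) by auto
  then obtain c where c: "c \<in> A" by blast
  obtain n where n: "avoids c n (\<psi> ` H)"
    by (rule finite_orbit_avoids[OF subgroup_iso_image[OF \<psi>(1) H(1)] fin_gen_iso_image[OF \<psi>(1) H(2)] \<psi>(2)[OF c]])
  obtain m where m: "avoids c m (\<psi> ` K)"
    by (rule finite_orbit_avoids[OF subgroup_iso_image[OF \<psi>(1) K(1)] fin_gen_iso_image[OF \<psi>(1) K(2)] \<psi>(3)[OF c]])
  obtain B :: "'x set" and \<eta> where B: "finite B" "card B = 2" "conj_faithful (FG A) (FG B) \<eta> (\<psi> ` H) (\<psi> ` K)"
    using exists_conj_faithful_rank_2[OF A c subgroup_iso_image[OF \<psi>(1) H(1)] subgroup_iso_image[OF \<psi>(1) K(1)]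
      avoids_mono[OF n, of "max n m"] avoids_mono[OF m, of "max n m"]] by auto
  have "conj_faithful (FG A) (FG A) \<psi> H K"
    using \<psi>(1) subgroup.subset[OF H(1)] subgroup.subset[OF K(1)] by (intro conj_faithful_iso) simp_all
  then have "conj_faithful (FG A) (FG B) (\<eta> \<circ> \<psi>) H K"
    by (rule conj_faithful_comp[OF group_FG group_FG group_FG H(1) K(1) _ B(3)])
  then show ?thesis using B(1,2) by blast
qed

section \<open>Subgroups of free groups are free\<close>

locale free_subgroup =
  fixes L :: "'x fg set"
  assumes L: "subgroup L (FG UNIV)"
begin

text \<open>Any well-founded total relation on letters will do: it makes \<open>lenlex ord\<close>
  well-founded and total, so each coset has a unique least word.\<close>

definition ord :: "('x \<times> bool) rel" where
  "ord = (SOME r. wf r \<and> total r)"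

lemma ord: "wf ord" "total ord"
proof -
  obtain r :: "('x \<times> bool) rel" where "well_order_on UNIV r" using well_order_on by blast
  then have "wf (r - Id)" "total (r - Id)"
    by (auto simp: well_order_on_def linear_order_on_def total_on_def)
  then show "wf ord" "total ord"
    unfolding ord_def by (metis (mono_tags, lifting) someI_ex)+
qed

text \<open>
  The length-lexicographically least words representing the cosets form a prefix-closed
  (Schreier) transversal.
\<close>

definition least_word :: "'x fg \<Rightarrow> 'x word" where
  "least_word g = (SOME w. coset L (mk w) = coset L g \<and>
     (\<forall>v. coset L (mk v) = coset L g \<longrightarrow> (v, w) \<notin> lenlex ord))"

definition rep :: "'x fg \<Rightarrow> 'x fg" where
  "rep g = mk (least_word g)"

lemma least_word:
  "coset L (mk (least_word g)) = coset L g"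
  "coset L (mk v) = coset L g \<Longrightarrow> (v, least_word g) \<notin> lenlex ord"
proof -
  let ?Q = "{w. coset L (mk w) = coset L g}"
  have Q: "word g \<in> ?Q" by simp
  obtain w where "w \<in> ?Q" "\<And>v. (v, w) \<in> lenlex ord \<Longrightarrow> v \<notin> ?Q"
    by (rule wfE_min[OF wf_lenlex[OF ord(1)] Q]) (rule that)
  then have "\<exists>w. coset L (mk w) = coset L g \<and> (\<forall>v. coset L (mk v) = coset L g \<longrightarrow> (v, w) \<notin> lenlex ord)"
    by blast
  from someI_ex[OF this]
  show "coset L (mk (least_word g)) = coset L g"
    "coset L (mk v) = coset L g \<Longrightarrow> (v, least_word g) \<notin> lenlex ord"
    unfolding least_word_def by blast+
qed

lemma least_word_eqI:
  assumes "coset L (mk w) = coset L g" "\<And>v. coset L (mk v) = coset L g \<Longrightarrow> (v, w) \<notin> lenlex ord"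
  shows "least_word g = w"
proof (rule ccontr)
  assume "least_word g \<noteq> w"
  then have "(least_word g, w) \<in> lenlex ord \<or> (w, least_word g) \<in> lenlex ord"
    using total_lenlex[OF ord(2)] by (auto simp: total_on_def)
  then show False using assms least_word by blast
qed

lemma least_word_cong: "coset L g = coset L h \<Longrightarrow> least_word g = least_word h"
  by (rule least_word_eqI) (use least_word in auto)

lemma coset_mult_right: "coset L g = coset L h \<Longrightarrow> coset L (g * a) = coset L (h * a)"
  by (simp add: coset_eq_iff[OF L] fg_inverse_mult mult.assoc)

text \<open>The Schreier property: a smaller representative of the shortened coset would, after
  appending \<open>l\<close>, beat \<open>w @ [l]\<close>.\<close>

lemma least_word_butlast:
  assumes "least_word g = w @ [l]"
  shows "least_word (mk w) = w"
proof (rule least_word_eqI)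
  fix v assume v: "coset L (mk v) = coset L (mk w)"
  show "(v, w) \<notin> lenlex ord"
  proof
    assume "(v, w) \<in> lenlex ord"
    then have "(v @ [l], w @ [l]) \<in> lenlex ord" by (rule lenlex_append1) simp
    moreover have "coset L (mk (v @ [l])) = coset L g"
      using coset_mult_right[OF v, of "mk [l]"] least_word(1)[of g] assms by (simp add: mk_append)
    ultimately show False using least_word(2)[of "v @ [l]" g] assms by simp
  qed
qed simp

lemma coset_rep: "coset L (rep g) = coset L g"
  by (simp add: rep_def least_word)

lemma rep_cong: "coset L g = coset L h \<Longrightarrow> rep g = rep h"
  unfolding rep_def using least_word_cong by metis

lemma rep_rep [simp]: "rep (rep g) = rep g"
  by (rule rep_cong[OF coset_rep])

lemma rep_rep_mult [simp]: "rep (rep g * a) = rep (g * a)"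
  by (rule rep_cong[OF coset_mult_right[OF coset_rep]])

lemma rep_one [simp]: "rep 1 = 1"
proof -
  have "least_word 1 = []" by (rule least_word_eqI) (simp_all add: lenlex_def)
  then show ?thesis by (simp add: rep_def)
qed

lemma rep_in_L: "g \<in> L \<Longrightarrow> rep g = 1"
  using rep_cong[of g 1] by (simp add: coset_eq_iff[OF L] subgroup_FG_closed(4)[OF L])

text \<open>Labels of the edges of the coset graph outside the spanning tree. \<open>\<Psi>\<close>
  sends a label to the Schreier generator in \<open>L\<close> that it stands for.\<close>

definition basis :: "('x fg \<times> 'x) set" where
  "basis = {(t, b). rep t = t \<and> t * gen b \<noteq> rep (t * gen b)}"

definition edge :: "'x fg \<Rightarrow> 'x \<Rightarrow> ('x fg \<times> 'x) fg" where
  "edge t b = (if t * gen b = rep (t * gen b) then 1 else gen (t, b))"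

text \<open>An inverse letter traverses an edge backwards, and an edge is named by its source; hence
  the representative of \<open>t b^(-1)\<close> in the second case.\<close>

definition step :: "'x fg \<Rightarrow> 'x \<times> bool \<Rightarrow> ('x fg \<times> 'x) fg" where
  "step t l = (if snd l then edge t (fst l) else inverse (edge (rep (t * inverse (gen (fst l)))) (fst l)))"

text \<open>Rewriting a path in the coset graph that starts at \<open>t\<close> as a word in the non-tree edges.\<close>

primrec path :: "'x fg \<Rightarrow> 'x word \<Rightarrow> ('x fg \<times> 'x) fg" where
  "path t [] = 1"
| "path t (l # w) = step t l * path (rep (t * mk [l])) w"

lemma path_append: "rep t = t \<Longrightarrow> path t (u @ v) = path t u * path (rep (t * mk u)) v"
proof (induction u arbitrary: t)
  case (Cons l u)
  have "mk (l # u) = mk [l] * mk u" by (simp flip: mk_append)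
  then show ?case using Cons.IH[of "rep (t * mk [l])"] by (simp add: mult.assoc)
qed simp

lemma step_cancel: "rep t = t \<Longrightarrow> step t l * step (rep (t * mk [l])) (linv l) = 1"
  by (cases l) (auto simp: step_def mk_single mult.assoc)

lemma path_lcons:
  assumes "rep t = t"
  shows "path t (lcons l w) = path t (l # w)"
proof (cases "\<exists>w'. w = linv l # w'")
  case True
  then obtain w' where w: "w = linv l # w'" by auto
  have "mk [l] * mk [linv l] = 1"
    using mk_append[of "[l]" "[linv l]"] mk_winv[of "[l]"] by simp
  then have "rep (rep (t * mk [l]) * mk [linv l]) = t" using assms by (simp add: mult.assoc)
  then have "path t (l # w) = (step t l * step (rep (t * mk [l])) (linv l)) * path t w'"
    by (simp add: w mult.assoc)
  then show ?thesis using step_cancel[OF assms] by (simp add: w lcons_def)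
next
  case False
  then have "lcons l w = l # w" by (cases w) (auto simp: lcons_def)
  then show ?thesis by simp
qed

lemma path_reduce: "rep t = t \<Longrightarrow> path t (reduce w) = path t w"
proof (induction w arbitrary: t)
  case (Cons l w)
  then show ?case by (simp add: reduce_Cons path_lcons)
qed simp

lemma path_in_basis: "rep t = t \<Longrightarrow> path t w \<in> Fr basis"
proof (induction w arbitrary: t)
  case (Cons l w)
  have "edge s b \<in> Fr basis" if "rep s = s" for s b
    using that by (auto simp: edge_def basis_def)
  then have "step t l \<in> Fr basis" using Cons.prems by (simp add: step_def)
  then show ?case using Cons.IH by simp
qed simp

text \<open>Reidemeister-Schreier rewriting, with the path starting at the trivial coset.\<close>

definition \<Phi> :: "'x fg \<Rightarrow> ('x fg \<times> 'x) fg" where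
  "\<Phi> g = path 1 (word g)"

definition \<Psi> :: "('x fg \<times> 'x) fg \<Rightarrow> 'x fg" where
  "\<Psi> = ext_hom (\<lambda>(t, b). t * gen b * inverse (rep (t * gen b)))"

lemma \<Psi>_simps [simp]:
  "\<Psi> (g * h) = \<Psi> g * \<Psi> h" "\<Psi> 1 = 1" "\<Psi> (inverse g) = inverse (\<Psi> g)"
  "\<Psi> (gen (t, b)) = t * gen b * inverse (rep (t * gen b))"
  by (simp_all add: \<Psi>_def)

lemma \<Psi>_edge: "\<Psi> (edge t b) = t * gen b * inverse (rep (t * gen b))"
  by (simp add: edge_def)

lemma \<Psi>_path: "rep t = t \<Longrightarrow> \<Psi> (path t w) = t * mk w * inverse (rep (t * mk w))"
proof (induction w arbitrary: t)
  case (Cons l w)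
  have "\<Psi> (step t l) = t * mk [l] * inverse (rep (t * mk [l]))"
    using Cons.prems by (cases l) (simp add: step_def \<Psi>_edge mk_single fg_inverse_mult mult.assoc)
  moreover have "mk (l # w) = mk [l] * mk w" by (simp flip: mk_append)
  ultimately show ?case using Cons.IH[of "rep (t * mk [l])"] by (simp add: mult.assoc)
qed simp

lemma \<Psi>_\<Phi>: "g \<in> L \<Longrightarrow> \<Psi> (\<Phi> g) = g"
  by (simp add: \<Phi>_def \<Psi>_path rep_in_L)

lemma \<Phi>_mult: "g \<in> L \<Longrightarrow> \<Phi> (g * h) = \<Phi> g * \<Phi> h"
  by (simp add: \<Phi>_def times_fg_def word_mk_reduce path_reduce path_append rep_in_L)

text \<open>All prefixes of a least word are least, so the path never leaves the spanning tree and
  every step is trivial.\<close>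

lemma path_least_word: "least_word (mk w) = w \<Longrightarrow> path 1 w = 1"
proof (induction w rule: rev_induct)
  case (snoc l w)
  have least: "least_word (mk w) = w" by (rule least_word_butlast[OF snoc.prems])
  then have w: "rep (mk w) = mk w" by (simp add: rep_def)
  have wl: "rep (mk w * mk [l]) = mk w * mk [l]"
    using snoc.prems by (simp add: rep_def flip: mk_append)
  have "step (mk w) l = 1"
    using w wl by (cases l; cases "snd l") (simp_all add: step_def edge_def mk_single mult.assoc)
  then show ?case using snoc.IH[OF least] w by (simp add: path_append)
qed simp

lemma \<Phi>_rep: "rep t = t \<Longrightarrow> \<Phi> t = 1"
proof -
  assume t: "rep t = t"
  then have "word t = reduce (least_word t)" unfolding rep_def by (metis word_mk_reduce)
  moreover have "least_word (mk (least_word t)) = least_word t"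
    by (rule least_word_cong[OF least_word(1)])
  ultimately show ?thesis using path_least_word by (simp add: \<Phi>_def path_reduce)
qed

text \<open>The path of \<open>t b s^(-1)\<close> runs through the tree along \<open>t\<close> and
  back along \<open>s\<close>; only the edge \<open>(t, b)\<close> between them contributes.\<close>

lemma \<Phi>_basis:
  assumes "(t, b) \<in> basis"
  shows "t * gen b * inverse (rep (t * gen b)) \<in> L"
    and "\<Phi> (t * gen b * inverse (rep (t * gen b))) = gen (t, b)"
proof -
  let ?s = "rep (t * gen b)"
  have t: "rep t = t" "t * gen b \<noteq> ?s" using assms by (auto simp: basis_def)
  show "t * gen b * inverse ?s \<in> L"
    using coset_rep[of "t * gen b"] by (simp add: coset_eq_iff[OF L])
  have inv: "path ?s (winv (word ?s)) = 1"
  proof -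
    have "path 1 (word ?s @ winv (word ?s)) = 1"
      using path_reduce[of 1 "word ?s @ winv (word ?s)"] by (simp add: reduce_append_winv)
    then show ?thesis using \<Phi>_rep[of ?s] by (simp add: path_append \<Phi>_def)
  qed
  have "t * gen b * inverse ?s = mk (word t @ [(b, True)] @ winv (word ?s))"
    using mk_append[of "word t" "[(b, True)] @ winv (word ?s)"] mk_append[of "[(b, True)]" "winv (word ?s)"]
    by (simp add: mk_winv mk_single mult.assoc)
  then have "\<Phi> (t * gen b * inverse ?s) = path 1 (word t @ [(b, True)] @ winv (word ?s))"
    by (simp add: \<Phi>_def word_mk_reduce path_reduce)
  also have "\<dots> = path 1 (word t) * path t ((b, True) # winv (word ?s))"
    using t by (simp add: path_append)
  also have "\<dots> = edge t b"
    using \<Phi>_rep[OF t(1)] inv by (simp add: \<Phi>_def step_def mk_single)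
  finally show "\<Phi> (t * gen b * inverse ?s) = gen (t, b)" using t by (simp add: edge_def)
qed

text \<open>Schreier's theorem. Injectivity comes from the left inverse \<open>\<Psi>\<close>,
  surjectivity from the Schreier generators being mapped to the labels.\<close>

theorem \<Phi>_iso: "\<Phi> \<in> iso ((FG UNIV)\<lparr>carrier := L\<rparr>) (FG basis)"
proof -
  have closed: "\<Phi> g \<in> Fr basis" for g by (simp add: \<Phi>_def path_in_basis)
  have "inj_on \<Phi> L" by (rule inj_on_inverseI[of _ \<Psi>]) (rule \<Psi>_\<Phi>)
  moreover have "\<exists>g\<in>L. \<Phi> g = y" if "y \<in> Fr basis" for y
    using that
  proof (induction y rule: Fr_induct)
    case one
    then show ?case using one_in_H[OF L] by (intro bexI[of _ 1]) (simp_all add: \<Phi>_def)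
  next
    case (gen x y)
    obtain t b where x: "x = (t, b)" by (cases x)
    obtain g where g: "g \<in> L" "\<Phi> g = y" using gen by blast
    show ?case
      using g \<Phi>_basis[of t b] gen(1) x \<Phi>_mult subgroup_FG_closed(1)[OF L]
      by (intro bexI[of _ "t * gen b * inverse (rep (t * gen b)) * g"]) auto
  next
    case (inv x y)
    obtain t b where x: "x = (t, b)" by (cases x)
    let ?x = "t * gen b * inverse (rep (t * gen b))"
    obtain g where g: "g \<in> L" "\<Phi> g = y" using inv by blast
    have xL: "?x \<in> L" "\<Phi> ?x = gen x" using \<Phi>_basis[of t b] inv(1) x by auto
    have "gen x * \<Phi> (inverse ?x * g) = y"
      using \<Phi>_mult[OF xL(1), of "inverse ?x * g"] xL(2) g(2) by simp
    then have "\<Phi> (inverse ?x * g) = inverse (gen x) * y" by (metis fg_inverse_cancel_left(1))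
    moreover have "inverse ?x * g \<in> L"
      by (rule subgroup_FG_closed(1)[OF L subgroup_FG_closed(4)[OF L xL(1)] g(1)])
    ultimately show ?case by blast
  qed
  ultimately have "bij_betw \<Phi> L (Fr basis)" using closed by (auto simp: bij_betw_def)
  moreover have "\<Phi> \<in> hom ((FG UNIV)\<lparr>carrier := L\<rparr>) (FG basis)"
    using closed \<Phi>_mult by (auto simp: hom_def)
  ultimately show ?thesis by (simp add: iso_def)
qed

end

section \<open>Double cosets\<close>

context group
begin

lemma conj_subgroup_inter:
  assumes "H \<subseteq> carrier G" "K \<subseteq> carrier G" "g \<in> carrier G"
  shows "H \<inter> conj_subgroup G g K = {h \<in> H. \<exists>k\<in>K. h \<otimes> g = g \<otimes> k}"
proof -
  have "h = g \<otimes> k \<otimes> inv g \<longleftrightarrow> h \<otimes> g = g \<otimes> k" if "h \<in> H" "k \<in> K" for h k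
    using that assms inv_solve_right[of h "g \<otimes> k" g] by (auto simp: subset_iff)
  then show ?thesis unfolding conj_subgroup_def l_coset_def r_coset_def by blast
qed

lemma conj_subgroup_inter_nontrivial:
  assumes "subgroup H G" "subgroup K G" "g \<in> carrier G"
  shows "H \<inter> conj_subgroup G g K \<noteq> {\<one>} \<longleftrightarrow> (\<exists>h\<in>H. \<exists>k\<in>K. h \<noteq> \<one> \<and> h \<otimes> g = g \<otimes> k)"
proof -
  have "\<one> \<in> {h \<in> H. \<exists>k\<in>K. h \<otimes> g = g \<otimes> k}"
    using assms subgroup.one_closed[OF assms(1)] subgroup.one_closed[OF assms(2)]
    by (auto intro!: bexI[of _ \<one>])
  then show ?thesis
    unfolding conj_subgroup_inter[OF subgroup.subset[OF assms(1)] subgroup.subset[OF assms(2)] assms(3)]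
    by blast
qed

lemma double_coset_iff: "x \<in> double_coset G H g K \<longleftrightarrow> (\<exists>h\<in>H. \<exists>k\<in>K. x = h \<otimes> g \<otimes> k)"
  by (auto simp: double_coset_def r_coset_def set_mult_def)

lemma conjugate_translate:
  assumes "h \<in> carrier G" "k \<in> carrier G" "a \<in> carrier G" "b \<in> carrier G" "s \<in> carrier G" "h \<otimes> s = s \<otimes> k"
  shows "(inv a \<otimes> h \<otimes> a) \<otimes> (inv a \<otimes> s \<otimes> inv b) = (inv a \<otimes> s \<otimes> inv b) \<otimes> (b \<otimes> k \<otimes> inv b)"
proof -
  have "(inv a \<otimes> h \<otimes> a) \<otimes> (inv a \<otimes> s \<otimes> inv b) = inv a \<otimes> (h \<otimes> s) \<otimes> inv b"
    using assms by (simp add: m_assoc) (simp add: m_assoc[symmetric])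
  also have "\<dots> = (inv a \<otimes> s \<otimes> inv b) \<otimes> (b \<otimes> k \<otimes> inv b)"
    unfolding assms(6) using assms(1-5) by (simp add: m_assoc) (simp add: m_assoc[symmetric])
  finally show ?thesis .
qed

end

text \<open>After removing \<open>a\<close> and \<open>b\<close>, the element \<open>f\<close> has
  the same image as \<open>g\<close> and conjugates some non-trivial \<open>h4\<close> to
  \<open>k4\<close>. By reflection along \<open>g\<close>, so does \<open>g\<close>; thus
  \<open>inverse f * g\<close> centralizes \<open>k4\<close> and lies in the kernel. The centralizer
  clause of \<open>conj_faithful\<close> exists for this step.\<close>

lemma conj_faithful_unique_lift:
  fixes L (structure)
  assumes groups: "group L" "group G'" and sL: "subgroup H L" "subgroup K L"
    and cf: "conj_faithful L G' \<eta> H K"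
    and hk: "h \<in> H" "k \<in> K" "h \<noteq> \<one>" and g: "g \<in> carrier L" "h \<otimes> g = g \<otimes> k"
    and h3: "h3 \<in> H" "k3 \<in> K" "h3 \<noteq> \<one>" and sL': "s \<in> carrier L" and h3s: "h3 \<otimes> s = s \<otimes> k3"
    and ab: "a \<in> H" "b \<in> K" "\<eta> s = \<eta> a \<otimes>\<^bsub>G'\<^esub> \<eta> g \<otimes>\<^bsub>G'\<^esub> \<eta> b"
  shows "s = a \<otimes> g \<otimes> b"
proof -
  interpret group_hom L G' \<eta>
    using groups conj_faithful_epi[OF cf] by (simp add: group_hom_def group_hom_axioms_def epi_def)
  have sub: "H \<subseteq> carrier L" "K \<subseteq> carrier L" using subgroup.subset sL by blast+
  have abL: "a \<in> carrier L" "b \<in> carrier L" using ab sub by blast+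
  define f where "f = inv a \<otimes> s \<otimes> inv b"
  have fL: "f \<in> carrier L" unfolding f_def using abL sL' by simp
  have sf: "s = a \<otimes> f \<otimes> b"
    unfolding f_def using abL sL' by (simp add: G.m_assoc) (simp add: G.m_assoc[symmetric])
  have "\<eta> a \<otimes>\<^bsub>G'\<^esub> \<eta> f \<otimes>\<^bsub>G'\<^esub> \<eta> b = \<eta> a \<otimes>\<^bsub>G'\<^esub> \<eta> g \<otimes>\<^bsub>G'\<^esub> \<eta> b"
    unfolding ab(3)[symmetric] using sf abL fL hom_mult[of "a \<otimes> f" b] hom_mult[of a f]
    by simp
  then have \<eta>f: "\<eta> f = \<eta> g"
    using abL fL g(1) by (simp add: H.m_assoc)
  have h3L: "h3 \<in> carrier L" "k3 \<in> carrier L" using h3 sub by blast+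
  define h4 k4 where "h4 = inv a \<otimes> h3 \<otimes> a" and "k4 = b \<otimes> k3 \<otimes> inv b"
  have h4: "h4 \<in> H" "k4 \<in> K"
    unfolding h4_def k4_def using ab h3
    by (simp_all add: subgroup.m_closed[OF sL(1)] subgroup.m_inv_closed[OF sL(1)]
        subgroup.m_closed[OF sL(2)] subgroup.m_inv_closed[OF sL(2)])
  have h4L: "h4 \<in> carrier L" "k4 \<in> carrier L" using h4 sub by blast+
  have conj: "h4 \<otimes> f = f \<otimes> k4"
    unfolding h4_def k4_def f_def using h3s h3L abL sL' by (intro G.conjugate_translate) simp_all
  have "k3 \<noteq> \<one>"
  proof
    assume "k3 = \<one>"
    then have "h3 \<otimes> s = \<one> \<otimes> s" using h3s sL' G.r_one G.l_one by simp
    then have "h3 = \<one>" using h3L sL' G.right_cancel G.one_closed by blast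
    then show False using h3(3) by simp
  qed
  then have k41: "k4 \<noteq> \<one>"
  proof (rule contrapos_nn)
    assume "k4 = \<one>"
    then have "b \<otimes> k3 = b" unfolding k4_def
      using abL h3L G.inv_solve_right[of "\<one>" "b \<otimes> k3" b] by simp
    then show "k3 = \<one>" using abL h3L by (metis G.l_cancel G.one_closed G.r_one)
  qed
  have "\<eta> h4 \<otimes>\<^bsub>G'\<^esub> \<eta> g = \<eta> g \<otimes>\<^bsub>G'\<^esub> \<eta> k4"
    using hom_mult[OF h4L(1) fL] hom_mult[OF fL h4L(2)] conj unfolding \<eta>f by simp
  then have h4g: "h4 \<otimes> g = g \<otimes> k4"
    by (rule conj_faithful_reflect[OF cf hk(1,2) h4 g(1) hk(3) g(2)])
  define c where "c = inv f \<otimes> g"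
  have cL: "c \<in> carrier L" unfolding c_def using fL g(1) by simp
  have "f \<otimes> (c \<otimes> k4) = g \<otimes> k4"
    unfolding c_def using fL g(1) h4L by (simp add: G.m_assoc[symmetric])
  also have "\<dots> = h4 \<otimes> (f \<otimes> c)"
    unfolding h4g[symmetric] c_def using fL g(1) h4L
    by (simp add: G.m_assoc[symmetric, of f "inv f" g])
  also have "\<dots> = f \<otimes> (k4 \<otimes> c)"
    using conj fL cL h4L by (simp add: G.m_assoc[symmetric])
  finally have "c \<otimes> k4 = k4 \<otimes> c" using fL cL h4L by simp
  moreover have "\<eta> c = \<one>\<^bsub>G'\<^esub>"
    unfolding c_def using fL g(1) \<eta>f hom_mult[of "inv f" g] by simp
  ultimately have "c = \<one>" by (rule conj_faithful_centralizer[OF cf h4(2) cL k41])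
  then have "f = g" unfolding c_def using fL g(1) G.inv_solve_left[of "\<one>" f g] by simp
  then show ?thesis using sf by simp
qed

text \<open>Lifting a conjugacy shows that every relevant double coset downstairs comes from a
  relevant one upstairs; the unique lift shows that distinct ones are not merged; reflection gives
  equality of the intersections.\<close>

lemma conj_faithful_double_cosets:
  fixes F (structure)
  assumes F: "group F" and G': "group G'" and HK: "subgroup H F" "subgroup K F"
    and reps: "is_double_coset_reps F H K S"
    and L: "L = subgroup_generated F (H \<union> K \<union> S)" and cf: "conj_faithful L G' \<eta> H K"
  shows "is_double_coset_reps G' (\<eta> ` H) (\<eta> ` K) (\<eta> ` S)"
    and "s \<in> S \<Longrightarrow> \<eta> ` (H \<inter> conj_subgroup F s K) = \<eta> ` H \<inter> conj_subgroup G' (\<eta> s) (\<eta> ` K)"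
proof -
  interpret F: group F by (rule F)
  have epi: "\<eta> \<in> epi L G'" by (rule conj_faithful_epi[OF cf])
  have gL: "group L" unfolding L by simp
  interpret group_hom L G' \<eta>
    using gL G' epi by (simp add: group_hom_def group_hom_axioms_def epi_def)
  have ops [simp]: "monoid.mult L = monoid.mult F" "\<one>\<^bsub>L\<^esub> = \<one>" by (simp_all add: L)
  have S: "S \<subseteq> carrier F" using reps by (simp add: is_double_coset_reps_def)
  have LF: "x \<in> carrier F" if "x \<in> carrier L" for x
    using that F.carrier_subgroup_generated_subset[of "H \<union> K \<union> S"] unfolding L by blast
  have "carrier F \<inter> (H \<union> K \<union> S) \<subseteq> carrier L"
    unfolding L carrier_subgroup_generated by (rule subsetI, rule generate.incl)
  then have sub: "H \<subseteq> carrier L" "K \<subseteq> carrier L" "S \<subseteq> carrier L"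
    using S subgroup.subset[OF HK(1)] subgroup.subset[OF HK(2)] by blast+
  have sL: "subgroup H L" "subgroup K L"
    using F.subgroup_incl[OF HK(1) F.subgroup_subgroup_generated[of "H \<union> K \<union> S"]]
      F.subgroup_incl[OF HK(2) F.subgroup_subgroup_generated[of "H \<union> K \<union> S"]] sub
    unfolding L subgroup_generated_def by simp_all
  have sG': "subgroup (\<eta> ` H) G'" "subgroup (\<eta> ` K) G'"
    using sL by (auto intro: subgroup_img_is_subgroup)
  have nontriv: "\<eta> h \<noteq> \<one>\<^bsub>G'\<^esub>" if "h \<in> H" "h \<noteq> \<one>" for h
    using that conj_faithful_inj[OF cf] subgroup.one_closed[OF HK(1)] hom_one
    by (metis inj_onD ops(2))
  have down: "\<eta> h \<otimes>\<^bsub>G'\<^esub> \<eta> g = \<eta> g \<otimes>\<^bsub>G'\<^esub> \<eta> k"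
    if "h \<in> H" "k \<in> K" "g \<in> carrier L" "h \<otimes> g = g \<otimes> k" for h k g
    using hom_mult[OF subsetD[OF sub(1) that(1)] that(3)] hom_mult[OF that(3) subsetD[OF sub(2) that(2)]]
      that(4) by simp
  have conj_S: "\<exists>h\<in>H. \<exists>k\<in>K. h \<noteq> \<one> \<and> h \<otimes> s = s \<otimes> k" if "s \<in> S" for s
  proof -
    have "H \<inter> conj_subgroup F s K \<noteq> {\<one>}"
      using reps that by (simp add: is_double_coset_reps_def)
    then show ?thesis
      unfolding F.conj_subgroup_inter_nontrivial[OF HK subsetD[OF S that]] .
  qed
  show "\<eta> ` (H \<inter> conj_subgroup F s K) = \<eta> ` H \<inter> conj_subgroup G' (\<eta> s) (\<eta> ` K)" if s: "s \<in> S" for s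
  proof -
    have sL': "s \<in> carrier L" using s sub by blast
    obtain h k where hk: "h \<in> H" "k \<in> K" "h \<noteq> \<one>" "h \<otimes> s = s \<otimes> k" using conj_S[OF s] by blast
    have "h' \<otimes> s = s \<otimes> k'" if "h' \<in> H" "k' \<in> K" "\<eta> h' \<otimes>\<^bsub>G'\<^esub> \<eta> s = \<eta> s \<otimes>\<^bsub>G'\<^esub> \<eta> k'" for h' k'
      using conj_faithful_reflect[OF cf hk(1,2) that(1,2) sL' _ _ that(3)] hk by simp
    then have "\<eta> ` {h \<in> H. \<exists>k\<in>K. h \<otimes> s = s \<otimes> k} = {h \<in> \<eta> ` H. \<exists>k\<in>\<eta> ` K. h \<otimes>\<^bsub>G'\<^esub> \<eta> s = \<eta> s \<otimes>\<^bsub>G'\<^esub> k}"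
      using down sL' by blast
    then show ?thesis
      using F.conj_subgroup_inter[of H K s] H.conj_subgroup_inter[of "\<eta> ` H" "\<eta> ` K" "\<eta> s"] sL' LF
        subgroup.subset[OF HK(1)] subgroup.subset[OF HK(2)] subgroup.subset[OF sG'(1)] subgroup.subset[OF sG'(2)]
      by simp
  qed
  have unique: "\<exists>!t. t \<in> \<eta> ` S \<and> t \<in> double_coset G' (\<eta> ` H) g' (\<eta> ` K)"
    if g': "g' \<in> carrier G'" "\<eta> ` H \<inter> conj_subgroup G' g' (\<eta> ` K) \<noteq> {\<one>\<^bsub>G'\<^esub>}" for g'
  proof -
    obtain h k where hk: "h \<in> H" "k \<in> K" "\<eta> h \<noteq> \<one>\<^bsub>G'\<^esub>" "\<eta> h \<otimes>\<^bsub>G'\<^esub> g' = g' \<otimes>\<^bsub>G'\<^esub> \<eta> k"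
      using g' H.conj_subgroup_inter_nontrivial[OF sG' g'(1)] by blast
    have h1: "h \<noteq> \<one>\<^bsub>L\<^esub>" using hk(3) hom_one by auto
    obtain g where g: "g \<in> carrier L" "\<eta> g = g'" "h \<otimes>\<^bsub>L\<^esub> g = g \<otimes>\<^bsub>L\<^esub> k"
      by (rule conj_faithful_lift[OF cf hk(1,2) g'(1) h1 hk(4)])
    have "H \<inter> conj_subgroup F g K \<noteq> {\<one>}"
      using F.conj_subgroup_inter_nontrivial[OF HK LF[OF g(1)]] hk(1,2) h1 g(3) by auto
    then have ex1: "\<exists>!s. s \<in> S \<and> s \<in> double_coset F H g K"
      using reps LF[OF g(1)] unfolding is_double_coset_reps_def by blast
    \<comment> \<open>The uniqueness half: a representative whose image falls into the double coset
      of \<open>g'\<close> already lies in that of \<open>g\<close>.\<close>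
    have up: "s \<in> double_coset F H g K" if s: "s \<in> S" "\<eta> s \<in> double_coset G' (\<eta> ` H) g' (\<eta> ` K)" for s
    proof -
      have sL': "s \<in> carrier L" using s sub by blast
      obtain a b where ab: "a \<in> H" "b \<in> K" "\<eta> s = \<eta> a \<otimes>\<^bsub>G'\<^esub> g' \<otimes>\<^bsub>G'\<^esub> \<eta> b"
        using s(2) unfolding H.double_coset_iff by blast
      have abL: "a \<in> carrier L" "b \<in> carrier L" using ab sub by blast+
      obtain h3 k3 where h3: "h3 \<in> H" "k3 \<in> K" "h3 \<noteq> \<one>" "h3 \<otimes> s = s \<otimes> k3"
        using conj_S[OF s(1)] by blast
      have "s = a \<otimes>\<^bsub>L\<^esub> g \<otimes>\<^bsub>L\<^esub> b"
        by (rule conj_faithful_unique_lift[OF gL G' sL cf hk(1,2) h1 g(1,3) h3(1,2) _ sL' _ ab(1,2)])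
          (use h3 ab g(2) in simp_all)
      then show ?thesis using ab(1,2) unfolding F.double_coset_iff by auto
    qed
    have dc: "\<eta> s \<in> double_coset G' (\<eta> ` H) g' (\<eta> ` K)" if s: "s \<in> double_coset F H g K" for s
    proof -
      obtain a b where ab: "a \<in> H" "b \<in> K" "s = a \<otimes>\<^bsub>L\<^esub> g \<otimes>\<^bsub>L\<^esub> b"
        using s unfolding F.double_coset_iff by auto
      have "a \<in> carrier L" "b \<in> carrier L" using ab sub by blast+
      then have "\<eta> s = \<eta> a \<otimes>\<^bsub>G'\<^esub> g' \<otimes>\<^bsub>G'\<^esub> \<eta> b" using g(1,2) ab(3) by (simp del: ops)
      then show ?thesis using ab(1,2) unfolding H.double_coset_iff by blast
    qed
    from ex1 obtain s where s: "s \<in> S" "s \<in> double_coset F H g K"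
      and s_unique: "\<And>t. t \<in> S \<Longrightarrow> t \<in> double_coset F H g K \<Longrightarrow> t = s" by blast
    show ?thesis
      using s dc up s_unique by (intro ex1I[of _ "\<eta> s"]) blast+
  qed
  have image: "\<eta> ` S \<subseteq> carrier G'" using sub(3) hom_closed by blast
  have nontrivial: "\<eta> ` H \<inter> conj_subgroup G' (\<eta> s) (\<eta> ` K) \<noteq> {\<one>\<^bsub>G'\<^esub>}" if s: "s \<in> S" for s
  proof -
    obtain h k where hk: "h \<in> H" "k \<in> K" "h \<noteq> \<one>" "h \<otimes> s = s \<otimes> k" using conj_S[OF s] by blast
    have sL': "s \<in> carrier L" using s sub by blast
    have "\<exists>h\<in>\<eta> ` H. \<exists>k\<in>\<eta> ` K. h \<noteq> \<one>\<^bsub>G'\<^esub> \<and> h \<otimes>\<^bsub>G'\<^esub> \<eta> s = \<eta> s \<otimes>\<^bsub>G'\<^esub> k"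
      using nontriv[OF hk(1,3)] down[OF hk(1,2) sL' hk(4)] hk(1,2) by blast
    then show ?thesis using H.conj_subgroup_inter_nontrivial[OF sG' hom_closed[OF sL']] by blast
  qed
  show "is_double_coset_reps G' (\<eta> ` H) (\<eta> ` K) (\<eta> ` S)"
    unfolding is_double_coset_reps_def
  proof (intro conjI ballI impI image)
    fix t assume "t \<in> \<eta> ` S"
    then obtain s where "s \<in> S" "t = \<eta> s" by (rule imageE) simp
    then show "\<eta> ` H \<inter> conj_subgroup G' t (\<eta> ` K) \<noteq> {\<one>\<^bsub>G'\<^esub>}" using nontrivial by simp
  qed (rule unique)
qed

section \<open>Free groups with a given basis\<close>

lemma reduced_words_eq: "reduced_words B = word ` Fr B"
proof -
  have eq: "(\<lambda>(x, a) (y, b). x = y \<longrightarrow> a = b) = (\<lambda>l m. m \<noteq> linv l)"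
    by (auto simp: fun_eq_iff linv_def)
  have "set w \<subseteq> B \<times> UNIV \<longleftrightarrow> fst ` set w \<subseteq> B" for w :: "'a word" by force
  then have "reduced_words B = {w. fst ` set w \<subseteq> B \<and> reduced w}"
    unfolding reduced_words_def reduced_def eq by simp
  also have "\<dots> = word ` Fr B"
  proof (intro equalityI subsetI)
    fix w assume "w \<in> {w. fst ` set w \<subseteq> B \<and> reduced w}"
    then show "w \<in> word ` Fr B" by (intro image_eqI[of _ _ "mk w"]) (auto simp: Fr_def)
  qed (auto simp: Fr_def)
  finally show ?thesis .
qed

lemma free_basis_iso:
  assumes "group G" "free_basis G B"
  shows "(\<lambda>g. word_value G (word g)) \<in> iso (FG B) G"
proof -
  have B: "B \<subseteq> carrier G" "bij_betw (word_value G) (word ` Fr B) (carrier G)"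
    using assms(2) by (simp_all add: free_basis_def reduced_words_eq)
  have "bij_betw word (Fr B) (word ` Fr B)" by (auto simp: bij_betw_def inj_on_def word_inject)
  then have "bij_betw (word_value G \<circ> word) (Fr B) (carrier G)" by (rule bij_betw_trans[OF _ B(2)])
  moreover have "(\<lambda>g. word_value G (word g)) \<in> hom (FG B) G"
    unfolding word_value_eq_gval using B(1) by (intro gval_hom[OF assms(1)]) blast
  ultimately show ?thesis by (simp add: iso_def comp_def)
qed

lemma letter_hom_iso:
  assumes "bij_betw f A B"
  shows "letter_hom f \<in> iso (FG A) (FG B)"
proof -
  have AB: "f ` A = B" "\<And>x. x \<in> A \<Longrightarrow> inv_into A f (f x) = x"
    using assms by (auto simp: bij_betw_def)
  have "letter_hom (inv_into A f) (letter_hom f g) = g" if "g \<in> Fr A" for g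
    using that by (induction g rule: Fr_induct) (simp_all add: AB)
  then have "inj_on (letter_hom f) (Fr A)" by (rule inj_on_inverseI)
  then have "bij_betw (letter_hom f) (Fr A) (Fr B)"
    using letter_hom_image[of f A] AB(1) by (simp add: bij_betw_def)
  moreover have "letter_hom f \<in> hom (FG A) (FG B)"
    using bij_betwE[OF calculation] by (intro homI) simp_all
  ultimately show ?thesis by (simp add: iso_def)
qed

text \<open>An end letter of \<open>g\<close> from \<open>A\<close> can be stripped, conjugating
  \<open>h\<close> or \<open>k\<close> within \<open>Fr A\<close>. If both end letters lie outside
  \<open>A\<close>, neither product cancels, and comparing first letters puts the first letter of
  \<open>g\<close> into \<open>A\<close>.\<close>

lemma Fr_malnormal:
  assumes "h \<in> Fr A" "h \<noteq> 1" "k \<in> Fr A" "h * g = g * k"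
  shows "g \<in> Fr A"
  using assms
proof (induction "length (word g)" arbitrary: g h k rule: less_induct)
  case less
  have k1: "k \<noteq> 1" using less.prems(2,4) by (metis fg_mult_right_cancel mult.left_neutral mult.right_neutral)
  have letter: "mk [l] \<in> Fr A" if "fst l \<in> A" for l using that by (intro mk_in_Fr) simp
  show ?case
  proof (cases "word g = []")
    case True
    then show ?thesis by simp
  next
    case False
    then obtain l v where lv: "word g = l # v" by (cases "word g") auto
    obtain v' l' where lv': "word g = v' @ [l']" using False by (cases "word g" rule: rev_cases) auto
    have red: "reduced v" "reduced v'"
      using reduced_word[of g] lv reduced_appendD[of v' "[l']"] lv' by (auto simp: reduced_Cons simp del: reduced_word)
    have g: "g = mk [l] * mk v" "g = mk v' * mk [l']"
      using lv lv' mk_word[of g] by (simp_all flip: mk_append)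
    consider "fst l \<in> A" | "fst l' \<in> A" | "fst l \<notin> A" "fst l' \<notin> A" by blast
    then show ?thesis
    proof cases
      case 1
      have "mk [l] * (inverse (mk [l]) * h * mk [l] * mk v) = mk [l] * (mk v * k)"
        using less.prems(4) by (simp add: g(1) mult.assoc)
      then have "inverse (mk [l]) * h * mk [l] * mk v = mk v * k" by (simp only: fg_mult_left_cancel)
      moreover have "inverse (mk [l]) * h * mk [l] \<noteq> 1"
      proof
        assume "inverse (mk [l]) * h * mk [l] = 1"
        then have "mk [l] * (inverse (mk [l]) * h * mk [l]) = mk [l]" by simp
        then have "h * mk [l] = 1 * mk [l]" by (simp add: mult.assoc)
        then show False using less.prems(2) by (simp only: fg_mult_right_cancel)
      qed
      ultimately have "mk v \<in> Fr A"
        using letter[OF 1] less.prems lv red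
        by (intro less.hyps[of "mk v" "inverse (mk [l]) * h * mk [l]" k]) simp_all
      then show ?thesis using g(1) letter[OF 1] by simp
    next
      case 2
      have "h * mk v' * mk [l'] = mk v' * (mk [l'] * k * inverse (mk [l'])) * mk [l']"
        using less.prems(4) by (simp add: g(2) mult.assoc)
      then have "h * mk v' = mk v' * (mk [l'] * k * inverse (mk [l']))" by (simp only: fg_mult_right_cancel)
      then have "mk v' \<in> Fr A"
        using letter[OF 2] less.prems lv' red
        by (intro less.hyps[of "mk v'" h "mk [l'] * k * inverse (mk [l'])"]) simp_all
      then show ?thesis using g(2) letter[OF 2] by simp
    next
      case 3
      have ne: "word h \<noteq> []" "word k \<noteq> []" using less.prems(2) k1 by simp_all
      have in_A: "fst m \<in> A" if "m \<in> set (word h) \<union> set (word k)" for m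
        using that less.prems(1,3) by (auto simp: Fr_def)
      have "fst (last (word h)) \<in> A" "fst (hd (word k)) \<in> A" "fst (hd (word h)) \<in> A"
        using ne by (auto intro!: in_A)
      then have "l \<noteq> linv (last (word h))" "hd (word k) \<noteq> linv l'" "hd (word h) \<noteq> l"
        using 3 by auto
      then have "reduced (word h @ word g)" "reduced (word g @ word k)"
        unfolding reduced_append[of "word h"] reduced_append[of "word g"]
        using arg_cong[OF lv, of hd] arg_cong[OF lv', of last] by simp_all
      then have "word h @ word g = word g @ word k"
        using less.prems(4) by (metis word_mult)
      then have "hd (word h) = l" using ne lv by (metis hd_append2 list.sel(1) append_Cons)
      then show ?thesis using \<open>hd (word h) \<noteq> l\<close> by simp
    qed
  qed
qed

lemma subgroup_Fr: "A \<subseteq> B \<Longrightarrow> subgroup (Fr A) (FG B)"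
proof (rule group.subgroupI[OF group_FG])
  show "Fr A \<noteq> {}" using Fr_one by blast
qed (use Fr_mono[of A B] in \<open>auto simp: subset_iff\<close>)

lemma fin_gen_letters:
  assumes "fin_gen_subgroup H (FG E)"
  obtains A where "finite A" "A \<subseteq> E" "H \<subseteq> Fr A"
proof -
  obtain B where B: "finite B" "B \<subseteq> Fr E" "generate (FG E) B = H"
    using assms by (auto simp: fin_gen_subgroup_def)
  define A where "A = (\<Union>b\<in>B. fst ` set (word b))"
  have A: "A \<subseteq> E" using B(2) by (auto simp: A_def Fr_def subset_iff)
  have "B \<subseteq> Fr A" by (auto simp: A_def Fr_def)
  then have "H \<subseteq> Fr A"
    using group.generate_subgroup_incl[OF group_FG _ subgroup_Fr[OF A]] B(3) by blast
  moreover have "finite A" using B(1) by (simp add: A_def)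
  ultimately show ?thesis using that A by blast
qed

text \<open>A non-trivial element is \<open>e^m\<close> with \<open>m \<noteq> 0\<close>, and
  exponents modulo \<open>m\<close> then exhaust the cosets.\<close>

lemma infinite_index_rank_1:
  assumes H: "subgroup H (FG {e})" and inf: "infinite (coset H ` Fr {e})"
  shows "H = {1}"
proof (rule ccontr)
  assume "H \<noteq> {1}"
  then obtain h where h: "h \<in> H" "h \<noteq> 1" using one_in_H[OF H] by blast
  have gen: "gen e = cval e 1" "inverse (gen e) = cval e (- 1)"
    using cval_of_nat[of e 1] by simp_all
  have cval: "\<exists>i. g = cval e i" if "g \<in> Fr {e}" for g
    using that
  proof (induction g rule: Fr_induct)
    case one
    show ?case by (intro exI[of _ 0]) simp
  next
    case (gen x g)
    then show ?case using \<open>gen e = cval e 1\<close> by (metis cval_add singletonD)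
  next
    case (inv x g)
    then show ?case using \<open>inverse (gen e) = cval e (- 1)\<close> by (metis cval_add singletonD)
  qed
  obtain m where m: "h = cval e m" using cval h(1) subgroup_FG_closed(3)[OF H] by blast
  then have "m \<noteq> 0" using h(2) by auto
  have mult: "cval e (m * q) \<in> H" for q
  proof (induction q rule: int_induct[of _ 0])
    case base
    then show ?case using one_in_H[OF H] by simp
  next
    case (step1 q)
    then show ?case using subgroup_FG_closed(1)[OF H step1(2) h(1)] by (simp add: m distrib_left flip: cval_add)
  next
    case (step2 q)
    have "inverse h = cval e (- m)" by (rule fg_inverse_unique) (simp add: m flip: cval_add)
    then show ?case
      using subgroup_FG_closed(1)[OF H step2(2) subgroup_FG_closed(4)[OF H h(1)]]
      by (simp add: right_diff_distrib flip: cval_add)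
  qed
  have "coset H g \<in> (\<lambda>i. coset H (cval e i)) ` {- \<bar>m\<bar>..\<bar>m\<bar>}" if g: "g \<in> Fr {e}" for g
  proof -
    obtain i where i: "g = cval e i" using cval[OF g] by blast
    have "g = cval e (m * (i div m)) * cval e (i mod m)" by (simp add: i flip: cval_add)
    then have "coset H g = coset H (cval e (i mod m))" using coset_mult_left[OF H mult] by simp
    moreover have "\<bar>i mod m\<bar> < \<bar>m\<bar>" by (rule abs_mod_less[OF \<open>m \<noteq> 0\<close>])
    then have "i mod m \<in> {- \<bar>m\<bar>..\<bar>m\<bar>}" by auto
    ultimately show ?thesis by blast
  qed
  then have "coset H ` Fr {e} \<subseteq> (\<lambda>i. coset H (cval e i)) ` {- \<bar>m\<bar>..\<bar>m\<bar>}" by blast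
  then show False using inf finite_subset by blast
qed

section \<open>From abstract groups to groups of words\<close>

lemma
  assumes G: "group G" and \<eta>: "\<eta> \<in> iso G (FG E)" and H: "subgroup H G"
  shows subgroup_image_FG: "subgroup (\<eta> ` H) (FG E)"
    and fin_gen_image_FG: "fin_gen_subgroup H G \<Longrightarrow> fin_gen_subgroup (\<eta> ` H) (FG E)"
    and infinite_index_image_FG: "\<not> finite_index H G \<Longrightarrow> infinite (coset (\<eta> ` H) ` Fr E)"
proof -
  interpret group_hom G "FG E" \<eta>
    using G \<eta> by (simp add: group_hom_def group_hom_axioms_def iso_def)
  have bij: "inj_on \<eta> (carrier G)" "\<eta> ` carrier G = Fr E"
    using \<eta> by (simp_all add: iso_def bij_betw_def)
  show sub: "subgroup (\<eta> ` H) (FG E)" by (rule subgroup_img_is_subgroup[OF H])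
  show "fin_gen_subgroup (\<eta> ` H) (FG E)" if gen: "fin_gen_subgroup H G"
  proof -
    obtain B where B: "finite B" "B \<subseteq> carrier G" "generate G B = H"
      using gen by (auto simp: fin_gen_subgroup_def)
    have "generate (FG E) (\<eta> ` B) = \<eta> ` H" using generate_img[OF B(2)] B(3) by simp
    moreover have "\<eta> ` B \<subseteq> carrier (FG E)" using image_mono[OF B(2), of \<eta>] bij(2) by simp
    ultimately show ?thesis
      unfolding fin_gen_subgroup_def using sub B(1) by (intro conjI exI[of _ "\<eta> ` B"]) simp_all
  qed
  show "infinite (coset (\<eta> ` H) ` Fr E)" if inf: "\<not> finite_index H G"
  proof
    assume fin: "finite (coset (\<eta> ` H) ` Fr E)"
    have HG: "H \<subseteq> carrier G" by (rule subgroup.subset[OF H])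
    have "\<eta> ` (H #>\<^bsub>G\<^esub> a) = coset (\<eta> ` H) (\<eta> a)" if a: "a \<in> carrier G" for a
    proof -
      have "\<eta> (h \<otimes>\<^bsub>G\<^esub> a) = \<eta> h * \<eta> a" if "h \<in> H" for h
        using hom_mult[OF subsetD[OF HG that] a] by simp
      then show ?thesis by (auto simp: r_coset_def coset_def image_iff)
    qed
    then have "(\<lambda>Z. \<eta> ` Z) ` (rcosets\<^bsub>G\<^esub> H) \<subseteq> coset (\<eta> ` H) ` Fr E"
      unfolding bij(2)[symmetric] by (auto simp: RCOSETS_def)
    then have "finite ((\<lambda>Z. \<eta> ` Z) ` (rcosets\<^bsub>G\<^esub> H))" using fin by (rule finite_subset)
    moreover have "inj_on (\<lambda>Z. \<eta> ` Z) (rcosets\<^bsub>G\<^esub> H)"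
    proof (rule inj_on_subset[OF inj_on_image])
      show "inj_on \<eta> (\<Union> (Pow (carrier G)))" using bij(1) by simp
      show "rcosets\<^bsub>G\<^esub> H \<subseteq> Pow (carrier G)"
        using G.r_coset_subset_G[OF HG] by (auto simp: RCOSETS_def)
    qed
    ultimately have "finite (rcosets\<^bsub>G\<^esub> H)" by (rule finite_imageD)
    then show False using inf H by (simp add: finite_index_def)
  qed
qed

text \<open>Reading elements of \<open>F\<close> as reduced words over \<open>B\<close> places
  \<open>L\<close> inside the type \<open>fg\<close>, where Schreier's theorem applies.\<close>

lemma free_iso_FG:
  fixes F :: "('a, 'c) monoid_scheme"
  assumes "group F" "free_basis F B" "subgroup L F"
  obtains E :: "('a fg \<times> 'a) set" and \<eta> where "\<eta> \<in> iso (F\<lparr>carrier := L\<rparr>) (FG E)"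
proof -
  interpret B: group "FG B" by simp
  define j where "j = inv_into (carrier (FG B)) (\<lambda>g. word_value F (word g))"
  have j: "j \<in> iso F (FG B)"
    unfolding j_def by (rule B.iso_set_sym[OF free_basis_iso[OF assms(1,2)]])
  have sub: "subgroup (j ` L) (FG B)" by (rule subgroup_image_FG[OF assms(1) j assms(3)])
  interpret free_subgroup "j ` L"
  proof (rule free_subgroup.intro)
    show "subgroup (j ` L) (FG UNIV)"
      using subgroup_FG_closed[OF sub] one_in_H[OF sub]
      by (intro group.subgroupI) auto
  qed
  have L: "L \<subseteq> carrier F" by (rule subgroup.subset[OF assms(3)])
  have "bij_betw j L (j ` L)"
    using j inj_on_subset[OF _ L, of j] by (simp add: iso_def bij_betw_def)
  moreover have "j \<in> hom (F\<lparr>carrier := L\<rparr>) ((FG UNIV)\<lparr>carrier := j ` L\<rparr>)"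
    using j L by (auto simp: iso_def hom_def subset_iff)
  ultimately have "j \<in> iso (F\<lparr>carrier := L\<rparr>) ((FG UNIV)\<lparr>carrier := j ` L\<rparr>)" by (simp add: iso_def)
  then show ?thesis by (rule that[OF iso_set_trans[OF _ \<Phi>_iso]])
qed

theorem theorem1p1:
  fixes F :: "('a, 'c) monoid_scheme"
    and F2 :: "('b, 'd) monoid_scheme"
    and H K S :: "'a set"
    and L :: "('a, 'c) monoid_scheme"
  assumes "free_group F"
    and "free_group_of_rank F2 2"
    and "fin_gen_subgroup H F"
    and "fin_gen_subgroup K F"
    and "is_double_coset_reps F H K S"
    and "L = subgroup_generated F (H \<union> K \<union> S)"
    and "\<not> finite_index H L"
    and "\<not> finite_index K L"
  shows "\<exists>\<eta> \<in> epi L F2.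
     inj_on \<eta> H \<and> inj_on \<eta> K \<and>
     is_double_coset_reps F2 (\<eta> ` H) (\<eta> ` K) (\<eta> ` S) \<and>
     (\<forall>s\<in>S. \<eta> ` (H \<inter> conj_subgroup F s K) =
              \<eta> ` H \<inter> conj_subgroup F2 (\<eta> s) (\<eta> ` K))"
proof -
  obtain B0 where F: "group F" "free_basis F B0" using assms(1) by (auto simp: free_group_def)
  obtain B2 where F2: "group F2" "free_basis F2 B2" "finite B2" "card B2 = 2"
    using assms(2) by (auto simp: free_group_of_rank_def)
  interpret F: group F by (rule F(1))
  let ?C = "generate F (carrier F \<inter> (H \<union> K \<union> S))"
  have L: "L = F\<lparr>carrier := ?C\<rparr>" by (simp add: assms(6) subgroup_generated_def)
  have HK: "subgroup H F" "subgroup K F" using assms(3,4) by (simp_all add: fin_gen_subgroup_def)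
  have S: "S \<subseteq> carrier F" using assms(5) by (simp add: is_double_coset_reps_def)
  then have HKS: "carrier F \<inter> (H \<union> K \<union> S) = H \<union> K \<union> S"
    using subgroup.subset[OF HK(1)] subgroup.subset[OF HK(2)] by blast
  have C: "subgroup ?C F" by (rule F.generate_is_subgroup) simp
  have subC: "H \<union> K \<union> S \<subseteq> ?C" unfolding HKS by (rule subsetI, rule generate.incl)
  have gL: "group L" unfolding L by (rule F.subgroup_imp_group[OF C])
  have sL: "subgroup H L" "subgroup K L"
    unfolding L using F.subgroup_incl[OF HK(1) C] F.subgroup_incl[OF HK(2) C] subC by simp_all
  have fin_gen_L: "fin_gen_subgroup H' L" if H': "fin_gen_subgroup H' F" "subgroup H' L" "H' \<subseteq> ?C" for H'
  proof -
    obtain B where B: "finite B" "generate F B = H'" using H'(1) by (auto simp: fin_gen_subgroup_def)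
    have "B \<subseteq> H'" unfolding B(2)[symmetric] by (rule subsetI, rule generate.incl)
    then have "generate L B = H'" "B \<subseteq> carrier L"
      using F.generate_consistent[OF _ C, of B] B(2) H'(3) unfolding L by auto
    then show ?thesis using H'(2) B(1) by (auto simp: fin_gen_subgroup_def)
  qed
  obtain E :: "('a fg \<times> 'a) set" and \<phi> where \<phi>: "\<phi> \<in> iso L (FG E)"
    unfolding L by (rule free_iso_FG[OF F C])
  interpret \<phi>: group_hom L "FG E" \<phi>
    using gL \<phi> by (simp add: group_hom_def group_hom_axioms_def iso_def)
  have fgL: "fin_gen_subgroup H L" "fin_gen_subgroup K L"
    using fin_gen_L[OF assms(3) sL(1)] fin_gen_L[OF assms(4) sL(2)] subC by simp_all
  note H1 = subgroup_image_FG[OF gL \<phi> sL(1)] fin_gen_image_FG[OF gL \<phi> sL(1) fgL(1)]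
    infinite_index_image_FG[OF gL \<phi> sL(1) assms(7)]
  note K1 = subgroup_image_FG[OF gL \<phi> sL(2)] fin_gen_image_FG[OF gL \<phi> sL(2) fgL(2)]
    infinite_index_image_FG[OF gL \<phi> sL(2) assms(8)]
  have inj: "inj_on \<phi> ?C" and onto: "\<phi> ` ?C = Fr E"
    using \<phi> unfolding L by (simp_all add: iso_def bij_betw_def)
  have conj_S: "\<exists>h\<in>\<phi> ` H. \<exists>k\<in>\<phi> ` K. h \<noteq> 1 \<and> h * \<phi> s = \<phi> s * k" if s: "s \<in> S" for s
  proof -
    have "H \<inter> conj_subgroup F s K \<noteq> {\<one>\<^bsub>F\<^esub>}" using assms(5) s by (simp add: is_double_coset_reps_def)
    then obtain h k where hk: "h \<in> H" "k \<in> K" "h \<noteq> \<one>\<^bsub>F\<^esub>" "h \<otimes>\<^bsub>F\<^esub> s = s \<otimes>\<^bsub>F\<^esub> k"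
      unfolding F.conj_subgroup_inter_nontrivial[OF HK subsetD[OF S s]] by blast
    have C': "h \<in> ?C" "k \<in> ?C" "s \<in> ?C" using hk(1,2) s subC by blast+
    have "\<phi> h * \<phi> s = \<phi> s * \<phi> k"
      using \<phi>.hom_mult[of h s] \<phi>.hom_mult[of s k] C' hk(4) unfolding L by simp
    moreover have "\<phi> h \<noteq> 1"
      using inj_onD[OF inj, of h "\<one>\<^bsub>F\<^esub>"] C'(1) subgroup.one_closed[OF C] \<phi>.hom_one hk(3) unfolding L by auto
    ultimately show ?thesis using hk(1,2) by blast
  qed
  \<comment> \<open>\<open>L\<close> is generated by \<open>H\<close>, \<open>K\<close> and
    \<open>S\<close>, so letters that suffice for these three sets suffice for everything. This
    serves both the finiteness of \<open>E\<close> and the lower bound on its size.\<close>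
  have gen_E: "Fr E \<subseteq> Fr A" if A: "A \<subseteq> E" "\<phi> ` H \<subseteq> Fr A" "\<phi> ` K \<subseteq> Fr A" "\<phi> ` S \<subseteq> Fr A" for A
  proof -
    have "generate L (H \<union> K \<union> S) = ?C"
      unfolding L using F.generate_consistent[OF subC C] HKS by simp
    then have "generate (FG E) (\<phi> ` (H \<union> K \<union> S)) = Fr E"
      using \<phi>.generate_img[of "H \<union> K \<union> S"] subC onto unfolding L by simp
    moreover have "generate (FG E) (\<phi> ` (H \<union> K \<union> S)) \<subseteq> Fr A"
      using A by (intro group.generate_subgroup_incl[OF group_FG _ subgroup_Fr]) auto
    ultimately show ?thesis by simp
  qed
  have "finite E"
  proof -
    obtain A1 where A1: "finite A1" "A1 \<subseteq> E" "\<phi> ` H \<subseteq> Fr A1" by (rule fin_gen_letters[OF H1(2)])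
    obtain A2 where A2: "finite A2" "A2 \<subseteq> E" "\<phi> ` K \<subseteq> Fr A2" by (rule fin_gen_letters[OF K1(2)])
    have HA: "\<phi> ` H \<subseteq> Fr (A1 \<union> A2)" and KA: "\<phi> ` K \<subseteq> Fr (A1 \<union> A2)"
      using A1(3) A2(3) Fr_mono[of A1 "A1 \<union> A2"] Fr_mono[of A2 "A1 \<union> A2"] by auto
    have "\<phi> s \<in> Fr (A1 \<union> A2)" if "s \<in> S" for s
      using conj_S[OF that] HA KA Fr_malnormal by blast
    then have sub: "Fr E \<subseteq> Fr (A1 \<union> A2)" using A1(2) A2(2) HA KA by (intro gen_E) auto
    have "x \<in> A1 \<union> A2" if "x \<in> E" for x
      using subsetD[OF sub, of "gen x"] that unfolding gen_in_Fr by simp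
    then have "E \<subseteq> A1 \<union> A2" by blast
    then show ?thesis using A1(1) A2(1) by (meson finite_UnI finite_subset)
  qed
  \<comment> \<open>In rank at most 1, infinite index forces both subgroups to be trivial. Then no
    double coset is relevant, \<open>S\<close> is empty and \<open>L\<close> is trivial, which
    contradicts the infinite number of cosets.\<close>
  have "2 \<le> card E"
  proof (rule ccontr)
    assume "\<not> 2 \<le> card E"
    then have "card E = 0 \<or> card E = 1" by linarith
    then have "E = {} \<or> (\<exists>e. E = {e})" using \<open>finite E\<close> by (auto simp: card_1_singleton_iff)
    then have trivial: "\<phi> ` H = {1} \<and> \<phi> ` K = {1}"
    proof
      assume "E = {}"
      then have "Fr E = {1}" by (auto simp: Fr_def)
      then show ?thesis using H1(3) by simp
    next
      assume "\<exists>e. E = {e}"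
      then obtain e where "E = {e}" by blast
      then show ?thesis
        using infinite_index_rank_1[of "\<phi> ` H" e] infinite_index_rank_1[of "\<phi> ` K" e] H1(1,3) K1(1,3)
        by simp
    qed
    then have "S = {}" using conj_S by auto
    then have "Fr E \<subseteq> Fr {}" using trivial by (intro gen_E) auto
    then have "Fr E \<subseteq> {1}" by (auto simp: Fr_def)
    then have "finite (Fr E)" by (rule finite_subset) simp
    then show False using H1(3) by simp
  qed
  obtain B :: "('a fg \<times> 'a) set" and \<theta> where B: "finite B" "card B = 2"
    "conj_faithful (FG E) (FG B) \<theta> (\<phi> ` H) (\<phi> ` K)"
    using exists_conj_faithful_finite_rank[OF \<open>finite E\<close> \<open>2 \<le> card E\<close> H1 K1] by blast
  \<comment> \<open>\<open>F2\<close> is an arbitrary structure over another type; a bijection of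
    the two bases carries the group of words over \<open>B\<close> to it.\<close>
  obtain f where f: "bij_betw f B B2"
    using finite_same_card_bij[OF B(1) F2(3)] B(2) F2(4) by auto
  define \<gamma> where "\<gamma> = (\<lambda>g. word_value F2 (word g)) \<circ> letter_hom f"
  have \<gamma>: "\<gamma> \<in> iso (FG B) F2"
    unfolding \<gamma>_def by (rule iso_set_trans[OF letter_hom_iso[OF f] free_basis_iso[OF F2(1,2)]])
  have cf1: "conj_faithful L (FG E) \<phi> H K"
    using subgroup.subset[OF sL(1)] subgroup.subset[OF sL(2)] by (rule conj_faithful_iso[OF gL group_FG \<phi>])
  have cf2: "conj_faithful L (FG B) (\<theta> \<circ> \<phi>) H K"
    by (rule conj_faithful_comp[OF gL group_FG group_FG sL cf1 B(3)])
  have "(\<theta> \<circ> \<phi>) ` carrier L \<subseteq> Fr B" using conj_faithful_epi[OF cf2] by (simp add: epi_def)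
  then have "(\<theta> \<circ> \<phi>) ` H \<subseteq> carrier (FG B)" "(\<theta> \<circ> \<phi>) ` K \<subseteq> carrier (FG B)"
    using image_mono[OF subgroup.subset[OF sL(1)], of "\<theta> \<circ> \<phi>"]
      image_mono[OF subgroup.subset[OF sL(2)], of "\<theta> \<circ> \<phi>"] unfolding FG_simps by (blast intro: order_trans)+
  then have cf3: "conj_faithful (FG B) F2 \<gamma> ((\<theta> \<circ> \<phi>) ` H) ((\<theta> \<circ> \<phi>) ` K)"
    by (rule conj_faithful_iso[OF group_FG F2(1) \<gamma>])
  have cf: "conj_faithful L F2 (\<gamma> \<circ> (\<theta> \<circ> \<phi>)) H K"
    by (rule conj_faithful_comp[OF gL group_FG F2(1) sL cf2 cf3])
  show ?thesis
    using conj_faithful_epi[OF cf] conj_faithful_inj[OF cf]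
      conj_faithful_double_cosets[OF F(1) F2(1) HK assms(5,6) cf]
    by (intro bexI[of _ "\<gamma> \<circ> (\<theta> \<circ> \<phi>)"] conjI ballI) simp_all
qed

end
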